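(* Let $1\le\alpha<2$, $N\ge2$, and let $x\in H^1([0,\delta],\mathcal X)$ be an isolated $\mathbf k$-cluster collision solution of the planar $N$-body problem with $\mathbf k=\{2,3\}$ and collision at $t=0$. Let $\theta_3^+=\lim_{t\to0^+}\theta_3(t)$, where $\theta_3(t)$ is the polar angle of $m_3$ relative to the center of mass of $m_2,m_3$. Let $\sigma=(\sigma_2,\sigma_3)=(\bar\rho_2e^{i\phi_2},\bar\rho_3e^{i\phi_3})$ with $\phi_2=\phi_3+\pi$ be a normalized centered $\mathbf k$-configuration. If $$|\phi_3-\theta_3^+|\le\pi\ \text{ when }\alpha\in(1,2);\qquad|\phi_3-\theta_3^+|<\pi\ \text{ when }\alpha=1,$$ then for $\delta_0,\varepsilon_0>0$ small enough, there is a new path $y\in H^1([0,\delta],\mathcal X)$ satisfying $A_L(y,\delta)<A_L(x,\delta)$ and: (a) $y(t)=x(t)$ for all $t\in[\delta_0,\delta]$; (b) $y(t)$ is collision-free for any $t\in(0,\delta]$; (c) $y|_{[0,\delta_0]}$ is a small deformation of $x|_{[0,\delta_0]}$ with $y(0)=x(0)+\varepsilon_0\sigma$; in particular $y_2(0)\ne y_3(0)$, and $y_k(0)\ne y_j(0)$ for any $k\in\mathbf k$ and $j\notin\mathbf k$.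
   Context: Planar $N$-body problem: masses $m_1,\dots,m_N>0$ at positions $x_j\in\mathbb{C}$ satisfy $m_j\ddot x_j=\partial U/\partial x_j$, where $U(x)=\sum_{1\le j<k\le N}\frac{m_jm_k}{\alpha|x_j-x_k|^\alpha}$. $K(\dot x)=\frac12\sum_jm_j|\dot x_j|^2$, $L=K+U$, $A_L(x,T)=\int_0^TL(x,\dot x)\,dt$. $\mathcal X$ is the set of configurations $x=(x_1,\dots,x_N)$ with $\sum_jm_jx_j=0$. A configuration is collision-free if its positions are pairwise distinct. Let $\mathbf k$ consist of two indices, labelled $2,3$ without loss of generality, $m_0=m_2+m_3$, and $x_0(t)=(m_2x_2(t)+m_3x_3(t))/m_0$. An isolated $\mathbf k$-cluster collision solution (with $\delta>0$) is a path $x\in H^1([0,\delta],\mathcal X)$ such that $x(t)$ is collision-free and solves the equation for $t\in(0,\delta]$, $x_2(0)=x_3(0)=x_0(0)$, and $x_j(0)\ne x_0(0)$ for all $j\notin\mathbf k$. A centered $\mathbf k$-configuration is $\sigma=(\sigma_2,\sigma_3)$ with $m_2\sigma_2+m_3\sigma_3=0$; it is normalized if $m_2|\sigma_2|^2+m_3|\sigma_3|^2=1$. Every normalized centered $\mathbf k$-configuration has the form $(\bar\rho_2e^{i\phi_2},\bar\rho_3e^{i\phi_3})$ with $\phi_2=\phi_3+\pi$, $\bar\rho_2=\sqrt{\frac{m_3}{m_2(m_2+m_3)}}$, $\bar\rho_3=\sqrt{\frac{m_2}{m_3(m_2+m_3)}}$. For a configuration $x$, $x+\varepsilon_0\sigma$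 has $j$-th component $x_j+\varepsilon_0\sigma_j$ if $j\in\mathbf k$ and $x_j$ otherwise. Write $x_j(t)-x_0(t)=\rho_j(t)e^{i\theta_j(t)}$, $j=2,3$, with $\rho_j>0$ and $\theta_j$ continuous on $(0,\delta]$, $\theta_2=\theta_3+\pi$. The limit $\theta_3^+=\lim_{t\to0^+}\theta_3(t)$ exists. *)

theory Defs
  imports "HOL-Analysis.Analysis"
begin

text \<open>
  The bodies are indexed by a finite linearly ordered type \<open>'n\<close>, so that \<open>N = CARD('n)\<close>, and a
  configuration is a vector of complex positions.
\<close>

type_synonym 'n config = "(complex, 'n) vec"

definition collision_free :: "'n::finite config \<Rightarrow> bool" where
  "collision_free x \<longleftrightarrow> (\<forall>j k. j \<noteq> k \<longrightarrow> x $ j \<noteq> x $ k)"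

definition centered_configs :: "('n::finite \<Rightarrow> real) \<Rightarrow> 'n config set" where
  "centered_configs m = {x. (\<Sum>j\<in>UNIV. m j *\<^sub>R x $ j) = 0}"

text \<open>
  This is the potential only at collision-free configurations: at a collision, division by zero
  silently drops the singular terms. See \<open>potential_ext\<close> for the version used in the action.
\<close>

definition potential :: "('n::{finite,linorder} \<Rightarrow> real) \<Rightarrow> real \<Rightarrow> 'n config \<Rightarrow> real" where
  "potential m \<alpha> x =
     (\<Sum>j\<in>UNIV. \<Sum>k\<in>{j<..}. m j * m k / (\<alpha> * norm (x $ j - x $ k) powr \<alpha>))"

definition potential_ext :: "('n::{finite,linorder} \<Rightarrow> real) \<Rightarrow> real \<Rightarrow> 'n config \<Rightarrow> ennreal" where
  "potential_ext m \<alpha> x = (if collision_free x then ennreal (potential m \<alpha> x) else \<infinity>)"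

definition kinetic :: "('n::finite \<Rightarrow> real) \<Rightarrow> 'n config \<Rightarrow> real" where
  "kinetic m v = 1 / 2 * (\<Sum>j\<in>UNIV. m j * (norm (v $ j))\<^sup>2)"

definition lagrangian ::
  "('n::{finite,linorder} \<Rightarrow> real) \<Rightarrow> real \<Rightarrow> 'n config \<Rightarrow> 'n config \<Rightarrow> ennreal" where
  "lagrangian m \<alpha> x v = ennreal (kinetic m v) + potential_ext m \<alpha> x"

text \<open>
  The continuous representatives of the elements of \<open>H\<^sup>1([0,T])\<close>: primitives of square-integrable
  functions.
\<close>

definition H1_path :: "real \<Rightarrow> (real \<Rightarrow> 'a::euclidean_space) \<Rightarrow> bool" where
  "H1_path T x \<longleftrightarrow> (\<exists>v. set_integrable lborel {0..T} v
      \<and> set_integrable lborel {0..T} (\<lambda>t. (norm (v t))\<^sup>2)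
      \<and> (\<forall>t\<in>{0..T}. x t = x 0 + (LINT s:{0..t}|lborel. v s)))"

definition H1_centered_paths ::
  "('n::finite \<Rightarrow> real) \<Rightarrow> real \<Rightarrow> (real \<Rightarrow> 'n config) set" where
  "H1_centered_paths m T = {x. H1_path T x \<and> (\<forall>t\<in>{0..T}. x t \<in> centered_configs m)}"

text \<open>
  A path in \<open>H\<^sup>1\<close> is differentiable almost everywhere and its pointwise derivative is its weak
  derivative, so the values of \<open>vector_derivative\<close> on the exceptional null set do not matter.
  The integral takes values in \<open>[0,\<infinity>]\<close>.
\<close>

definition action ::
  "('n::{finite,linorder} \<Rightarrow> real) \<Rightarrow> real \<Rightarrow> (real \<Rightarrow> 'n config) \<Rightarrow> real \<Rightarrow> ennreal" where
  "action m \<alpha> x T =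
     (\<integral>\<^sup>+t\<in>{0..T}. lagrangian m \<alpha> (x t) (vector_derivative x (at t)) \<partial>lborel)"

text \<open>
  Newton's equations \<open>m\<^sub>j x\<^sub>j'' = \<partial>U/\<partial>x\<^sub>j\<close>, where \<open>\<partial>U/\<partial>x\<^sub>j\<close> is the gradient of \<open>U\<close> with respect to
  \<open>x\<^sub>j\<close> for the real inner product on the complex plane. Derivatives in \<open>t\<close> are one-sided at end points of
  \<open>S\<close> that belong to \<open>S\<close>.
\<close>

definition newton_solution_on ::
  "('n::{finite,linorder} \<Rightarrow> real) \<Rightarrow> real \<Rightarrow> real set \<Rightarrow> (real \<Rightarrow> 'n config) \<Rightarrow> bool" where
  "newton_solution_on m \<alpha> S x \<longleftrightarrow> (\<exists>v a. \<forall>t\<in>S.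
      (x has_vector_derivative v t) (at t within S)
      \<and> (v has_vector_derivative a t) (at t within S)
      \<and> (\<forall>j. GDERIV (\<lambda>z. potential m \<alpha> (\<chi> i. if i = j then z else x t $ i)) (x t $ j)
              :> m j *\<^sub>R a t $ j))"

definition cluster_center :: "('n::finite \<Rightarrow> real) \<Rightarrow> 'n set \<Rightarrow> 'n config \<Rightarrow> complex" where
  "cluster_center m k x = (\<Sum>j\<in>k. m j *\<^sub>R x $ j) /\<^sub>R (\<Sum>j\<in>k. m j)"

definition isolated_cluster_collision_solution ::
  "('n::{finite,linorder} \<Rightarrow> real) \<Rightarrow> real \<Rightarrow> 'n set \<Rightarrow> real \<Rightarrow> (real \<Rightarrow> 'n config) \<Rightarrow> bool" where
  "isolated_cluster_collision_solution m \<alpha> k \<delta> x \<longleftrightarrow>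
     0 < \<delta> \<and> x \<in> H1_centered_paths m \<delta>
     \<and> (\<forall>t\<in>{0<..\<delta>}. collision_free (x t))
     \<and> newton_solution_on m \<alpha> {0<..\<delta>} x
     \<and> (\<forall>j\<in>k. x 0 $ j = cluster_center m k (x 0))
     \<and> (\<forall>j. j \<notin> k \<longrightarrow> x 0 $ j \<noteq> cluster_center m k (x 0))"

text \<open>
  A \<open>k\<close>-configuration is a function on all indices of which only the values on \<open>k\<close> are used.
\<close>

definition normalized_centered_cluster_config ::
  "('n::finite \<Rightarrow> real) \<Rightarrow> 'n set \<Rightarrow> ('n \<Rightarrow> complex) \<Rightarrow> bool" where
  "normalized_centered_cluster_config m k \<sigma> \<longleftrightarrow>
     (\<Sum>j\<in>k. m j *\<^sub>R \<sigma> j) = 0 \<and> (\<Sum>j\<in>k. m j * (norm (\<sigma> j))\<^sup>2) = 1"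

definition add_cluster ::
  "'n::finite set \<Rightarrow> 'n config \<Rightarrow> real \<Rightarrow> ('n \<Rightarrow> complex) \<Rightarrow> 'n config" where
  "add_cluster k x \<epsilon> \<sigma> = (\<chi> j. if j \<in> k then x $ j + \<epsilon> *\<^sub>R \<sigma> j else x $ j)"

definition rho_bar :: "('n::finite \<Rightarrow> real) \<Rightarrow> 'n \<Rightarrow> 'n \<Rightarrow> real" where
  "rho_bar m p q = sqrt (m q / (m p * (m p + m q)))"

end

theory Submission
  imports Defs
begin

text \<open>
  Write \<open>r = x\<^sub>3 - x\<^sub>2\<close> for the relative position of the colliding pair and keep both the centre of mass of
  the pair and the other bodies fixed, so that only the Lagrangian \<open>\<bar>r'\<bar>\<^sup>2 / 2 + \<kappa> / \<bar>r\<bar>\<^sup>\<alpha>\<close> with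
  \<open>\<kappa> = (m\<^sub>2 + m\<^sub>3) / \<alpha>\<close> matters, up to an error \<open>O(\<tau>)\<close> on \<open>[0, \<tau>]\<close>.
  By the arithmetic-geometric mean inequality the pair action of the collision path on \<open>[0, \<tau>]\<close> is at least
  its Jacobi length \<open>sqrt (2 \<kappa>) / \<gamma> * \<bar>r \<tau>\<bar> powr \<gamma>\<close>, where \<open>\<gamma> = 1 - \<alpha> / 2\<close>. The substitution \<open>w = r powr \<gamma>\<close>
  turns the Jacobi metric into the metric of a flat cone in which the angle \<open>\<phi>\<^sub>3 - \<theta>\<^sub>3\<close> becomes
  \<open>\<gamma> (\<phi>\<^sub>3 - \<theta>\<^sub>3)\<close>, and the hypothesis on the angles says exactly that the limit of this angle is smaller than
  a right angle. Hence the straight segment from a point at small distance \<open>b \<bar>w(\<tau>)\<bar>\<close> from the apex,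
  in the direction of \<open>\<sigma>\<close>, to \<open>w(\<tau>)\<close> is shorter than the ray from the apex by an amount of order \<open>b\<close>. Run at zero
  energy this segment takes the time \<open>(1 + O(b)) \<tau>\<close> as \<open>\<tau> \<rightarrow> 0\<close>, because \<open>\<bar>r\<bar> powr (1 + \<alpha> / 2)\<close>
  is asymptotically linear at the collision; rescaling time to \<open>[0, \<tau>]\<close> then costs
  only \<open>O(b\<^sup>2)\<close>. So for a fixed small \<open>b\<close> the gain is of order \<open>\<bar>r \<tau>\<bar> powr \<gamma>\<close>, which dominates \<open>\<tau>\<close>.
  Finally \<open>\<tau>\<close> is determined by \<open>\<epsilon>\<^sub>0\<close> through the intermediate value theorem.
\<close>

section \<open>Paths in H1\<close>

text \<open>For a fixed arc the kinetic share of the action scales like the inverse of the travel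
  time and the potential share like the travel time. Their sum is flat near its minimum, so a timing
  error of order \<open>b\<close> costs only \<open>b\<close> squared, against a gain that is linear
  in \<open>b\<close>. Hence \<open>b\<close> can be fixed from \<alpha> and the limiting angle
  alone, before \<tau> is chosen. The error O(\<tau>) comes only from the far bodies: with the
  centre of mass of the pair kept, the kinetic energy splits exactly. It is beaten because \<tau> is
  comparable to \<open>\<bar>r \<tau>\<bar> powr (1 + \<alpha> / 2)\<close>, whose exponent exceeds
  \<gamma> by \<alpha>. The two cases of the angle hypothesis reflect \<gamma> = 1/2 at \<alpha> =
  1, where the angle pi becomes exactly a right angle on the cone, and \<gamma> < 1/2 for \<alpha> >
  1. Infinite parts common to both actions could not be cancelled, so the action of \<open>x\<close>
  has to be finite. Membership in H1 controls only its kinetic part; conservation of energy supplies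
  the rest.\<close>

lemma AE_zero_if_halfline_integrals_zero:
  fixes f :: "real \<Rightarrow> real"
  assumes f: "integrable lborel f"
    and zero: "\<And>x. (LINT s:{x<..}|lborel. f s) = 0"
  shows "AE t in lborel. f t = 0"
proof -
  have [measurable]: "f \<in> borel_measurable lborel" using f by auto
  \<comment> \<open>\<open>ennreal\<close> sends negative reals to 0, so \<open>p\<close> and
    \<open>n\<close> are the positive and the negative part of \<open>f\<close>. The finite measures
    with these densities agree on all half-lines, hence coincide, and densities are unique almost
    everywhere.\<close>
  define p where "p = (\<lambda>t. ennreal (f t))"
  define n where "n = (\<lambda>t. ennreal (- f t))"
  have mp [measurable]: "p \<in> borel_measurable lborel" and mn [measurable]: "n \<in> borel_measurable lborel"
    unfolding p_def n_def by measurable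
  have fin: "emeasure (density lborel p) {x<..} = ennreal (LINT s|lborel. indicator {x<..} s * max 0 (f s))"
    and fin': "emeasure (density lborel n) {x<..} = ennreal (LINT s|lborel. indicator {x<..} s * max 0 (- f s))" for x
  proof -
    have i: "integrable lborel (\<lambda>s. indicator {x<..} s * max 0 (f s))"
            "integrable lborel (\<lambda>s. indicator {x<..} s * max 0 (- f s))"
      by (rule Bochner_Integration.integrable_bound[OF f]; auto simp: indicator_def)+
    have "emeasure (density lborel p) {x<..} = (\<integral>\<^sup>+s. ennreal (indicator {x<..} s * max 0 (f s)) \<partial>lborel)"
      by (subst emeasure_density) (auto intro!: nn_integral_cong simp: p_def indicator_def max_def ennreal_neg)
    also have "\<dots> = ennreal (LINT s|lborel. indicator {x<..} s * max 0 (f s))"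
      by (rule nn_integral_eq_integral[OF i(1)]) auto
    finally show "emeasure (density lborel p) {x<..} = ennreal (LINT s|lborel. indicator {x<..} s * max 0 (f s))" .
    have "emeasure (density lborel n) {x<..} = (\<integral>\<^sup>+s. ennreal (indicator {x<..} s * max 0 (- f s)) \<partial>lborel)"
      by (subst emeasure_density) (auto intro!: nn_integral_cong simp: n_def indicator_def max_def ennreal_neg)
    also have "\<dots> = ennreal (LINT s|lborel. indicator {x<..} s * max 0 (- f s))"
      by (rule nn_integral_eq_integral[OF i(2)]) auto
    finally show "emeasure (density lborel n) {x<..} = ennreal (LINT s|lborel. indicator {x<..} s * max 0 (- f s))" .
  qed
  have same: "(LINT s|lborel. indicator {x<..} s * max 0 (f s)) = (LINT s|lborel. indicator {x<..} s * max 0 (- f s))" for x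
  proof -
    have i: "integrable lborel (\<lambda>s. indicator {x<..} s * max 0 (f s))"
            "integrable lborel (\<lambda>s. indicator {x<..} s * max 0 (- f s))"
      by (rule Bochner_Integration.integrable_bound[OF f]; auto simp: indicator_def)+
    have "0 = (LINT s|lborel. indicator {x<..} s * max 0 (f s) - indicator {x<..} s * max 0 (- f s))"
      using zero[of x] unfolding set_lebesgue_integral_def
      by (subst (asm) Bochner_Integration.integral_cong[where g = "\<lambda>s. indicator {x<..} s * max 0 (f s) - indicator {x<..} s * max 0 (- f s)", OF refl])
        (simp_all add: max_def algebra_simps)
    then show ?thesis
      by (subst (asm) Bochner_Integration.integral_diff[OF i]) auto
  qed
  have "density lborel p = density lborel n"
    by (rule measure_eqI_lessThan) (auto simp: fin fin' same)
  then have "AE t in lborel. p t = n t"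
    by (intro sigma_finite_measure.density_unique[OF sigma_finite_lborel]) auto
  then show ?thesis
  proof eventually_elim
    case (elim t)
    then have "enn2real (ennreal (f t)) = enn2real (ennreal (- f t))" by (simp add: p_def n_def)
    then show ?case by (cases "0 \<le> f t") (auto simp: ennreal_neg)
  qed
qed

lemma borel_measurable_ennreal_indicator_Ioo:
  fixes f :: "real \<Rightarrow> real"
  assumes "continuous_on {a<..<b} f"
  shows "(\<lambda>t. ennreal (f t) * indicator {a<..<b} t) \<in> borel_measurable lborel"
proof -
  have "(\<lambda>t. indicator {a<..<b} t *\<^sub>R f t) \<in> borel_measurable borel"
    using assms by (intro borel_measurable_continuous_on_indicator) auto
  then have "(\<lambda>t. ennreal (indicator {a<..<b} t *\<^sub>R f t)) \<in> borel_measurable lborel" by simp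
  also have "(\<lambda>t. ennreal (indicator {a<..<b} t *\<^sub>R f t)) = (\<lambda>t. ennreal (f t) * indicator {a<..<b} t)"
    by (auto simp: indicator_def fun_eq_iff)
  finally show ?thesis .
qed

text \<open>Extending the derivative by zero makes it integrable on the whole line, and the gauge
  integral, with its rules for splitting intervals and for the fundamental theorem, replaces the
  Lebesgue integral.\<close>

lemma H1_pathE:
  assumes "H1_path T x"
  obtains u where "integrable lborel u" "integrable lborel (\<lambda>t. (norm (u t))\<^sup>2)"
    "\<And>t. t \<in> {0..T} \<Longrightarrow> x t = x 0 + integral {0..t} u"
proof -
  obtain v where v: "set_integrable lborel {0..T} v" "set_integrable lborel {0..T} (\<lambda>t. (norm (v t))\<^sup>2)"
    "\<And>t. t \<in> {0..T} \<Longrightarrow> x t = x 0 + (LINT s:{0..t}|lborel. v s)"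
    using assms unfolding H1_path_def by blast
  define u where "u = (\<lambda>t. indicator {0..T} t *\<^sub>R v t)"
  show thesis
  proof
    show iu: "integrable lborel u" using v(1) by (simp add: set_integrable_def u_def)
    have "(\<lambda>t. (norm (u t))\<^sup>2) = (\<lambda>t. indicator {0..T} t *\<^sub>R (norm (v t))\<^sup>2)"
      by (auto simp: u_def fun_eq_iff indicator_def)
    then show "integrable lborel (\<lambda>t. (norm (u t))\<^sup>2)" using v(2) by (simp add: set_integrable_def)
    fix t assume t: "t \<in> {0..T}"
    have "set_integrable lborel {0..t} u"
      unfolding set_integrable_def by (rule integrable_mult_indicator[OF _ iu]) auto
    then have "(LINT s:{0..t}|lborel. u s) = integral {0..t} u"
      by (rule set_borel_integral_eq_integral)
    moreover have "(LINT s:{0..t}|lborel. u s) = (LINT s:{0..t}|lborel. v s)"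
      by (rule set_lebesgue_integral_cong) (use t in \<open>auto simp: u_def\<close>)
    ultimately show "x t = x 0 + integral {0..t} u" using v(3)[OF t] by simp
  qed
qed

lemma H1_pathI:
  assumes "integrable lborel u" "integrable lborel (\<lambda>t. (norm (u t))\<^sup>2)"
    "\<And>t. t \<in> {0..T} \<Longrightarrow> x t = x 0 + integral {0..t} u"
  shows "H1_path T x"
  unfolding H1_path_def
proof (intro exI conjI ballI)
  have *: "set_integrable lborel {0..t} u" for t
    unfolding set_integrable_def by (rule integrable_mult_indicator[OF _ assms(1)]) auto
  show "set_integrable lborel {0..T} u" by (rule *)
  show "set_integrable lborel {0..T} (\<lambda>t. (norm (u t))\<^sup>2)"
    unfolding set_integrable_def by (rule integrable_mult_indicator[OF _ assms(2)]) auto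
  fix t assume "t \<in> {0..T}"
  then show "x t = x 0 + (LINT s:{0..t}|lborel. u s)"
    using assms(3)[of t] set_borel_integral_eq_integral(2)[OF *[of t]] by simp
qed

lemma integrable_lborel_imp_integrable_on:
  fixes u :: "real \<Rightarrow> 'a::euclidean_space"
  assumes "integrable lborel u"
  shows "u integrable_on {a..b}"
proof -
  have "set_integrable lborel {a..b} u"
    unfolding set_integrable_def by (rule integrable_mult_indicator[OF _ assms]) auto
  then show ?thesis by (rule set_borel_integral_eq_integral)
qed

lemma H1_path_imp_continuous_on:
  assumes "H1_path T x"
  shows "continuous_on {0..T} x"
proof -
  obtain u where u: "integrable lborel u" "\<And>t. t \<in> {0..T} \<Longrightarrow> x t = x 0 + integral {0..t} u"
    using H1_pathE[OF assms] by blast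
  have "continuous_on {0..T} (\<lambda>t. x 0 + integral {0..t} u)"
    by (intro continuous_intros indefinite_integral_continuous_1 integrable_lborel_imp_integrable_on u)
  then show ?thesis by (rule continuous_on_eq) (rule u(2)[symmetric])
qed

lemma H1_path_mono:
  assumes "H1_path T x" "\<tau> \<le> T"
  shows "H1_path \<tau> x"
proof -
  obtain u where u: "integrable lborel u" "integrable lborel (\<lambda>t. (norm (u t))\<^sup>2)"
    "\<And>t. t \<in> {0..T} \<Longrightarrow> x t = x 0 + integral {0..t} u" using H1_pathE[OF assms(1)] by blast
  show ?thesis using assms(2) by (intro H1_pathI[OF u(1,2)] u(3)) auto
qed

lemma H1_path_add:
  assumes "H1_path T x" "H1_path T y"
  shows "H1_path T (\<lambda>t. x t + y t)"
proof -
  obtain u where u: "integrable lborel u" "integrable lborel (\<lambda>t. (norm (u t))\<^sup>2)"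
    "\<And>t. t \<in> {0..T} \<Longrightarrow> x t = x 0 + integral {0..t} u" using H1_pathE[OF assms(1)] by blast
  obtain v where v: "integrable lborel v" "integrable lborel (\<lambda>t. (norm (v t))\<^sup>2)"
    "\<And>t. t \<in> {0..T} \<Longrightarrow> y t = y 0 + integral {0..t} v" using H1_pathE[OF assms(2)] by blast
  have [measurable]: "u \<in> borel_measurable borel" "v \<in> borel_measurable borel"
    using u(1) v(1) by auto
  show ?thesis
  proof (rule H1_pathI[where u = "\<lambda>t. u t + v t"])
    show "integrable lborel (\<lambda>t. u t + v t)" using u v by auto
    have "integrable lborel (\<lambda>t. 2 * (norm (u t))\<^sup>2 + 2 * (norm (v t))\<^sup>2)" using u v by auto
    then show "integrable lborel (\<lambda>t. (norm (u t + v t))\<^sup>2)"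
    proof (rule Bochner_Integration.integrable_bound, measurable, intro AE_I2)
      fix t
      have "(norm (u t + v t))\<^sup>2 \<le> (norm (u t) + norm (v t))\<^sup>2"
        by (intro power_mono norm_triangle_ineq) auto
      also have "\<dots> \<le> 2 * (norm (u t))\<^sup>2 + 2 * (norm (v t))\<^sup>2"
        using zero_le_power2[of "norm (u t) - norm (v t)"] by (simp add: power2_eq_square algebra_simps)
      finally show "norm ((norm (u t + v t))\<^sup>2) \<le> norm (2 * (norm (u t))\<^sup>2 + 2 * (norm (v t))\<^sup>2)" by simp
    qed
    fix t assume "t \<in> {0..T}"
    then show "x t + y t = x 0 + y 0 + integral {0..t} (\<lambda>t. u t + v t)"
      using u(3)[of t] v(3)[of t] Henstock_Kurzweil_Integration.integral_add[OF
          integrable_lborel_imp_integrable_on[OF u(1)] integrable_lborel_imp_integrable_on[OF v(1)], of 0 t]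
      by simp
  qed
qed

lemma H1_path_bounded_linear:
  fixes x :: "real \<Rightarrow> 'a::euclidean_space" and L :: "'a \<Rightarrow> 'b::euclidean_space"
  assumes "H1_path T x" "bounded_linear L"
  shows "H1_path T (\<lambda>t. L (x t))"
proof -
  interpret L: bounded_linear L by fact
  obtain u where u: "integrable lborel u" "integrable lborel (\<lambda>t. (norm (u t))\<^sup>2)"
    "\<And>t. t \<in> {0..T} \<Longrightarrow> x t = x 0 + integral {0..t} u" using H1_pathE[OF assms(1)] by blast
  obtain K where K: "\<And>z. norm (L z) \<le> norm z * K" using L.bounded by blast
  have [measurable]: "u \<in> borel_measurable borel" using u(1) by auto
  have [measurable]: "L \<in> borel_measurable borel"
    by (intro borel_measurable_continuous_onI L.continuous_on continuous_on_id)
  show ?thesis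
  proof (rule H1_pathI[where u = "\<lambda>t. L (u t)"])
    show "integrable lborel (\<lambda>t. L (u t))" by (rule integrable_bounded_linear[OF assms(2) u(1)])
    have "integrable lborel (\<lambda>t. (norm (u t))\<^sup>2 * K\<^sup>2)" using u(2) by auto
    then show "integrable lborel (\<lambda>t. (norm (L (u t)))\<^sup>2)"
    proof (rule Bochner_Integration.integrable_bound, measurable, intro AE_I2)
      fix t
      have "(norm (L (u t)))\<^sup>2 \<le> (norm (u t) * K)\<^sup>2"
        by (intro power_mono K) auto
      then show "norm ((norm (L (u t)))\<^sup>2) \<le> norm ((norm (u t))\<^sup>2 * K\<^sup>2)" by (simp add: power_mult_distrib)
    qed
    fix t assume "t \<in> {0..T}"
    then show "L (x t) = L (x 0) + integral {0..t} (\<lambda>t. L (u t))"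
      using u(3)[of t] integral_linear[OF integrable_lborel_imp_integrable_on[OF u(1)] assms(2), of 0 t]
      by (simp add: o_def L.add)
  qed
qed

lemma H1_path_concat:
  assumes x: "H1_path T x" and g: "H1_path \<tau> g" and \<tau>: "0 \<le> \<tau>" "\<tau> \<le> T" and eq: "g \<tau> = x \<tau>"
  shows "H1_path T (\<lambda>t. if t \<le> \<tau> then g t else x t)"
proof -
  obtain u where u: "integrable lborel u" "integrable lborel (\<lambda>t. (norm (u t))\<^sup>2)"
    "\<And>t. t \<in> {0..T} \<Longrightarrow> x t = x 0 + integral {0..t} u" using H1_pathE[OF x] by blast
  obtain v where v: "integrable lborel v" "integrable lborel (\<lambda>t. (norm (v t))\<^sup>2)"
    "\<And>t. t \<in> {0..\<tau>} \<Longrightarrow> g t = g 0 + integral {0..t} v" using H1_pathE[OF g] by blast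
  define z where "z = (\<lambda>t. indicator {..\<tau>} t *\<^sub>R v t + indicator {\<tau><..} t *\<^sub>R u t)"
  have iz: "integrable lborel z" unfolding z_def
    by (intro Bochner_Integration.integrable_add integrable_mult_indicator u v) auto
  show ?thesis
  proof (rule H1_pathI[where u = z])
    show "integrable lborel z" by (rule iz)
    have "(\<lambda>t. (norm (z t))\<^sup>2) = (\<lambda>t. indicator {..\<tau>} t *\<^sub>R (norm (v t))\<^sup>2 + indicator {\<tau><..} t *\<^sub>R (norm (u t))\<^sup>2)"
      by (auto simp: z_def fun_eq_iff indicator_def)
    moreover have "integrable lborel \<dots>"
      by (intro Bochner_Integration.integrable_add integrable_mult_indicator u v) auto
    ultimately show "integrable lborel (\<lambda>t. (norm (z t))\<^sup>2)" by simp
    fix t assume t: "t \<in> {0..T}"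
    have e1: "integral {0..t} z = integral {0..t} v" if "t \<le> \<tau>" for t
      by (rule Henstock_Kurzweil_Integration.integral_cong) (use that in \<open>auto simp: z_def\<close>)
    show "(if t \<le> \<tau> then g t else x t) = (if 0 \<le> \<tau> then g 0 else x 0) + integral {0..t} z"
    proof (cases "t \<le> \<tau>")
      case True then show ?thesis using v(3)[of t] t \<tau> e1 by simp
    next
      case False
      have "integral {0..t} z = integral {0..\<tau>} z + integral {\<tau>..t} z"
        by (rule Henstock_Kurzweil_Integration.integral_combine[symmetric])
          (use False \<tau> in \<open>simp_all add: integrable_lborel_imp_integrable_on[OF iz]\<close>)
      also have "integral {\<tau>..t} z = integral {\<tau>..t} u"
        by (rule integral_spike[of "{\<tau>}"]) (auto simp: z_def)
      also have "\<dots> = integral {0..t} u - integral {0..\<tau>} u"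
        using Henstock_Kurzweil_Integration.integral_combine[of 0 \<tau> t u]
          integrable_lborel_imp_integrable_on[OF u(1)] False \<tau> by (simp add: algebra_simps)
      also have "\<dots> = x t - x \<tau>" using u(3)[of t] u(3)[of \<tau>] t \<tau> by (simp add: algebra_simps)
      finally show ?thesis using v(3)[of \<tau>] \<tau> e1[of \<tau>] eq False by simp
    qed
  qed
qed

text \<open>Meant for the new relative motion, which stays away from 0 and so has bounded velocity.
  Nothing is asked of the derivative at the end points, where the reparametrized segment is only
  known to be continuous.\<close>

lemma H1_path_if_bounded_derivative:
  fixes z :: "real \<Rightarrow> 'a::euclidean_space"
  assumes T: "0 \<le> T" and z: "continuous_on {0..T} z"
    and z': "\<And>t. t \<in> {0<..<T} \<Longrightarrow> (z has_vector_derivative z' t) (at t)"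
    and cont: "continuous_on {0<..<T} z'"
    and bound: "\<And>t. t \<in> {0<..<T} \<Longrightarrow> norm (z' t) \<le> B"
  shows "H1_path T z"
proof -
  define u where "u = (\<lambda>t. indicator {0<..<T} t *\<^sub>R z' t)"
  have [measurable]: "u \<in> borel_measurable borel"
    unfolding u_def by (rule borel_measurable_continuous_on_indicator[OF _ cont]) auto
  have B: "norm (u t) \<le> norm (indicator {0..T} t * B)" for t
    using bound[of t] by (auto simp: u_def indicator_def)
  have c: "integrable lborel (\<lambda>t. indicator {0..T} t * (C::real))" for C
    by (intro integrable_mult_left) (simp add: integrable_indicator_iff emeasure_lborel_Icc_eq)
  have iu: "integrable lborel u"
    by (rule Bochner_Integration.integrable_bound[OF c[of B]]) (simp, rule AE_I2, rule B)
  show ?thesis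
  proof (rule H1_pathI[OF iu])
    show "integrable lborel (\<lambda>t. (norm (u t))\<^sup>2)"
    proof (rule Bochner_Integration.integrable_bound[OF c[of "B\<^sup>2"]], measurable, intro AE_I2)
      fix t
      have "(norm (u t))\<^sup>2 \<le> (norm (indicator {0..T} t * B))\<^sup>2" by (intro power_mono B) auto
      also have "\<dots> = indicator {0..T} t * B\<^sup>2" by (auto simp: indicator_def)
      finally show "norm ((norm (u t))\<^sup>2) \<le> norm (indicator {0..T} t * B\<^sup>2)" by (simp add: indicator_def)
    qed
    fix t assume t: "t \<in> {0..T}"
    have "(z' has_integral z t - z 0) {0..t}"
      by (rule fundamental_theorem_of_calculus_interior)
        (use t in \<open>auto intro!: z' continuous_on_subset[OF z]\<close>)
    then have "(u has_integral z t - z 0) {0..t}"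
      by (rule has_integral_spike_finite[of "{0,t}", rotated 2]) (use t in \<open>auto simp: u_def\<close>)
    then show "z t = z 0 + integral {0..t} u" by (simp add: integral_unique)
  qed
qed

text \<open>The classical velocity \<open>w\<close> may blow up at the ends, so its square
  integrability must be inherited from the weak derivative \<open>u\<close>. Both have the same
  integrals over compact subintervals, which forces them to agree almost everywhere.\<close>

lemma H1_path_nn_integral_derivative_finite:
  fixes x :: "real \<Rightarrow> 'a::euclidean_space"
  assumes x: "H1_path T x"
    and w: "\<And>t. t \<in> {0<..<T} \<Longrightarrow> (x has_vector_derivative w t) (at t)"
    and cont: "continuous_on {0<..<T} w"
  shows "(\<integral>\<^sup>+t\<in>{0<..<T}. ennreal ((norm (w t))\<^sup>2) \<partial>lborel) < \<infinity>"
proof -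
  obtain u where u: "integrable lborel u" "integrable lborel (\<lambda>t. (norm (u t))\<^sup>2)"
    "\<And>t. t \<in> {0..T} \<Longrightarrow> x t = x 0 + integral {0..t} u" using H1_pathE[OF x] by blast
  have iu: "u integrable_on {p..q}" for p q
    by (rule integrable_lborel_imp_integrable_on[OF u(1)])
  have AEab: "AE t in lborel. t \<in> {a..b} \<longrightarrow> u t = w t" if ab: "0 < a" "a < b" "b < T" for a b
  proof -
    have cw: "continuous_on {p..q} w" if "a \<le> p" "q \<le> b" for p q
      by (rule continuous_on_subset[OF cont]) (use that ab in auto)
    have iw: "w integrable_on {p..q}" if "a \<le> p" "q \<le> b" for p q
      by (rule integrable_continuous_real[OF cw[OF that]])
    have diff0: "integral {p..b} (\<lambda>t. u t - w t) = 0" if p: "a \<le> p" "p \<le> b" for p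
    proof -
      have "(w has_integral x b - x p) {p..b}"
        by (rule fundamental_theorem_of_calculus) (use p ab in \<open>auto intro!: has_vector_derivative_at_within w\<close>)
      moreover have "integral {p..b} u = x b - x p"
        using Henstock_Kurzweil_Integration.integral_combine[of 0 p b u] iu[of 0 b] u(3)[of b] u(3)[of p] p ab
        by (auto simp: eq_diff_eq add.commute)
      ultimately show ?thesis
        using Henstock_Kurzweil_Integration.integral_diff[OF iu iw[of p b]] p by (simp add: integral_unique)
    qed
    \<comment> \<open>The criterion on half-line integrals concerns real functions, so the
      difference is tested against each basis vector and cut off outside the compact
      interval.\<close>
    have "AE t in lborel. indicator {a..b} t * ((u t - w t) \<bullet> c) = 0" for c
    proof (rule AE_zero_if_halfline_integrals_zero)
      have iw': "integrable lborel (\<lambda>t. indicator {a..b} t *\<^sub>R w t)"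
        using borel_integrable_compact[of "{a..b}" w] cw[of a b] ab
        by (simp add: indicator_scaleR_eq_if) 
      have I: "integrable lborel (\<lambda>t. indicator {a..b} t *\<^sub>R u t - indicator {a..b} t *\<^sub>R w t)"
        by (intro Bochner_Integration.integrable_diff iw' integrable_mult_indicator u) auto
      have "integrable lborel (\<lambda>t. (indicator {a..b} t *\<^sub>R u t - indicator {a..b} t *\<^sub>R w t) \<bullet> c)"
        using I by (rule integrable_inner_left)
      also have "(\<lambda>t. (indicator {a..b} t *\<^sub>R u t - indicator {a..b} t *\<^sub>R w t) \<bullet> c)
        = (\<lambda>t. indicator {a..b} t * ((u t - w t) \<bullet> c))"
        by (auto simp: inner_diff_left algebra_simps)
      finally show i: "integrable lborel (\<lambda>t. indicator {a..b} t * ((u t - w t) \<bullet> c))" .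
      fix p
      show "(LINT s:{p<..}|lborel. indicator {a..b} s * ((u s - w s) \<bullet> c)) = 0"
      proof (cases "p < b")
        case False
        then have "(\<lambda>s. indicator {p<..} s *\<^sub>R (indicator {a..b} s * ((u s - w s) \<bullet> c))) = (\<lambda>s. 0)"
          by (auto simp: indicator_def fun_eq_iff)
        then show ?thesis unfolding set_lebesgue_integral_def by simp
      next
        case True
        \<comment> \<open>The half-line meets \<open>{a..b}\<close> in \<open>{p'..b}\<close>, up to
          the single point \<open>p\<close>.\<close>
        define p' where "p' = max a p"
        have p': "a \<le> p'" "p' \<le> b" using True ab by (auto simp: p'_def)
        let ?h = "\<lambda>s. indicator {a..b} s * ((u s - w s) \<bullet> c)"
        have "(LINT s:{p<..}|lborel. ?h s) = (LINT s:{p'..b}|lborel. ?h s)"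
          unfolding set_lebesgue_integral_def
        proof (rule integral_cong_AE)
          show "(\<lambda>s. indicator {p<..} s *\<^sub>R ?h s) \<in> borel_measurable lborel"
            by (rule borel_measurable_integrable, rule integrable_mult_indicator[OF _ i]) auto
          show "(\<lambda>s. indicator {p'..b} s *\<^sub>R ?h s) \<in> borel_measurable lborel"
            by (rule borel_measurable_integrable, rule integrable_mult_indicator[OF _ i]) auto
          show "AE s in lborel. indicator {p<..} s *\<^sub>R ?h s = indicator {p'..b} s *\<^sub>R ?h s"
            using AE_lborel_singleton[of p]
            by eventually_elim (auto simp: indicator_def p'_def max_def split: if_splits)
        qed
        also have "\<dots> = integral {p'..b} ?h"
          by (rule set_borel_integral_eq_integral, unfold set_integrable_def,
              rule integrable_mult_indicator[OF _ i]) auto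
        also have "\<dots> = integral {p'..b} ((\<lambda>z. z \<bullet> c) \<circ> (\<lambda>s. u s - w s))"
          by (rule Henstock_Kurzweil_Integration.integral_cong) (use p' in auto)
        also have "\<dots> = integral {p'..b} (\<lambda>s. u s - w s) \<bullet> c"
          by (rule integral_linear) (use p' in \<open>auto intro!: Henstock_Kurzweil_Integration.integrable_diff iu iw bounded_linear_inner_left\<close>)
        finally show ?thesis using diff0 p' by simp
      qed
    qed
    then have "AE t in lborel. \<forall>c\<in>Basis. indicator {a..b} t * ((u t - w t) \<bullet> c) = 0"
      by (subst AE_ball_countable) (auto intro: countable_finite)
    then show ?thesis
    proof eventually_elim
      case (elim t)
      show ?case
        by (rule impI, rule euclidean_eqI) (use elim in \<open>simp add: inner_diff_left\<close>)
    qed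
  qed
  \<comment> \<open>The open interval is exhausted by countably many compact ones; those that
    degenerate are empty or a single point.\<close>
  have "AE t in lborel. t \<in> {1 / real (Suc n)..T - 1 / real (Suc n)} \<longrightarrow> u t = w t" for n
  proof (cases "1 / real (Suc n) < T - 1 / real (Suc n)")
    case True then show ?thesis by (intro AEab) auto
  next
    case False
    have "AE t in lborel. t \<noteq> 1 / real (Suc n)" by (rule AE_lborel_singleton)
    then show ?thesis by eventually_elim (use False in auto)
  qed
  then have "AE t in lborel. \<forall>n. t \<in> {1 / real (Suc n)..T - 1 / real (Suc n)} \<longrightarrow> u t = w t"
    by (subst AE_all_countable) blast
  then have AE: "AE t in lborel. t \<in> {0<..<T} \<longrightarrow> u t = w t"
  proof eventually_elim
    case (elim t)
    show ?case
    proof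
      assume t: "t \<in> {0<..<T}"
      then obtain n where "1 / real (Suc n) < min t (T - t)"
        using reals_Archimedean[of "min t (T - t)"] by (auto simp: inverse_eq_divide)
      then show "u t = w t" using spec[OF elim, of n] t by auto
    qed
  qed
  have "(\<integral>\<^sup>+t\<in>{0<..<T}. ennreal ((norm (w t))\<^sup>2) \<partial>lborel) \<le> (\<integral>\<^sup>+t. ennreal ((norm (u t))\<^sup>2) \<partial>lborel)"
    by (rule nn_integral_mono_AE) (use AE in \<open>eventually_elim, auto simp: indicator_def\<close>)
  also have "\<dots> < \<infinity>"
    using u(2) by (subst nn_integral_eq_integral) auto
  finally show ?thesis .
qed

section \<open>Sundman asymptotics of a perturbed binary collision\<close>

lemma has_derivative_norm_powr:
  fixes f :: "'a::real_normed_vector \<Rightarrow> 'b::real_inner"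
  assumes f: "(f has_derivative f') (at x within S)" and nz: "f x \<noteq> 0"
  shows "((\<lambda>x. norm (f x) powr p) has_derivative (\<lambda>h. p * norm (f x) powr (p - 2) * (f x \<bullet> f' h))) (at x within S)"
proof -
  have n: "((\<lambda>x. norm (f x)) has_derivative (\<lambda>h. f' h \<bullet> sgn (f x))) (at x within S)"
    by (rule has_derivative_compose[OF f has_derivative_norm[OF nz]])
  have "norm (f x) powr (p - 1) = norm (f x) powr (p - 2) * norm (f x)"
    using nz powr_add[of "norm (f x)" "p - 2" 1] by simp
  then have "(f' h \<bullet> sgn (f x)) * (p * norm (f x) powr (p - 1)) = p * norm (f x) powr (p - 2) * (f x \<bullet> f' h)" for h
    using nz by (simp add: sgn_div_norm inner_commute)
  moreover have "((\<lambda>x. norm (f x) powr p) has_derivative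
      (\<lambda>h. (f' h \<bullet> sgn (f x)) * (p * norm (f x) powr (p - 1)))) (at x within S)"
    by (rule DERIV_compose_FDERIV[OF has_real_derivative_powr n]) (use nz in simp)
  ultimately show ?thesis by (simp only:)
qed

lemma has_real_derivative_norm_powr:
  fixes r :: "real \<Rightarrow> 'a::real_inner"
  assumes "(r has_vector_derivative v) (at t within S)" "r t \<noteq> 0"
  shows "((\<lambda>t. norm (r t) powr p) has_real_derivative p * norm (r t) powr (p - 2) * (r t \<bullet> v)) (at t within S)"
  using has_derivative_norm_powr[OF assms(1)[unfolded has_vector_derivative_def] assms(2), of p]
  by (simp add: has_field_derivative_def mult_ac mult_commute_abs)

text \<open>The last square is that of the angular momentum of the pair: a bound on it together with
  the energy determines the radial part \<open>r \<bullet> v\<close>.\<close>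

lemma complex_lagrange_identity:
  fixes r v :: complex
  shows "(norm r)\<^sup>2 * (norm v)\<^sup>2 = (r \<bullet> v)\<^sup>2 + (Re r * Im v - Im r * Re v)\<^sup>2"
  unfolding cmod_power2 inner_complex_def by (simp add: power2_eq_square algebra_simps)

lemma nn_integral_finite_imp_integral_bound:
  fixes f :: "real \<Rightarrow> real"
  assumes "(\<integral>\<^sup>+t\<in>{0<..<d}. ennreal (f t) \<partial>lborel) < \<infinity>"
    and "continuous_on {0<..<d} f" "\<And>t. 0 \<le> f t"
  obtains C where "0 \<le> C" "\<And>s t. 0 < s \<Longrightarrow> t < d \<Longrightarrow> integral {s..t} f \<le> C"
proof
  define C where "C = enn2real (\<integral>\<^sup>+t\<in>{0<..<d}. ennreal (f t) \<partial>lborel)"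
  show "0 \<le> C" by (simp add: C_def)
  fix s t :: real assume st: "0 < s" "t < d"
  have "f integrable_on {s..t}"
    by (rule integrable_continuous_real, rule continuous_on_subset[OF assms(2)]) (use st in auto)
  then have "(f has_integral integral {s..t} f) {s..t}" by (rule integrable_integral)
  then have "ennreal (integral {s..t} f) = (\<integral>\<^sup>+t\<in>{s..t}. ennreal (f t) \<partial>lborel)"
    by (rule nn_integral_has_integral_lebesgue'[OF assms(3), symmetric])
  also have "\<dots> \<le> (\<integral>\<^sup>+t\<in>{0<..<d}. ennreal (f t) \<partial>lborel)"
    by (rule nn_integral_mono) (use st in \<open>auto simp: indicator_def\<close>)
  also have "\<dots> = ennreal C" using assms(1) by (simp add: C_def)
  finally show "integral {s..t} f \<le> C" by (simp add: C_def)
qed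

text \<open>
  Sundman's asymptotics. The energy of the pair stays bounded, so the Lagrange--Jacobi identity makes
  \<open>\<bar>r\<bar>\<^sup>2\<close> convex and hence increasing near the collision; the angular momentum is then
  \<open>O(t \<bar>r\<bar>)\<close>, and the energy determines the radial velocity to leading order.
\<close>

lemma perturbed_kepler_collision:
  fixes r v F :: "real \<Rightarrow> complex" and \<alpha> \<kappa> d M :: real
  assumes \<alpha>: "1 \<le> \<alpha>" "\<alpha> < 2" and \<kappa>: "0 < \<kappa>" and d: "0 < d"
    and r: "\<And>t. t \<in> {0<..<d} \<Longrightarrow> (r has_vector_derivative v t) (at t)"
    and v: "\<And>t. t \<in> {0<..<d} \<Longrightarrow>
      (v has_vector_derivative F t - (\<alpha> * \<kappa> * norm (r t) powr (- \<alpha> - 2)) *\<^sub>R r t) (at t)"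
    and F: "\<And>t. t \<in> {0<..<d} \<Longrightarrow> norm (F t) \<le> M"
    and nz: "\<And>t. t \<in> {0<..<d} \<Longrightarrow> r t \<noteq> 0"
    and lim: "(r \<longlongrightarrow> 0) (at_right 0)"
    and fin: "(\<integral>\<^sup>+t\<in>{0<..<d}. ennreal ((norm (v t))\<^sup>2) \<partial>lborel) < \<infinity>"
  shows "\<forall>\<^sub>F t in at_right 0. 0 < r t \<bullet> v t"
    and "((\<lambda>t. norm (r t) powr (1 + \<alpha> / 2) / t) \<longlongrightarrow> (1 + \<alpha> / 2) * sqrt (2 * \<kappa>)) (at_right 0)"
proof -
  have cv: "continuous_on {0<..<d} v"
    by (rule continuous_at_imp_continuous_on) (use v has_vector_derivative_continuous in blast)
  have cv2: "continuous_on {0<..<d} (\<lambda>t. (norm (v t))\<^sup>2)" by (intro continuous_intros cv)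
  obtain C where C: "0 \<le> C" "\<And>s t. 0 < s \<Longrightarrow> t < d \<Longrightarrow> integral {s..t} (\<lambda>t. (norm (v t))\<^sup>2) \<le> C"
    using nn_integral_finite_imp_integral_bound[OF fin cv2] by auto
  have M: "0 \<le> M" using order_trans[OF norm_ge_zero F[of "d / 2"]] d by simp
  \<comment> \<open>The energy of the pair per unit of reduced mass. Only the perturbing force
    \<open>F\<close> changes it, at the rate \<open>v \<bullet> F\<close>.\<close>
  define E where "E = (\<lambda>t. (norm (v t))\<^sup>2 / 2 - \<kappa> * norm (r t) powr (- \<alpha>))"
  have dE: "(E has_real_derivative v t \<bullet> F t) (at t)" if t: "t \<in> {0<..<d}" for t
  proof -
    have 1: "((\<lambda>t. v t \<bullet> v t) has_real_derivative
      2 * (v t \<bullet> (F t - (\<alpha> * \<kappa> * norm (r t) powr (- \<alpha> - 2)) *\<^sub>R r t))) (at t)"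
      using bounded_bilinear.has_vector_derivative[OF bounded_bilinear_inner v[OF t] v[OF t]]
      by (simp add: has_real_derivative_iff_has_vector_derivative inner_commute)
    have "((\<lambda>t. (v t \<bullet> v t) / 2 - \<kappa> * norm (r t) powr (- \<alpha>)) has_real_derivative
      2 * (v t \<bullet> (F t - (\<alpha> * \<kappa> * norm (r t) powr (- \<alpha> - 2)) *\<^sub>R r t)) / 2
        - \<kappa> * (- \<alpha> * norm (r t) powr (- \<alpha> - 2) * (r t \<bullet> v t))) (at t)"
      by (intro DERIV_diff DERIV_cdivide DERIV_cmult 1 has_real_derivative_norm_powr r t nz)
    then show ?thesis unfolding E_def power2_norm_eq_inner
      by (rule DERIV_cong) (simp add: inner_diff_right inner_commute algebra_simps diff_divide_distrib)
  qed
  define t0 where "t0 = d / 2"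
  have t0: "0 < t0" "t0 < d" using d by (auto simp: t0_def)
  \<comment> \<open>The power is at most \<open>M * (1 + \<bar>v\<bar>\<^sup>2) / 2\<close>, and the
    integral of the squared speed over \<open>{s..t0}\<close> is at most \<open>C\<close>, whatever
    \<open>s\<close> is.\<close>
  define K where "K = \<bar>E t0\<bar> + M * (d + C) / 2"
  have E_le: "\<bar>E s\<bar> \<le> K" if s: "0 < s" "s < t0" for s
  proof -
    have hi: "((\<lambda>t. v t \<bullet> F t) has_integral E t0 - E s) {s..t0}"
      by (rule fundamental_theorem_of_calculus)
        (use s t0 dE in \<open>auto simp: has_real_derivative_iff_has_vector_derivative[symmetric] intro: has_field_derivative_at_within\<close>)
    have i2: "(\<lambda>t. (norm (v t))\<^sup>2) integrable_on {s..t0}"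
      by (rule integrable_continuous_real, rule continuous_on_subset[OF cv2]) (use s t0 in auto)
    have i3: "(\<lambda>t. M / 2 + M / 2 * (norm (v t))\<^sup>2) integrable_on {s..t0}"
      using integrable_on_cmult_left[OF i2, of "M / 2"]
      by (intro Henstock_Kurzweil_Integration.integrable_add) auto
    have "norm (integral {s..t0} (\<lambda>t. v t \<bullet> F t)) \<le> integral {s..t0} (\<lambda>t. M / 2 + M / 2 * (norm (v t))\<^sup>2)"
    proof (rule integral_norm_bound_integral)
      show "(\<lambda>t. v t \<bullet> F t) integrable_on {s..t0}" using hi by (rule has_integral_integrable)
      show "(\<lambda>t. M / 2 + M / 2 * (norm (v t))\<^sup>2) integrable_on {s..t0}" by (rule i3)
      fix t assume t: "t \<in> {s..t0}"
      have "norm (v t \<bullet> F t) \<le> norm (v t) * norm (F t)"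
        by (simp add: Cauchy_Schwarz_ineq2)
      also have "\<dots> \<le> norm (v t) * M" using F[of t] t s t0 by (intro mult_left_mono) auto
      also have "\<dots> \<le> (1 + (norm (v t))\<^sup>2) / 2 * M"
        using sum_squares_bound[of 1 "norm (v t)"] M by (intro mult_right_mono) auto
      finally show "norm (v t \<bullet> F t) \<le> M / 2 + M / 2 * (norm (v t))\<^sup>2" by (simp add: algebra_simps)
    qed
    also have "\<dots> = M / 2 * (t0 - s) + M / 2 * integral {s..t0} (\<lambda>t. (norm (v t))\<^sup>2)"
      using s integrable_on_cmult_left[OF i2, of "M / 2"]
      by (subst Henstock_Kurzweil_Integration.integral_add) auto
    also have "\<dots> \<le> M / 2 * d + M / 2 * C"
      using s t0 M C(2)[of s t0] by (intro add_mono mult_left_mono) auto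
    finally have "\<bar>E t0 - E s\<bar> \<le> M * (d + C) / 2"
      using hi by (simp add: integral_unique algebra_simps)
    then show ?thesis unfolding K_def by linarith
  qed
  have K: "0 \<le> K" using M d C by (simp add: K_def)
  have vE: "(norm (v t))\<^sup>2 = 2 * E t + 2 * \<kappa> * norm (r t) powr (- \<alpha>)" for t
    by (simp add: E_def)
  \<comment> \<open>Half the derivative of the squared distance. Inserting the energy into its own
    derivative leaves \<open>(2 - \<alpha>) * \<kappa> * \<bar>r\<bar> powr (- \<alpha>)\<close>
    plus terms that stay bounded near the collision.\<close>
  define P where "P = (\<lambda>t. r t \<bullet> v t)"
  have dP: "(P has_real_derivative (norm (v t))\<^sup>2 + r t \<bullet> F t - \<alpha> * \<kappa> * norm (r t) powr (- \<alpha>)) (at t)"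
    if t: "t \<in> {0<..<d}" for t
  proof -
    have *: "(norm (r t))\<^sup>2 * norm (r t) powr (- \<alpha> - 2) = norm (r t) powr (- \<alpha>)"
      using nz[OF t] powr_add[of "norm (r t)" "- \<alpha> - 2" 2] by simp
    have "(P has_real_derivative r t \<bullet> (F t - (\<alpha> * \<kappa> * norm (r t) powr (- \<alpha> - 2)) *\<^sub>R r t) + v t \<bullet> v t) (at t)"
      unfolding P_def has_real_derivative_iff_has_vector_derivative
      by (rule bounded_bilinear.has_vector_derivative[OF bounded_bilinear_inner r[OF t] v[OF t]])
    then show ?thesis
      by (rule DERIV_cong) (simp add: inner_diff_right power2_norm_eq_inner[symmetric] * algebra_simps)
  qed
  have \<rho>lim: "((\<lambda>t. norm (r t)) \<longlongrightarrow> 0) (at_right 0)" using lim by (simp add: tendsto_norm_zero)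
  have dN: "((\<lambda>t. (norm (r t))\<^sup>2) has_real_derivative 2 * P t) (at t)" if "t \<in> {0<..<d}" for t
    unfolding power2_norm_eq_inner P_def
    using bounded_bilinear.has_vector_derivative[OF bounded_bilinear_inner r[OF that] r[OF that]]
    by (simp add: has_real_derivative_iff_has_vector_derivative inner_commute)
  \<comment> \<open>Below this distance the singular term exceeds \<open>2 * K + M\<close>, which
    bounds the remaining terms. The minimum with 1 allows
    \<open>\<bar>r\<bar> powr (- \<alpha>)\<close> to be estimated from below by the inverse
    distance, as \<alpha> is at least 1.\<close>
  define \<eta> where "\<eta> = min 1 ((2 - \<alpha>) * \<kappa> / (2 * K + M + 1))"
  have \<eta>: "0 < \<eta>" using \<alpha> \<kappa> K M by (simp add: \<eta>_def)
  have "\<forall>\<^sub>F t in at_right 0. norm (r t) < \<eta>" using order_tendstoD(2)[OF \<rho>lim \<eta>] .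
  then obtain t1' where t1': "0 < t1'" "\<And>t. 0 < t \<Longrightarrow> t < t1' \<Longrightarrow> norm (r t) < \<eta>"
    unfolding eventually_at_right_field by auto
  define t1 where "t1 = min t1' t0"
  have t1: "0 < t1" "\<And>t. 0 < t \<Longrightarrow> t < t1 \<Longrightarrow> norm (r t) < \<eta>" "t1 \<le> t0" "t1 < d"
    using t1' t0 by (auto simp: t1_def)
  have dPpos: "0 < (norm (v t))\<^sup>2 + r t \<bullet> F t - \<alpha> * \<kappa> * norm (r t) powr (- \<alpha>)"
    if t: "0 < t" "t < t1" for t
  proof -
    have \<rho>: "0 < norm (r t)" "norm (r t) < 1" "norm (r t) < (2 - \<alpha>) * \<kappa> / (2 * K + M + 1)"
      using t1(2)[OF t] nz[of t] t t1 by (auto simp: \<eta>_def)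
    have "\<bar>r t \<bullet> F t\<bar> \<le> norm (r t) * norm (F t)" by (rule Cauchy_Schwarz_ineq2)
    also have "\<dots> \<le> 1 * M" using F[of t] t t1 \<rho> by (intro mult_mono) auto
    finally have 1: "- M \<le> r t \<bullet> F t" by (simp add: abs_le_iff)
    have 2: "- (2 * K) \<le> 2 * E t" using E_le[of t] t t1 by (auto simp: abs_le_iff)
    have "norm (r t) powr (- 1) \<le> norm (r t) powr (- \<alpha>)"
      using \<rho> \<alpha> by (intro powr_mono') auto
    then have "(2 - \<alpha>) * \<kappa> * (1 / norm (r t)) \<le> (2 - \<alpha>) * \<kappa> * norm (r t) powr (- \<alpha>)"
      using \<alpha> \<kappa> \<rho> by (intro mult_left_mono) (auto simp: powr_minus_divide)
    moreover have "2 * K + M + 1 < (2 - \<alpha>) * \<kappa> * (1 / norm (r t))"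
      using \<rho> K M by (simp add: field_simps)
    ultimately have "2 * K + M + 1 < (2 - \<alpha>) * \<kappa> * norm (r t) powr (- \<alpha>)" by linarith
    then show ?thesis using 1 2 unfolding vE by (simp add: algebra_simps)
  qed
  have Pmono: "P s < P t" if "0 < s" "s < t" "t < t1" for s t
    by (rule DERIV_pos_imp_increasing[OF \<open>s < t\<close>]) (use that t1 dP dPpos in \<open>fastforce\<close>)
  \<comment> \<open>Since \<open>P\<close> increases, a nonpositive value at \<open>s\<close> would
    make the distance nonincreasing on all of \<open>{0<..s}\<close>, so it could not tend to 0 at
    the collision.\<close>
  have Ppos: "0 < P s" if s: "0 < s" "s < t1" for s
  proof (rule ccontr)
    assume "\<not> 0 < P s"
    then have neg: "P t \<le> 0" if "0 < t" "t \<le> s" for t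
      using Pmono[of t s] that s by (cases "t = s") auto
    have "(norm (r s))\<^sup>2 \<le> (norm (r t))\<^sup>2" if t: "0 < t" "t < s" for t
    proof (rule DERIV_nonpos_imp_nonincreasing[of t s])
      show "\<exists>y. ((\<lambda>t. (norm (r t))\<^sup>2) has_real_derivative y) (at u) \<and> y \<le> 0" if "t \<le> u" "u \<le> s" for u
        using dN[of u] neg[of u] that t s t1 by (intro exI[of _ "2 * P u"]) auto
    qed (use t in auto)
    then have "\<forall>\<^sub>F t in at_right 0. (norm (r s))\<^sup>2 \<le> (norm (r t))\<^sup>2"
      using s unfolding eventually_at_right_field by (intro exI[of _ s]) auto
    then have "\<forall>\<^sub>F t in at_right 0. norm (r s) \<le> norm (r t)" by simp
    then have "norm (r s) \<le> 0" by (rule tendsto_lowerbound[OF \<rho>lim]) simp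
    then show False using nz[of s] s t1 by simp
  qed
  then show "\<forall>\<^sub>F t in at_right 0. 0 < r t \<bullet> v t"
    unfolding eventually_at_right_field P_def using t1(1) by auto
  have \<rho>mono: "norm (r s) \<le> norm (r t)" if st: "0 < s" "s \<le> t" "t < t1" for s t
  proof -
    have "(norm (r s))\<^sup>2 \<le> (norm (r t))\<^sup>2"
    proof (rule DERIV_nonneg_imp_nondecreasing[OF st(2)])
      show "\<exists>y. ((\<lambda>t. (norm (r t))\<^sup>2) has_real_derivative y) (at u) \<and> 0 \<le> y" if "s \<le> u" "u \<le> t" for u
        using dN[of u] Ppos[of u] that st t1 by (intro exI[of _ "2 * P u"]) auto
    qed
    then show ?thesis by (rule power2_le_imp_le) auto
  qed
  define L where "L = (\<lambda>t. Re (r t) * Im (v t) - Im (r t) * Re (v t))"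
  have dL: "(L has_real_derivative Re (r t) * Im (F t) - Im (r t) * Re (F t)) (at t)" if t: "t \<in> {0<..<d}" for t
  proof -
    let ?a = "F t - (\<alpha> * \<kappa> * norm (r t) powr (- \<alpha> - 2)) *\<^sub>R r t"
    have c: "((\<lambda>t. Re (r t)) has_real_derivative Re (v t)) (at t)" "((\<lambda>t. Im (r t)) has_real_derivative Im (v t)) (at t)"
      "((\<lambda>t. Re (v t)) has_real_derivative Re ?a) (at t)" "((\<lambda>t. Im (v t)) has_real_derivative Im ?a) (at t)"
      unfolding has_real_derivative_iff_has_vector_derivative
      by (intro bounded_linear.has_vector_derivative[OF bounded_linear_Re]
          bounded_linear.has_vector_derivative[OF bounded_linear_Im] r v t)+
    show ?thesis unfolding L_def
      by (rule DERIV_cong[OF DERIV_diff[OF DERIV_mult[OF c(1,4)] DERIV_mult[OF c(2,3)]]])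
        (simp add: algebra_simps)
  qed
  have dL_le: "\<bar>Re (r t) * Im (F t) - Im (r t) * Re (F t)\<bar> \<le> norm (r t) * M" if t: "t \<in> {0<..<d}" for t
  proof -
    have "(Re (r t) * Im (F t) - Im (r t) * Re (F t))\<^sup>2 \<le> (norm (r t) * norm (F t))\<^sup>2"
      using complex_lagrange_identity[of "r t" "F t"] by (simp add: power_mult_distrib)
    then have "\<bar>Re (r t) * Im (F t) - Im (r t) * Re (F t)\<bar> \<le> norm (r t) * norm (F t)"
      by (intro abs_le_square_iff[THEN iffD2, of _ "norm (r t) * norm (F t)", simplified]) auto
    also have "\<dots> \<le> norm (r t) * M" using F[OF t] by (intro mult_left_mono) auto
    finally show ?thesis .
  qed
  have powr_lim: "((\<lambda>t. norm (r t) powr p) \<longlongrightarrow> 0) (at_right 0)" if "0 < p" for p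
    by (rule tendsto_zero_powrI[OF \<rho>lim tendsto_const _ that]) simp
  have ev1: "\<forall>\<^sub>F t in at_right 0. 0 < t \<and> t < t1"
    using t1(1) unfolding eventually_at_right_field by auto
  \<comment> \<open>The energy bound gives speed of order
    \<open>\<bar>r\<bar> powr (- \<alpha> / 2)\<close>, hence angular momentum of order
    \<open>\<bar>r\<bar> powr (1 - \<alpha> / 2)\<close>; here \<alpha> < 2 is essential.\<close>
  have L0: "(L \<longlongrightarrow> 0) (at_right 0)"
  proof -
    have "((\<lambda>t. (L t)\<^sup>2) \<longlongrightarrow> 0) (at_right 0)"
    proof (rule tendsto_sandwich[OF _ _ tendsto_const])
      show "\<forall>\<^sub>F t in at_right 0. (L t)\<^sup>2 \<le> 2 * K * (norm (r t))\<^sup>2 + 2 * \<kappa> * norm (r t) powr (2 - \<alpha>)"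
        using ev1
      proof eventually_elim
        case (elim t)
        then have t: "t \<in> {0<..<d}" "t < t0" using t1 by auto
        have "(L t)\<^sup>2 \<le> (norm (r t))\<^sup>2 * (norm (v t))\<^sup>2"
          unfolding complex_lagrange_identity[of "r t" "v t"] L_def by simp
        also have "\<dots> = 2 * E t * (norm (r t))\<^sup>2 + 2 * \<kappa> * ((norm (r t))\<^sup>2 * norm (r t) powr (- \<alpha>))"
          unfolding vE by (simp add: algebra_simps)
        also have "(norm (r t))\<^sup>2 * norm (r t) powr (- \<alpha>) = norm (r t) powr (2 - \<alpha>)"
          using nz[OF t(1)] powr_add[of "norm (r t)" 2 "- \<alpha>"] by simp
        also have "2 * E t * (norm (r t))\<^sup>2 \<le> 2 * K * (norm (r t))\<^sup>2"
          using E_le[of t] t by (intro mult_right_mono) (auto simp: abs_le_iff)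
        finally show ?case by simp
      qed
      have "((\<lambda>t. 2 * K * (norm (r t))\<^sup>2 + 2 * \<kappa> * norm (r t) powr (2 - \<alpha>)) \<longlongrightarrow> 2 * K * 0\<^sup>2 + 2 * \<kappa> * 0) (at_right 0)"
        by (intro tendsto_intros \<rho>lim powr_lim) (use \<alpha> in auto)
      then show "((\<lambda>t. 2 * K * (norm (r t))\<^sup>2 + 2 * \<kappa> * norm (r t) powr (2 - \<alpha>)) \<longlongrightarrow> 0) (at_right 0)" by simp
    qed auto
    then have "((\<lambda>t. sqrt ((L t)\<^sup>2)) \<longlongrightarrow> sqrt 0) (at_right 0)" by (rule tendsto_real_sqrt)
    then show ?thesis by (simp add: tendsto_rabs_zero_iff)
  qed
  \<comment> \<open>The torque at time \<open>u\<close> is at most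
    \<open>M * \<bar>r u\<bar>\<close>, which is at most \<open>M * \<bar>r t\<bar>\<close> by
    monotonicity of the distance. Starting from the limit 0 this integrates to the bound.\<close>
  have L_le: "\<bar>L t\<bar> \<le> M * t * norm (r t)" if t: "0 < t" "t < t1" for t
  proof -
    have "\<bar>L t - L s\<bar> \<le> M * t * norm (r t)" if s: "0 < s" "s < t" for s
    proof -
      have "norm (L t - L s) \<le> norm (r t) * M * norm (t - s)"
      proof (rule field_differentiable_bound[of "{s..t}"])
        show "(L has_field_derivative Re (r u) * Im (F u) - Im (r u) * Re (F u)) (at u within {s..t})" if "u \<in> {s..t}" for u
          by (rule has_field_derivative_at_within, rule dL) (use that s t t1(4) in auto)
        show "norm (Re (r u) * Im (F u) - Im (r u) * Re (F u)) \<le> norm (r t) * M" if "u \<in> {s..t}" for u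
        proof -
          have u: "u \<in> {0<..<d}" "0 < u" "u \<le> t" using that s t t1(4) by auto
          show ?thesis
            unfolding real_norm_def
            by (rule order_trans[OF dL_le[OF u(1)] mult_right_mono[OF \<rho>mono[OF u(2,3) t(2)] M]])
        qed
      qed (use s in auto)
      also have "\<dots> \<le> norm (r t) * M * t" using s t M by (intro mult_left_mono) auto
      finally show ?thesis by (simp add: mult_ac)
    qed
    then have "\<forall>\<^sub>F s in at_right 0. \<bar>L t - L s\<bar> \<le> M * t * norm (r t)"
      using t unfolding eventually_at_right_field by auto
    moreover have "((\<lambda>s. \<bar>L t - L s\<bar>) \<longlongrightarrow> \<bar>L t - 0\<bar>) (at_right 0)" by (intro tendsto_intros L0)
    ultimately have "\<bar>L t - 0\<bar> \<le> M * t * norm (r t)" by (intro tendsto_upperbound) auto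
    then show ?thesis by simp
  qed
  \<comment> \<open>The exponent for which the radial equation at zero energy and zero angular
    momentum becomes linear: there \<open>\<bar>r\<bar> powr e\<close> has the constant derivative
    \<open>e * sqrt (2 * \<kappa>)\<close>.\<close>
  define e where "e = 1 + \<alpha> / 2"
  define Q where "Q = (\<lambda>t. norm (r t) powr e)"
  define Q' where "Q' = (\<lambda>t. e * norm (r t) powr (e - 2) * (r t \<bullet> v t))"
  have dQ: "(Q has_real_derivative Q' t) (at t)" if "t \<in> {0<..<d}" for t
    unfolding Q_def Q'_def by (rule has_real_derivative_norm_powr[OF r[OF that] nz[OF that]])
  have Q'_sq: "(Q' t)\<^sup>2 = e\<^sup>2 * (2 * E t * norm (r t) powr \<alpha> + 2 * \<kappa> - (L t)\<^sup>2 * norm (r t) powr (\<alpha> - 2))"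
    if t: "0 < t" "t < t1" for t
  proof -
    have nz': "norm (r t) > 0" using nz[of t] t t1 by auto
    have 1: "(norm (r t) powr (e - 2))\<^sup>2 = norm (r t) powr (\<alpha> - 2)"
      unfolding power2_eq_square powr_add[symmetric] by (simp add: e_def)
    have 2: "norm (r t) powr (\<alpha> - 2) * (norm (r t))\<^sup>2 = norm (r t) powr \<alpha>"
      using nz' powr_add[of "norm (r t)" "\<alpha> - 2" 2] by simp
    have 3: "norm (r t) powr \<alpha> * norm (r t) powr (- \<alpha>) = 1"
      using nz' powr_add[of "norm (r t)" "\<alpha>" "- \<alpha>"] by simp
    have "(r t \<bullet> v t)\<^sup>2 = (norm (r t))\<^sup>2 * (2 * E t + 2 * \<kappa> * norm (r t) powr (- \<alpha>)) - (L t)\<^sup>2"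
      using complex_lagrange_identity[of "r t" "v t"] unfolding L_def vE[symmetric] by simp
    from arg_cong[OF this, of "\<lambda>z. e\<^sup>2 * norm (r t) powr (\<alpha> - 2) * z"]
    have "(Q' t)\<^sup>2 = e\<^sup>2 * (norm (r t) powr (\<alpha> - 2) * (norm (r t))\<^sup>2 * (2 * E t + 2 * \<kappa> * norm (r t) powr (- \<alpha>))
        - (L t)\<^sup>2 * norm (r t) powr (\<alpha> - 2))"
      unfolding Q'_def power_mult_distrib 1 by (simp add: algebra_simps)
    also have "\<dots> = e\<^sup>2 * (2 * E t * norm (r t) powr \<alpha> + 2 * \<kappa> * (norm (r t) powr \<alpha> * norm (r t) powr (- \<alpha>))
        - (L t)\<^sup>2 * norm (r t) powr (\<alpha> - 2))"
      unfolding 2 by (simp add: algebra_simps)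
    finally show ?thesis unfolding 3 by simp
  qed
  have l1: "((\<lambda>t. 2 * E t * norm (r t) powr \<alpha>) \<longlongrightarrow> 0) (at_right 0)"
  proof (rule Lim_null_comparison)
    show "\<forall>\<^sub>F t in at_right 0. norm (2 * E t * norm (r t) powr \<alpha>) \<le> 2 * K * norm (r t) powr \<alpha>"
      using ev1
    proof eventually_elim
      case (elim t)
      then have "\<bar>E t\<bar> \<le> K" using E_le[of t] t1 by auto
      then show ?case by (simp add: abs_mult mult_right_mono)
    qed
    show "((\<lambda>t. 2 * K * norm (r t) powr \<alpha>) \<longlongrightarrow> 0) (at_right 0)"
      using tendsto_mult[OF tendsto_const powr_lim[of \<alpha>], of "2 * K"] \<alpha> by simp
  qed
  have l2: "((\<lambda>t. (L t)\<^sup>2 * norm (r t) powr (\<alpha> - 2)) \<longlongrightarrow> 0) (at_right 0)"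
  proof (rule Lim_null_comparison)
    show "\<forall>\<^sub>F t in at_right 0. norm ((L t)\<^sup>2 * norm (r t) powr (\<alpha> - 2)) \<le> (M * t)\<^sup>2 * norm (r t) powr \<alpha>"
      using ev1
    proof eventually_elim
      case (elim t)
      then have nz': "norm (r t) > 0" using nz[of t] t1 by auto
      have "(L t)\<^sup>2 \<le> (M * t * norm (r t))\<^sup>2"
        using L_le[of t] elim M by (intro abs_le_square_iff[THEN iffD1]) auto
      then have "(L t)\<^sup>2 * norm (r t) powr (\<alpha> - 2) \<le> (M * t * norm (r t))\<^sup>2 * norm (r t) powr (\<alpha> - 2)"
        by (intro mult_right_mono) auto
      also have "\<dots> = (M * t)\<^sup>2 * norm (r t) powr \<alpha>"
        using nz' powr_add[of "norm (r t)" "\<alpha> - 2" 2] by (simp add: power_mult_distrib)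
      finally show ?case by simp
    qed
    have "((\<lambda>t. (M * t)\<^sup>2 * norm (r t) powr \<alpha>) \<longlongrightarrow> (M * 0)\<^sup>2 * 0) (at_right 0)"
      by (intro tendsto_intros powr_lim) (use \<alpha> in auto)
    then show "((\<lambda>t. (M * t)\<^sup>2 * norm (r t) powr \<alpha>) \<longlongrightarrow> 0) (at_right 0)" by simp
  qed
  have "((\<lambda>t. e\<^sup>2 * (2 * E t * norm (r t) powr \<alpha> + 2 * \<kappa> - (L t)\<^sup>2 * norm (r t) powr (\<alpha> - 2)))
      \<longlongrightarrow> e\<^sup>2 * (0 + 2 * \<kappa> - 0)) (at_right 0)"
    by (intro tendsto_intros l1 l2)
  then have "((\<lambda>t. (Q' t)\<^sup>2) \<longlongrightarrow> e\<^sup>2 * (0 + 2 * \<kappa> - 0)) (at_right 0)"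
    by (rule Lim_transform_eventually) (use ev1 in \<open>eventually_elim, simp add: Q'_sq\<close>)
  then have "((\<lambda>t. (Q' t)\<^sup>2) \<longlongrightarrow> e\<^sup>2 * (2 * \<kappa>)) (at_right 0)" by simp
  then have "((\<lambda>t. sqrt ((Q' t)\<^sup>2)) \<longlongrightarrow> sqrt (e\<^sup>2 * (2 * \<kappa>))) (at_right 0)" by (rule tendsto_real_sqrt)
  moreover have e: "0 < e" using \<alpha> by (simp add: e_def)
  \<comment> \<open>Positivity of \<open>P\<close> selects the positive root. The quotient by 1, the
    derivative of the denominator \<open>t\<close>, is the form that l'Hospital's rule
    expects.\<close>
  moreover have "\<forall>\<^sub>F t in at_right 0. sqrt ((Q' t)\<^sup>2) = Q' t / 1"
    using ev1
  proof eventually_elim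
    case (elim t)
    then show ?case using Ppos[of t] e by (simp add: Q'_def P_def abs_mult)
  qed
  ultimately have "((\<lambda>t. Q' t / 1) \<longlongrightarrow> e * sqrt (2 * \<kappa>)) (at_right 0)"
    by (simp add: real_sqrt_mult filterlim_cong)
  then have "((\<lambda>t. Q t / t) \<longlongrightarrow> e * sqrt (2 * \<kappa>)) (at_right 0)"
  proof (rule lhopital_right_0[rotated 6])
    show "(Q \<longlongrightarrow> 0) (at_right 0)" unfolding Q_def by (rule powr_lim[OF e])
    show "\<forall>\<^sub>F t in at_right 0. (Q has_real_derivative Q' t) (at t)"
      using ev1 by eventually_elim (use dQ t1 in auto)
    show "\<forall>\<^sub>F t in at_right 0. (t::real) \<noteq> 0" using ev1 by eventually_elim auto
  qed (auto intro!: tendsto_intros)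
  then show "((\<lambda>t. norm (r t) powr (1 + \<alpha> / 2) / t) \<longlongrightarrow> (1 + \<alpha> / 2) * sqrt (2 * \<kappa>)) (at_right 0)"
    by (simp add: Q_def e_def)
qed


text \<open>By the arithmetic-geometric mean inequality the integrand dominates \<open>sqrt (2 *
  \<kappa>) * \<bar>r\<bar> powr (- \<alpha> / 2) * \<bar>v\<bar>\<close>, which in turn dominates
  the derivative of the bound along the path. Outward motion makes that derivative nonnegative, so
  its integral in the extended reals telescopes; the lower limit then moves to the
  collision.\<close>

lemma kepler_action_lower_bound:
  fixes r v :: "real \<Rightarrow> 'a::euclidean_space" and \<alpha> \<kappa> \<tau> :: real
  assumes \<alpha>: "\<alpha> < 2" and \<kappa>: "0 < \<kappa>" and \<tau>: "0 < \<tau>"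
    and r: "\<And>t. t \<in> {0<..\<tau>} \<Longrightarrow> (r has_vector_derivative v t) (at t)"
    and nz: "\<And>t. t \<in> {0<..\<tau>} \<Longrightarrow> r t \<noteq> 0"
    and out: "\<And>t. t \<in> {0<..\<tau>} \<Longrightarrow> 0 \<le> r t \<bullet> v t"
    and lim: "(r \<longlongrightarrow> 0) (at_right 0)"
  shows "ennreal (sqrt (2 * \<kappa>) / (1 - \<alpha> / 2) * norm (r \<tau>) powr (1 - \<alpha> / 2))
    \<le> (\<integral>\<^sup>+t\<in>{0<..<\<tau>}. ennreal ((norm (v t))\<^sup>2 / 2 + \<kappa> * norm (r t) powr (- \<alpha>)) \<partial>lborel)" (is "_ \<le> ?I")
proof -
  define \<gamma> where "\<gamma> = 1 - \<alpha> / 2"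
  have \<gamma>: "0 < \<gamma>" using \<alpha> by (simp add: \<gamma>_def)
  define q where "q = sqrt (2 * \<kappa>)"
  have q: "0 \<le> q" "q\<^sup>2 = 2 * \<kappa>" using \<kappa> by (auto simp: q_def)
  define h where "h = (\<lambda>t. q / \<gamma> * norm (r t) powr \<gamma>)"
  define h' where "h' = (\<lambda>t. q * norm (r t) powr (\<gamma> - 2) * (r t \<bullet> v t))"
  have dh: "(h has_real_derivative h' t) (at t)" if t: "t \<in> {0<..\<tau>}" for t
    unfolding h_def
    by (rule DERIV_cong[OF DERIV_cmult[OF has_real_derivative_norm_powr[OF r[OF t] nz[OF t]]]])
      (use \<gamma> in \<open>simp add: h'_def\<close>)
  have h'_le: "h' t \<le> (norm (v t))\<^sup>2 / 2 + \<kappa> * norm (r t) powr (- \<alpha>)" if t: "t \<in> {0<..\<tau>}" for t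
  proof -
    have "h' t \<le> q * norm (r t) powr (\<gamma> - 2) * (norm (r t) * norm (v t))"
      unfolding h'_def using q by (intro mult_left_mono) (auto simp: norm_cauchy_schwarz)
    also have "norm (r t) powr (\<gamma> - 2) = norm (r t) powr (- \<alpha> / 2) * norm (r t) powr (- 1)"
    proof -
      have "\<gamma> - 2 = - \<alpha> / 2 + - 1" by (simp add: \<gamma>_def)
      then show ?thesis by (simp only: powr_add)
    qed
    also have "q * (norm (r t) powr (- \<alpha> / 2) * norm (r t) powr (- 1)) * (norm (r t) * norm (v t))
        = (q * norm (r t) powr (- \<alpha> / 2)) * norm (v t)"
      using nz[OF t] by (simp add: powr_minus_divide)
    also have "\<dots> \<le> ((q * norm (r t) powr (- \<alpha> / 2))\<^sup>2 + (norm (v t))\<^sup>2) / 2"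
      using sum_squares_bound[of "q * norm (r t) powr (- \<alpha> / 2)" "norm (v t)"] by simp
    also have "(q * norm (r t) powr (- \<alpha> / 2))\<^sup>2 = 2 * \<kappa> * norm (r t) powr (- \<alpha>)"
      unfolding power_mult_distrib q by (simp add: power2_eq_square powr_add[symmetric])
    finally show ?thesis by (simp add: add_divide_distrib)
  qed
  have h'_nonneg: "0 \<le> h' t" if "t \<in> {0<..\<tau>}" for t
    unfolding h'_def using q out[OF that] by simp
  have part: "ennreal (h \<tau> - h s) \<le> ?I" if s: "0 < s" "s < \<tau>" for s
  proof -
    have "(h' has_integral h \<tau> - h s) {s..\<tau>}"
      by (rule fundamental_theorem_of_calculus)
        (use s dh in \<open>auto simp: has_real_derivative_iff_has_vector_derivative[symmetric] intro: has_field_derivative_at_within\<close>)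
    then have "(h' has_integral h \<tau> - h s) {s<..<\<tau>}" by (simp add: has_integral_Icc_iff_Ioo)
    then have "ennreal (h \<tau> - h s) = (\<integral>\<^sup>+t\<in>{s<..<\<tau>}. ennreal (h' t) \<partial>lborel)"
      using s h'_nonneg by (intro nn_integral_has_integral_lebesgue'[symmetric]) auto
    also have "\<dots> \<le> ?I"
      using s h'_le by (intro nn_integral_mono) (auto simp: indicator_def intro!: ennreal_leI)
    finally show ?thesis .
  qed
  have "((\<lambda>s. norm (r s)) \<longlongrightarrow> 0) (at_right 0)" using lim by (simp add: tendsto_norm_zero)
  then have "((\<lambda>s. norm (r s) powr \<gamma>) \<longlongrightarrow> 0) (at_right 0)"
    by (rule tendsto_zero_powrI[OF _ tendsto_const _ \<gamma>]) simp
  then have "((\<lambda>s. ennreal (h \<tau> - h s)) \<longlongrightarrow> ennreal (h \<tau> - q / \<gamma> * 0)) (at_right 0)"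
    unfolding h_def by (intro tendsto_intros)
  moreover have "\<forall>\<^sub>F s in at_right 0. ennreal (h \<tau> - h s) \<le> ?I"
    using part \<tau> unfolding eventually_at_right_field by blast
  ultimately have "ennreal (h \<tau> - q / \<gamma> * 0) \<le> ?I" by (rule tendsto_upperbound) simp
  then show ?thesis by (simp add: h_def q_def \<gamma>_def)
qed

section \<open>Gravitational forces and energy\<close>

definition acceleration :: "('n::finite \<Rightarrow> real) \<Rightarrow> real \<Rightarrow> 'n config \<Rightarrow> 'n \<Rightarrow> complex" where
  "acceleration m \<alpha> x j =
     (\<Sum>k\<in>UNIV - {j}. (m k * norm (x $ j - x $ k) powr (- \<alpha> - 2)) *\<^sub>R (x $ k - x $ j))"

lemma sum_greaterThan_symmetric:
  fixes T :: "'n::{finite,linorder} \<Rightarrow> 'n \<Rightarrow> real"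
  assumes "\<And>j k. T j k = T k j"
  shows "(\<Sum>j\<in>UNIV. \<Sum>k\<in>{j<..}. T j k) = 1 / 2 * (\<Sum>j\<in>UNIV. \<Sum>k\<in>UNIV - {j}. T j k)"
proof -
  have split: "(\<Sum>k\<in>UNIV - {j}. T j k) = (\<Sum>k\<in>UNIV. if j < k then T j k else 0) + (\<Sum>k\<in>UNIV. if k < j then T k j else 0)" for j
  proof -
    have "(\<Sum>k\<in>UNIV - {j}. T j k) = (\<Sum>k\<in>UNIV. if k \<noteq> j then T j k else 0)"
      by (rule sum.mono_neutral_cong_left) auto
    also have "\<dots> = (\<Sum>k\<in>UNIV. (if j < k then T j k else 0) + (if k < j then T k j else 0))"
      by (rule sum.cong) (auto simp: assms)
    finally show ?thesis by (simp add: sum.distrib)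
  qed
  have "(\<Sum>j\<in>UNIV. \<Sum>k\<in>UNIV - {j}. T j k) =
      (\<Sum>j\<in>UNIV. \<Sum>k\<in>UNIV. if j < k then T j k else 0) + (\<Sum>j\<in>UNIV. \<Sum>k\<in>UNIV. if k < j then T k j else 0)"
    unfolding split by (rule sum.distrib)
  also have "(\<Sum>j\<in>UNIV. \<Sum>k\<in>UNIV. if k < j then T k j else 0) = (\<Sum>j\<in>UNIV. \<Sum>k\<in>UNIV. if j < k then T j k else 0)"
    by (rule sum.swap)
  also have "(\<Sum>j\<in>UNIV. \<Sum>k\<in>UNIV. if j < k then T j k else 0) = (\<Sum>j\<in>UNIV. \<Sum>k\<in>{j<..}. T j k)"
    by (intro sum.cong refl sum.mono_neutral_cong_right) auto
  finally show ?thesis by simp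
qed

text \<open>The sum over ordered pairs treats all bodies alike, so derivatives and estimates need no
  case distinction on the order of the indices.\<close>

lemma potential_symmetric:
  "potential m \<alpha> x = 1 / 2 * (\<Sum>j\<in>UNIV. \<Sum>k\<in>UNIV - {j}. m j * m k / \<alpha> * norm (x $ j - x $ k) powr (- \<alpha>))"
  unfolding potential_def
  by (subst sum_greaterThan_symmetric) (simp_all add: norm_minus_commute mult.commute powr_minus_divide)

lemma has_derivative_potential:
  fixes m :: "'n::{finite,linorder} \<Rightarrow> real"
  assumes cf: "collision_free x" and \<alpha>: "\<alpha> \<noteq> 0"
  shows "(potential m \<alpha> has_derivative (\<lambda>h. \<Sum>j\<in>UNIV. m j * (acceleration m \<alpha> x j \<bullet> h $ j))) (at x)"
proof -
  let ?p = "\<lambda>j k. norm (x $ j - x $ k) powr (- \<alpha> - 2)"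
  have "((\<lambda>x. 1 / 2 * (\<Sum>j\<in>UNIV. \<Sum>k\<in>UNIV - {j}. m j * m k / \<alpha> * norm (x $ j - x $ k) powr (- \<alpha>))) has_derivative
     (\<lambda>h. 1 / 2 * (\<Sum>j\<in>UNIV. \<Sum>k\<in>UNIV - {j}. m j * m k / \<alpha> *
        (- \<alpha> * ?p j k * ((x $ j - x $ k) \<bullet> (h $ j - h $ k)))))) (at x)"
  proof (intro has_derivative_mult_right has_derivative_sum has_derivative_norm_powr)
    fix j k :: 'n assume "k \<in> UNIV - {j}"
    then show "x $ j - x $ k \<noteq> 0" using cf by (auto simp: collision_free_def)
    show "((\<lambda>x. x $ j - x $ k) has_derivative (\<lambda>h. h $ j - h $ k)) (at x)"
      by (intro has_derivative_diff bounded_linear.has_derivative[OF bounded_linear_vec_nth] has_derivative_ident)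
  qed
  moreover have "1 / 2 * (\<Sum>j\<in>UNIV. \<Sum>k\<in>UNIV - {j}. m j * m k / \<alpha> *
        (- \<alpha> * ?p j k * ((x $ j - x $ k) \<bullet> (h $ j - h $ k))))
      = (\<Sum>j\<in>UNIV. m j * (acceleration m \<alpha> x j \<bullet> h $ j))" for h
  proof -
    \<comment> \<open>The force exerted by \<open>k\<close> on \<open>j\<close>, paired with the
      displacement of \<open>j\<close>. Each ordered pair contributes it in both orders, and
      exchanging the two sums cancels the factor 1/2.\<close>
    define B where "B = (\<lambda>j k. m j * m k * ?p j k * ((x $ k - x $ j) \<bullet> h $ j))"
    have "(\<Sum>j\<in>UNIV. \<Sum>k\<in>UNIV - {j}. m j * m k / \<alpha> *
        (- \<alpha> * ?p j k * ((x $ j - x $ k) \<bullet> (h $ j - h $ k)))) = (\<Sum>j\<in>UNIV. \<Sum>k\<in>UNIV - {j}. B j k + B k j)"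
    proof (intro sum.cong refl)
      fix j k
      have e: "(x $ j - x $ k) \<bullet> (h $ j - h $ k) = - ((x $ k - x $ j) \<bullet> h $ j) - ((x $ j - x $ k) \<bullet> h $ k)"
        by (simp add: inner_diff_left inner_diff_right)
      have p: "?p k j = ?p j k" by (simp add: norm_minus_commute)
      show "m j * m k / \<alpha> * (- \<alpha> * ?p j k * ((x $ j - x $ k) \<bullet> (h $ j - h $ k))) = B j k + B k j"
        unfolding B_def e p using \<alpha> by (simp add: field_simps)
    qed
    also have "\<dots> = (\<Sum>j\<in>UNIV. \<Sum>k\<in>UNIV - {j}. B j k) + (\<Sum>j\<in>UNIV. \<Sum>k\<in>UNIV - {j}. B k j)"
      by (simp add: sum.distrib)
    also have "(\<Sum>j\<in>UNIV. \<Sum>k\<in>UNIV - {j}. B k j) = (\<Sum>j\<in>UNIV. \<Sum>k\<in>UNIV. if k \<noteq> j then B k j else 0)"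
      by (intro sum.cong refl sum.mono_neutral_cong_left) auto
    also have "\<dots> = (\<Sum>k\<in>UNIV. \<Sum>j\<in>UNIV. if k \<noteq> j then B k j else 0)" by (rule sum.swap)
    also have "\<dots> = (\<Sum>j\<in>UNIV. \<Sum>k\<in>UNIV - {j}. B j k)"
      by (intro sum.cong refl sum.mono_neutral_cong_right) auto
    finally show ?thesis
      by (simp add: acceleration_def B_def inner_sum_left sum_distrib_left mult.assoc)
  qed
  ultimately show ?thesis unfolding potential_symmetric by simp
qed

lemma GDERIV_potential:
  fixes m :: "'n::{finite,linorder} \<Rightarrow> real"
  assumes cf: "collision_free x" and \<alpha>: "\<alpha> \<noteq> 0"
  shows "GDERIV (\<lambda>z. potential m \<alpha> (\<chi> i. if i = j then z else x $ i)) (x $ j) :> m j *\<^sub>R acceleration m \<alpha> x j"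
proof -
  have 1: "((\<lambda>z. \<chi> i. if i = j then z else x $ i) has_derivative (\<lambda>h. \<chi> i. if i = j then h else 0)) (at (x $ j))"
  proof -
    have "bounded_linear (\<lambda>h::complex. \<chi> i. if i = j then h else (0::complex))"
      by (rule linear_conv_bounded_linear[THEN iffD1], rule linearI) (auto simp: vec_eq_iff)
    then have "((\<lambda>z. (\<chi> i. if i = j then 0 else x $ i) + (\<chi> i. if i = j then z else 0)) has_derivative
        (\<lambda>h. 0 + (\<chi> i. if i = j then h else 0))) (at (x $ j))"
      by (rule has_derivative_add[OF has_derivative_const bounded_linear.has_derivative[OF _ has_derivative_ident]])
    moreover have "(\<chi> i. if i = j then 0 else x $ i) + (\<chi> i. if i = j then z else 0) = (\<chi> i. if i = j then z else x $ i)" for z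
      by (simp add: vec_eq_iff)
    ultimately show ?thesis by simp
  qed
  have x: "(\<chi> i. if i = j then x $ j else x $ i) = x" by (simp add: vec_eq_iff)
  have "((\<lambda>z. potential m \<alpha> (\<chi> i. if i = j then z else x $ i)) has_derivative
      (\<lambda>h. \<Sum>i\<in>UNIV. m i * (acceleration m \<alpha> x i \<bullet> (\<chi> i. if i = j then h else 0) $ i))) (at (x $ j))"
    by (rule has_derivative_compose[OF 1, of "potential m \<alpha>"]) (unfold x, rule has_derivative_potential[OF assms])
  also have "(\<lambda>h. \<Sum>i\<in>UNIV. m i * (acceleration m \<alpha> x i \<bullet> (\<chi> i. if i = j then h else 0) $ i))
      = (\<lambda>h. h \<bullet> (m j *\<^sub>R acceleration m \<alpha> x j))"
  proof
    fix h
    have "(\<Sum>i\<in>UNIV. m i * (acceleration m \<alpha> x i \<bullet> (\<chi> i. if i = j then h else 0) $ i))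
        = (\<Sum>i\<in>UNIV. if i = j then m i * (acceleration m \<alpha> x i \<bullet> h) else 0)"
      by (rule sum.cong) auto
    then show "(\<Sum>i\<in>UNIV. m i * (acceleration m \<alpha> x i \<bullet> (\<chi> i. if i = j then h else 0) $ i))
        = h \<bullet> (m j *\<^sub>R acceleration m \<alpha> x j)"
      by (simp add: inner_commute)
  qed
  finally show ?thesis unfolding gderiv_def .
qed

text \<open>At interior times the derivatives within the half-open interval are two-sided, and
  uniqueness of the gradient identifies the second derivative.\<close>

lemma newton_solution_onE:
  fixes m :: "'n::{finite,linorder} \<Rightarrow> real"
  assumes "newton_solution_on m \<alpha> {0<..\<delta>} x"
    and cf: "\<And>t. t \<in> {0<..<\<delta>} \<Longrightarrow> collision_free (x t)" and m: "\<And>j. 0 < m j" and \<alpha>: "\<alpha> \<noteq> 0"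
  obtains v where "\<And>t. t \<in> {0<..<\<delta>} \<Longrightarrow> (x has_vector_derivative v t) (at t)"
    "\<And>t. t \<in> {0<..<\<delta>} \<Longrightarrow> (v has_vector_derivative (\<chi> j. acceleration m \<alpha> (x t) j)) (at t)"
proof -
  obtain v a where va: "\<And>t. t \<in> {0<..\<delta>} \<Longrightarrow> (x has_vector_derivative v t) (at t within {0<..\<delta>})"
    "\<And>t. t \<in> {0<..\<delta>} \<Longrightarrow> (v has_vector_derivative a t) (at t within {0<..\<delta>})"
    "\<And>t j. t \<in> {0<..\<delta>} \<Longrightarrow> GDERIV (\<lambda>z. potential m \<alpha> (\<chi> i. if i = j then z else x t $ i)) (x t $ j)
              :> m j *\<^sub>R a t $ j"
    using assms(1) unfolding newton_solution_on_def by blast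
  have within: "at t within {0<..\<delta>} = at t" if "t \<in> {0<..<\<delta>}" for t
    by (rule at_within_interior) (use that in auto)
  have "a t $ j = acceleration m \<alpha> (x t) j" if t: "t \<in> {0<..<\<delta>}" for t j
  proof -
    have "(\<lambda>h. h \<bullet> (m j *\<^sub>R a t $ j)) = (\<lambda>h. h \<bullet> (m j *\<^sub>R acceleration m \<alpha> (x t) j))"
      using has_derivative_unique[OF va(3)[of t j, unfolded gderiv_def]
          GDERIV_potential[OF cf[OF t] \<alpha>, of m j, unfolded gderiv_def]] t by auto
    then have "m j *\<^sub>R a t $ j = m j *\<^sub>R acceleration m \<alpha> (x t) j"
      by (metis inner_commute vector_eq_rdot)
    then show ?thesis using m[of j] by simp
  qed
  then have "a t = (\<chi> j. acceleration m \<alpha> (x t) j)" if "t \<in> {0<..<\<delta>}" for t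
    using that by (simp add: vec_eq_iff)
  with va within that[of v] show thesis by fastforce
qed

lemma energy_conservation:
  fixes m :: "'n::{finite,linorder} \<Rightarrow> real"
  assumes x: "\<And>t. t \<in> {0<..<\<delta>} \<Longrightarrow> (x has_vector_derivative v t) (at t)"
    and v: "\<And>t. t \<in> {0<..<\<delta>} \<Longrightarrow> (v has_vector_derivative (\<chi> j. acceleration m \<alpha> (x t) j)) (at t)"
    and cf: "\<And>t. t \<in> {0<..<\<delta>} \<Longrightarrow> collision_free (x t)" and \<alpha>: "\<alpha> \<noteq> 0"
  obtains H where "\<And>t. t \<in> {0<..<\<delta>} \<Longrightarrow> kinetic m (v t) = potential m \<alpha> (x t) + H"
proof -
  have d: "((\<lambda>t. kinetic m (v t) - potential m \<alpha> (x t)) has_real_derivative 0) (at t)" if t: "t \<in> {0<..<\<delta>}" for t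
  proof -
    have vj: "((\<lambda>t. v t $ j) has_vector_derivative acceleration m \<alpha> (x t) j) (at t)" for j
      using bounded_linear.has_vector_derivative[OF bounded_linear_vec_nth v[OF t], of j] by simp
    have K: "((\<lambda>t. kinetic m (v t)) has_real_derivative
        1 / 2 * (\<Sum>j\<in>UNIV. m j * (v t $ j \<bullet> acceleration m \<alpha> (x t) j + acceleration m \<alpha> (x t) j \<bullet> v t $ j))) (at t)"
      unfolding kinetic_def power2_norm_eq_inner
      by (intro DERIV_cmult DERIV_sum bounded_bilinear.has_vector_derivative[OF bounded_bilinear_inner, folded
            has_real_derivative_iff_has_vector_derivative] vj)
    have "((\<lambda>t. potential m \<alpha> (x t)) has_derivative
        (\<lambda>h. \<Sum>j\<in>UNIV. m j * (acceleration m \<alpha> (x t) j \<bullet> (h *\<^sub>R v t) $ j))) (at t)"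
      by (rule has_derivative_compose[OF x[OF t, unfolded has_vector_derivative_def]
            has_derivative_potential[OF cf[OF t] \<alpha>]])
    then have U: "((\<lambda>t. potential m \<alpha> (x t)) has_real_derivative
        (\<Sum>j\<in>UNIV. m j * (acceleration m \<alpha> (x t) j \<bullet> v t $ j))) (at t)"
      unfolding has_field_derivative_def
      by (rule has_derivative_eq_rhs) (simp add: fun_eq_iff sum_distrib_left sum_distrib_right mult_ac)
    show ?thesis
      by (rule DERIV_cong[OF DERIV_diff[OF K U]])
        (simp add: inner_commute sum_distrib_left)
  qed
  have "\<exists>H. \<forall>t\<in>{0<..<\<delta>}. kinetic m (v t) - potential m \<alpha> (x t) = H"
  proof -
    have "(\<lambda>t. kinetic m (v t) - potential m \<alpha> (x t)) constant_on {0<..<\<delta>}"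
    proof (rule DERIV_zero_connected_constant_on[OF _ _ finite.emptyI])
      show "continuous_on {0<..<\<delta>} (\<lambda>t. kinetic m (v t) - potential m \<alpha> (x t))"
        by (rule continuous_at_imp_continuous_on) (blast intro: DERIV_isCont d)
    qed (use d in \<open>simp_all add: connected_Ioo\<close>)
    then show ?thesis unfolding constant_on_def by blast
  qed
  then obtain H where "\<forall>t\<in>{0<..<\<delta>}. kinetic m (v t) - potential m \<alpha> (x t) = H" ..
  then show thesis by (intro that[of H]) (auto simp: algebra_simps)
qed

lemma potential_nonneg:
  fixes m :: "'n::{finite,linorder} \<Rightarrow> real"
  assumes "\<And>j. 0 < m j" "0 < \<alpha>"
  shows "0 \<le> potential m \<alpha> x"
  unfolding potential_def using assms by (intro sum_nonneg divide_nonneg_nonneg mult_nonneg_nonneg) (auto intro: less_imp_le)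

lemma kinetic_nonneg: "(\<And>j. 0 < m j) \<Longrightarrow> 0 \<le> kinetic m v"
  unfolding kinetic_def by (intro mult_nonneg_nonneg sum_nonneg) (auto intro: less_imp_le)

text \<open>The potential could a priori fail to be integrable at the collision. By conservation of
  energy it differs from the kinetic energy by a constant, and the kinetic energy is integrable for
  a path in H1.\<close>

lemma newton_solution_finite_action:
  fixes m :: "'n::{finite,linorder} \<Rightarrow> real"
  assumes H1: "H1_path \<delta> x" and m: "\<And>j. 0 < m j" and \<alpha>: "0 < \<alpha>"
    and x: "\<And>t. t \<in> {0<..<\<delta>} \<Longrightarrow> (x has_vector_derivative v t) (at t)"
    and v: "\<And>t. t \<in> {0<..<\<delta>} \<Longrightarrow> (v has_vector_derivative (\<chi> j. acceleration m \<alpha> (x t) j)) (at t)"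
    and cf: "\<And>t. t \<in> {0<..<\<delta>} \<Longrightarrow> collision_free (x t)"
  shows "(\<integral>\<^sup>+t\<in>{0<..<\<delta>}. ennreal (kinetic m (v t) + potential m \<alpha> (x t)) \<partial>lborel) < \<infinity>"
proof -
  have cv: "continuous_on {0<..<\<delta>} v"
    by (rule continuous_at_imp_continuous_on) (use v has_vector_derivative_continuous in blast)
  obtain H where H: "\<And>t. t \<in> {0<..<\<delta>} \<Longrightarrow> kinetic m (v t) = potential m \<alpha> (x t) + H"
    using energy_conservation[OF x v cf] \<alpha> by auto
  define M where "M = (\<Sum>j\<in>UNIV. m j)"
  have M: "0 \<le> M" unfolding M_def using m by (intro sum_nonneg) (auto intro: less_imp_le)
  have le: "kinetic m (v t) + potential m \<alpha> (x t) \<le> M * (norm (v t))\<^sup>2 + \<bar>H\<bar>" if t: "t \<in> {0<..<\<delta>}" for t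
  proof -
    have "(\<Sum>j\<in>UNIV. m j * (norm (v t $ j))\<^sup>2) \<le> (\<Sum>j\<in>UNIV. m j * (norm (v t))\<^sup>2)"
      using m by (intro sum_mono mult_left_mono power_mono Finite_Cartesian_Product.norm_nth_le) (auto intro: less_imp_le)
    then have "2 * kinetic m (v t) \<le> M * (norm (v t))\<^sup>2" by (simp add: kinetic_def M_def sum_distrib_right)
    then show ?thesis using H[OF t] by linarith
  qed
  have meas: "(\<lambda>t. ennreal ((norm (v t))\<^sup>2) * indicator {0<..<\<delta>} t) \<in> borel_measurable lborel"
    by (intro borel_measurable_ennreal_indicator_Ioo continuous_intros cv)
  have "(\<integral>\<^sup>+t\<in>{0<..<\<delta>}. ennreal (kinetic m (v t) + potential m \<alpha> (x t)) \<partial>lborel)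
      \<le> (\<integral>\<^sup>+t. ennreal M * (ennreal ((norm (v t))\<^sup>2) * indicator {0<..<\<delta>} t) + ennreal \<bar>H\<bar> * indicator {0<..<\<delta>} t \<partial>lborel)"
  proof (rule nn_integral_mono)
    fix t
    show "ennreal (kinetic m (v t) + potential m \<alpha> (x t)) * indicator {0<..<\<delta>} t
        \<le> ennreal M * (ennreal ((norm (v t))\<^sup>2) * indicator {0<..<\<delta>} t) + ennreal \<bar>H\<bar> * indicator {0<..<\<delta>} t"
    proof (cases "t \<in> {0<..<\<delta>}")
      case True
      then have "ennreal (kinetic m (v t) + potential m \<alpha> (x t)) \<le> ennreal (M * (norm (v t))\<^sup>2 + \<bar>H\<bar>)"
        by (intro ennreal_leI le)
      also have "\<dots> = ennreal M * ennreal ((norm (v t))\<^sup>2) + ennreal \<bar>H\<bar>"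
        using M by (simp add: ennreal_plus ennreal_mult)
      finally show ?thesis using True by simp
    qed simp
  qed
  also have "\<dots> = ennreal M * (\<integral>\<^sup>+t\<in>{0<..<\<delta>}. ennreal ((norm (v t))\<^sup>2) \<partial>lborel) + ennreal \<bar>H\<bar> * emeasure lborel {0<..<\<delta>}"
    using borel_measurable_times_ennreal[OF _ meas, of "\<lambda>t. ennreal M"]
    by (subst nn_integral_add) (simp_all add: nn_integral_cmult[OF meas] nn_integral_cmult_indicator)
  also have "\<dots> < \<infinity>"
    using H1_path_nn_integral_derivative_finite[OF H1 x cv] emeasure_bounded_finite[OF bounded_box[of 0 \<delta>]]
    by (auto simp: ennreal_mult_less_top)
  finally show ?thesis .
qed

section \<open>Geodesics of the Jacobi metric\<close>

text \<open>Prescribes the speed along a curve: \<open>S\<close> is the rescaled inverse of the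
  primitive of \<open>g\<close>, so a point where \<open>g\<close> is small is passed quickly. The
  constant in the derivative makes the total time equal to \<tau>.\<close>

lemma inverse_primitive:
  fixes g :: "real \<Rightarrow> real"
  assumes g: "continuous_on {0..1} g" "\<And>s. s \<in> {0..1} \<Longrightarrow> 0 < g s" and \<tau>: "0 < \<tau>"
  obtains S where "0 < integral {0..1} g" "continuous_on {0..\<tau>} S" "S 0 = 0" "S \<tau> = 1"
    "\<And>t. t \<in> {0..\<tau>} \<Longrightarrow> S t \<in> {0..1}"
    "\<And>t. t \<in> {0<..<\<tau>} \<Longrightarrow> (S has_real_derivative integral {0..1} g / (\<tau> * g (S t))) (at t)"
proof -
  define G where "G = (\<lambda>s. integral {0..s} g)"
  have dG: "(G has_real_derivative g s) (at s within {0..1})" if "s \<in> {0..1}" for s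
    unfolding G_def by (rule integral_has_real_derivative[OF g(1) that])
  have dGi: "(G has_real_derivative g s) (at s)" if "0 < s" "s < 1" for s
    using dG[of s] that at_within_Icc_at[of 0 s 1] by auto
  have cG: "continuous_on {0..1} G"
    by (rule DERIV_continuous_on[OF dG])
  have mono: "G s < G t" if "0 \<le> s" "s < t" "t \<le> 1" for s t
    by (rule DERIV_pos_imp_increasing_open[OF \<open>s < t\<close>])
      (use that g(2) in \<open>auto intro!: continuous_on_subset[OF cG] exI[of _ "g _"] dGi\<close>)
  define A where "A = integral {0..1} g"
  have G0: "G 0 = 0" and G1: "G 1 = A" by (simp_all add: G_def A_def)
  have A: "0 < A" using mono[of 0 1] G0 G1 by simp
  have inj: "inj_on G {0..1}"
    by (rule inj_onI) (metis mono atLeastAtMost_iff less_irrefl linorder_neqE)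
  have im: "G ` {0..1} = {0..A}"
  proof
    show "G ` {0..1} \<subseteq> {0..A}"
      using mono[of 0] mono[of _ 1] G0 G1 A by (force simp: le_less)
    show "{0..A} \<subseteq> G ` {0..1}"
    proof
      fix y assume "y \<in> {0..A}"
      then have "\<exists>s\<ge>0. s \<le> 1 \<and> G s = y" using IVT'[of G 0 y 1] G0 G1 cG by auto
      then show "y \<in> G ` {0..1}" by auto
    qed
  qed
  define R where "R = inv_into {0..1} G"
  have RG: "R (G s) = s" if "s \<in> {0..1}" for s
    unfolding R_def by (rule inv_into_f_f[OF inj that])
  have GR: "G (R y) = y" "R y \<in> {0..1}" if "y \<in> {0..A}" for y
    using that f_inv_into_f[of y G "{0..1}"] inv_into_into[of y G "{0..1}"] unfolding R_def im by blast+
  have cR: "continuous_on {0..A} R"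
    using continuous_on_inv[OF cG, of R] RG im by simp
  have R0: "R 0 = 0" and RA: "R A = 1" using RG[of 0] RG[of 1] G0 G1 by auto
  define S where "S = (\<lambda>t. R (A * t / \<tau>))"
  have in_A: "A * t / \<tau> \<in> {0..A}" if "t \<in> {0..\<tau>}" for t
    using that A \<tau> by (auto simp: field_simps)
  show thesis
  proof
    show "0 < integral {0..1} g" using A by (simp add: A_def)
    show "continuous_on {0..\<tau>} S"
      unfolding S_def by (rule continuous_on_compose2[OF cR]) (use in_A \<tau> in \<open>auto intro!: continuous_intros\<close>)
    show "S 0 = 0" "S \<tau> = 1" using R0 RA \<tau> by (auto simp: S_def)
    show "S t \<in> {0..1}" if "t \<in> {0..\<tau>}" for t
      unfolding S_def by (rule GR(2)[OF in_A[OF that]])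
    fix t assume t: "t \<in> {0<..<\<tau>}"
    let ?y = "A * t / \<tau>"
    have y: "0 < ?y" "?y < A" using t A \<tau> by (auto simp: field_simps)
    have Ry: "0 < R ?y" "R ?y < 1"
      using GR[of ?y] y G0 G1 by (auto simp: less_le)
    have "(R has_real_derivative inverse (g (R ?y))) (at ?y)"
    proof (rule DERIV_inverse_function[of G _ _ _ 0 A])
      show "(G has_real_derivative g (R ?y)) (at (R ?y))" using dGi Ry by blast
      show "g (R ?y) \<noteq> 0" using g(2)[of "R ?y"] Ry by auto
      show "isCont R ?y"
        using continuous_on_interior[OF cR, of ?y] y by simp
      show "G (R y) = y" if "0 < y" "y < A" for y using GR[of y] that by auto
    qed (use y in auto)
    then have "(S has_real_derivative inverse (g (R ?y)) * (A / \<tau>)) (at t)"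
      unfolding S_def by (rule DERIV_chain2) (use \<tau> in \<open>auto intro!: derivative_eq_intros\<close>)
    then show "(S has_real_derivative integral {0..1} g / (\<tau> * g (S t))) (at t)"
      using \<tau> by (simp add: S_def A_def field_simps)
  qed
qed

text \<open>
  The map \<open>w \<mapsto> w powr (1 / \<gamma>)\<close> flattens the Jacobi metric of the zero-energy \<open>\<alpha>\<close>-Kepler problem, so
  that the path below is a Jacobi geodesic up to a constant rescaling of time. This makes its kinetic
  and its potential energy proportional.
\<close>

lemma jacobi_geodesic:
  fixes w0 :: complex and \<gamma> \<alpha> \<tau> :: real
  assumes \<gamma>: "0 < \<gamma>" "\<gamma> \<le> 1" "\<alpha> = 2 - 2 * \<gamma>" and w0: "0 < Re w0" "norm w0 \<le> 1" and \<tau>: "0 < \<tau>"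
  defines "l \<equiv> norm (1 - w0)"
    and "A \<equiv> integral {0..1} (\<lambda>s. norm (w0 + of_real s * (1 - w0)) powr (\<alpha> / \<gamma>))"
  obtains Z Z' B where "continuous_on {0..\<tau>} Z" "Z 0 = w0 powr of_real (1 / \<gamma>)" "Z \<tau> = 1"
    "\<And>t. t \<in> {0..\<tau>} \<Longrightarrow> Z t \<noteq> 0" "\<And>t. t \<in> {0..\<tau>} \<Longrightarrow> norm (Z t) \<le> 1"
    "\<And>t. t \<in> {0<..<\<tau>} \<Longrightarrow> (Z has_vector_derivative Z' t) (at t)"
    "continuous_on {0<..<\<tau>} Z'" "\<And>t. t \<in> {0<..<\<tau>} \<Longrightarrow> norm (Z' t) \<le> B"
    "\<And>t. t \<in> {0<..<\<tau>} \<Longrightarrow> (norm (Z' t))\<^sup>2 = (l * A / (\<gamma> * \<tau>))\<^sup>2 * norm (Z t) powr (- \<alpha>)"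
    "(\<integral>\<^sup>+t\<in>{0<..<\<tau>}. ennreal (norm (Z t) powr (- \<alpha>)) \<partial>lborel) = ennreal (\<tau> / A)" "0 < A"
proof -
  define a where "a = \<alpha> / \<gamma>"
  have a: "a = 2 / \<gamma> - 2" using \<gamma> by (simp add: a_def field_simps)
  define W where "W = (\<lambda>s. w0 + of_real s * (1 - w0))"
  \<comment> \<open>Both ends of the segment, \<open>w0\<close> and 1, have real part at least
    \<open>d\<close>, hence so has every point between. This keeps the segment off the branch cut of
    the power and bounds its distance to 0 from below.\<close>
  define d where "d = min (Re w0) 1"
  have d: "0 < d" using w0 by (simp add: d_def)
  have ReW: "d \<le> Re (W s)" if "s \<in> {0..1}" for s
  proof -
    have "(1 - s) * d + s * d \<le> (1 - s) * Re w0 + s * 1"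
      using that by (intro add_mono mult_left_mono) (auto simp: d_def)
    then show ?thesis by (simp add: W_def algebra_simps)
  qed
  have W_not: "W s \<notin> \<real>\<^sub>\<le>\<^sub>0" "W s \<noteq> 0" "0 < norm (W s)" "d \<le> norm (W s)" if "s \<in> {0..1}" for s
    using ReW[OF that] d complex_Re_le_cmod[of "W s"] by (auto simp: complex_nonpos_Reals_iff)
  have W_le: "norm (W s) \<le> 1" if "s \<in> {0..1}" for s
  proof -
    have "W s = of_real (1 - s) * w0 + of_real s * 1" by (simp add: W_def algebra_simps)
    then have "norm (W s) \<le> (1 - s) * norm w0 + s"
      using norm_triangle_ineq[of "of_real (1 - s) * w0" "of_real s * 1"] that
      by (simp add: norm_mult del: of_real_diff)
    also have "\<dots> \<le> (1 - s) * 1 + s" using w0 that by (intro add_right_mono mult_left_mono) auto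
    finally show ?thesis by simp
  qed
  \<comment> \<open>The power map multiplies speeds by
    \<open>\<bar>W\<bar> powr (1 / \<gamma> - 1) / \<gamma>\<close>, and
    \<open>1 / \<gamma> - 1 = a / 2\<close>. Passing the segment with speed proportional to
    \<open>1 / g\<close> thus gives \<open>\<bar>Z'\<bar>\<close> proportional to
    \<open>\<bar>W\<bar> powr (- a / 2)\<close>, which is
    \<open>\<bar>Z\<bar> powr (- \<alpha> / 2)\<close>.\<close>
  define g where "g = (\<lambda>s. norm (W s) powr a)"
  have cW: "continuous_on X W" for X unfolding W_def by (intro continuous_intros)
  have cg: "continuous_on {0..1} g" unfolding g_def
    by (intro continuous_on_powr' continuous_intros cW) (use W_not in auto)
  have gpos: "0 < g s" if "s \<in> {0..1}" for s using W_not[OF that] by (simp add: g_def)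
  have Aeq: "integral {0..1} g = A" by (simp add: A_def g_def W_def a_def)
  obtain S where S: "0 < A" "continuous_on {0..\<tau>} S" "S 0 = 0" "S \<tau> = 1"
    "\<And>t. t \<in> {0..\<tau>} \<Longrightarrow> S t \<in> {0..1}"
    "\<And>t. t \<in> {0<..<\<tau>} \<Longrightarrow> (S has_real_derivative A / (\<tau> * g (S t))) (at t)"
    using inverse_primitive[OF cg gpos \<tau>] unfolding Aeq by blast
  have S01: "S t \<in> {0..1}" if "t \<in> {0<..<\<tau>}" for t using S(5) that by auto
  define Z where "Z = (\<lambda>t. W (S t) powr of_real (1 / \<gamma>))"
  define Z' where "Z' = (\<lambda>t. of_real (A / (\<tau> * g (S t))) * ((1 - w0) *
     (of_real (1 / \<gamma>) * W (S t) powr of_real (1 / \<gamma> - 1))))"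
  have nZ: "norm (Z t) = norm (W (S t)) powr (1 / \<gamma>)" for t
    by (simp add: Z_def norm_powr_real_powr')
  have nZa: "norm (Z t) powr (- \<alpha>) = norm (W (S t)) powr (- a)" for t
    by (simp add: nZ powr_powr a_def)
  have inv_g: "norm (W (S t)) powr (- a) = 1 / g (S t)" for t
    by (simp add: g_def powr_minus_divide)
  have nZ': "norm (Z' t) = l * A / (\<gamma> * \<tau>) * norm (W (S t)) powr (- a / 2)"
    if t: "t \<in> {0<..<\<tau>}" for t
  proof -
    have "norm (Z' t) = A / \<tau> * (norm (W (S t)) powr (- a)) * (l * (1 / \<gamma> * norm (W (S t)) powr (1 / \<gamma> - 1)))"
      unfolding Z'_def inv_g l_def using S(1) \<tau> \<gamma> gpos[OF S01[OF t]]
      by (simp add: norm_mult norm_powr_real_powr' norm_divide del: of_real_diff)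
    also have "\<dots> = l * A / (\<gamma> * \<tau>) * (norm (W (S t)) powr (- a) * norm (W (S t)) powr (1 / \<gamma> - 1))"
      by (simp add: field_simps)
    also have "norm (W (S t)) powr (- a) * norm (W (S t)) powr (1 / \<gamma> - 1) = norm (W (S t)) powr (- a / 2)"
    proof -
      have "- a + (1 / \<gamma> - 1) = - a / 2" by (simp add: a)
      then show ?thesis by (subst powr_add[symmetric]) (simp only:)
    qed
    finally show ?thesis .
  qed
  have cS: "continuous_on {0<..<\<tau>} S" by (rule continuous_on_subset[OF S(2)]) auto
  have cWS: "continuous_on {0<..<\<tau>} (\<lambda>t. W (S t))"
    by (rule continuous_on_compose2[OF cW[of UNIV] cS]) auto
  have cWS': "continuous_on {0..\<tau>} (\<lambda>t. W (S t))"
    by (rule continuous_on_compose2[OF cW[of UNIV] S(2)]) auto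
  have cgS: "continuous_on {0<..<\<tau>} (\<lambda>t. g (S t))"
    by (rule continuous_on_compose2[OF cg cS]) (use S01 in auto)
  show thesis
  proof
    show "continuous_on {0..\<tau>} Z" unfolding Z_def
      by (rule continuous_on_powr_complex[OF _ _ cWS']) (use W_not(2)[OF S(5)] order_trans[OF less_imp_le[OF d] ReW[OF S(5)]] in auto)
    show "Z 0 = w0 powr of_real (1 / \<gamma>)" using S by (simp add: Z_def W_def)
    show "Z \<tau> = 1" using S by (simp add: Z_def W_def)
    show "Z t \<noteq> 0" if "t \<in> {0..\<tau>}" for t using W_not[OF S(5)[OF that]] by (simp add: Z_def)
    show "norm (Z t) \<le> 1" if "t \<in> {0..\<tau>}" for t
      using powr_mono2[of "1 / \<gamma>" "norm (W (S t))" 1] W_le[OF S(5)[OF that]] \<gamma> by (simp add: nZ)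
    show "(Z has_vector_derivative Z' t) (at t)" if t: "t \<in> {0<..<\<tau>}" for t
    proof -
      have dS: "(S has_vector_derivative A / (\<tau> * g (S t))) (at t)"
        using S(6)[OF t] by (simp add: has_real_derivative_iff_has_vector_derivative)
      have "((\<lambda>s. W s) has_vector_derivative (1 - w0)) (at (S t))"
        unfolding W_def by (auto intro!: derivative_eq_intros simp: has_vector_derivative_def scaleR_conv_of_real)
      moreover have "((\<lambda>z. z powr of_real (1 / \<gamma>)) has_field_derivative
          of_real (1 / \<gamma>) * W (S t) powr (of_real (1 / \<gamma>) - 1)) (at (W (S t)))"
        by (rule has_field_derivative_powr) (use W_not[OF S01[OF t]] in auto)
      ultimately have "((\<lambda>z. z powr of_real (1 / \<gamma>)) \<circ> W has_vector_derivative
          (1 - w0) * (of_real (1 / \<gamma>) * W (S t) powr (of_real (1 / \<gamma>) - 1))) (at (S t))"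
        using field_vector_diff_chain_at[of W "1 - w0" "S t"] by blast
      from vector_diff_chain_at[OF dS this]
      show ?thesis by (simp add: Z_def Z'_def o_def scaleR_conv_of_real)
    qed
    have "continuous_on {0<..<\<tau>} (\<lambda>t. W (S t) powr of_real (1 / \<gamma> - 1))"
      by (rule continuous_on_powr_complex[OF _ _ cWS]) (use W_not(2)[OF S01] order_trans[OF less_imp_le[OF d] ReW[OF S01]] in auto)
    moreover have "\<tau> * g (S t) \<noteq> 0" if "t \<in> {0<..<\<tau>}" for t
      using gpos[OF S01[OF that]] \<tau> by simp
    ultimately show "continuous_on {0<..<\<tau>} Z'" unfolding Z'_def
      by (intro continuous_on_mult continuous_on_of_real continuous_on_divide continuous_on_const cgS ballI)
    show "norm (Z' t) \<le> l * A / (\<gamma> * \<tau>) * d powr (- a / 2)" if t: "t \<in> {0<..<\<tau>}" for t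
    proof -
      have "0 \<le> a" using \<gamma> by (simp add: a field_simps)
      then have "norm (W (S t)) powr (- a / 2) \<le> d powr (- a / 2)"
        by (intro powr_mono2') (use W_not[OF S01[OF t]] d in auto)
      then show ?thesis unfolding nZ'[OF t]
        by (rule mult_left_mono) (use \<gamma> \<tau> S(1) in \<open>simp add: l_def\<close>)
    qed
    show "(norm (Z' t))\<^sup>2 = (l * A / (\<gamma> * \<tau>))\<^sup>2 * norm (Z t) powr (- \<alpha>)" if t: "t \<in> {0<..<\<tau>}" for t
      unfolding nZ'[OF t] nZa power_mult_distrib
      by (simp add: power2_eq_square powr_add[symmetric])
    \<comment> \<open>The choice of speed makes the potential term an exact derivative, so its
      integral only depends on the values 0 and 1 of \<open>S\<close> at the ends.\<close>
    have dS: "((\<lambda>t. \<tau> / A * S t) has_vector_derivative norm (Z t) powr (- \<alpha>)) (at t)" if t: "t \<in> {0<..<\<tau>}" for t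
    proof -
      have "((\<lambda>t. \<tau> / A * S t) has_real_derivative \<tau> / A * (A / (\<tau> * g (S t)))) (at t)"
        by (rule DERIV_cmult[OF S(6)[OF t]])
      also have "\<tau> / A * (A / (\<tau> * g (S t))) = norm (Z t) powr (- \<alpha>)"
        using S(1) \<tau> gpos[OF S01[OF t]] by (simp add: nZa inv_g)
      finally show ?thesis by (simp add: has_real_derivative_iff_has_vector_derivative)
    qed
    have "((\<lambda>t. norm (Z t) powr (- \<alpha>)) has_integral \<tau> / A * S \<tau> - \<tau> / A * S 0) {0..\<tau>}"
      by (rule fundamental_theorem_of_calculus_interior) (use \<tau> dS S(1) in \<open>auto intro!: continuous_intros S(2)\<close>)
    then have "((\<lambda>t. norm (Z t) powr (- \<alpha>)) has_integral \<tau> / A) {0<..<\<tau>}"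
      using S by (simp add: has_integral_Icc_iff_Ioo)
    then show "(\<integral>\<^sup>+t\<in>{0<..<\<tau>}. ennreal (norm (Z t) powr (- \<alpha>)) \<partial>lborel) = ennreal (\<tau> / A)"
      by (rule nn_integral_has_integral_lebesgue'[rotated]) auto
    show "0 < A" by (rule S(1))
  qed
qed


lemma powr_diff_le:
  fixes u v a :: real
  assumes "1 \<le> a" "0 < u" "u \<le> 1" "0 < v" "v \<le> 1"
  shows "\<bar>u powr a - v powr a\<bar> \<le> a * \<bar>u - v\<bar>"
proof -
  have "norm (u powr a - v powr a) \<le> a * norm (u - v)"
  proof (rule field_differentiable_bound[of "{0<..1}"])
    show "((\<lambda>u. u powr a) has_field_derivative a * z powr (a - 1)) (at z within {0<..1})" if "z \<in> {0<..1}" for z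
      using that by (auto intro!: derivative_eq_intros)
    show "norm (a * z powr (a - 1)) \<le> a" if "z \<in> {0<..1}" for z
      using that assms(1) powr_mono2[of "a - 1" z 1] by (auto simp: norm_mult)
  qed (use assms in auto)
  then show ?thesis by simp
qed

text \<open>For \<open>w0 = 0\<close> the integral is \<open>1 / (a + 1)\<close>, and moving the
  starting point by \<open>b\<close> moves each point of the segment by at most \<open>b\<close>. Up
  to a scaling factor the integral is the potential action integral's reciprocal along the geodesic,
  and it governs the travel time.\<close>

lemma jacobi_time_estimate:
  fixes w0 :: complex
  assumes a: "1 \<le> a" and w0: "0 < Re w0" "norm w0 \<le> b" "b \<le> 1"
  shows "\<bar>integral {0..1} (\<lambda>s. norm (w0 + of_real s * (1 - w0)) powr a) - 1 / (a + 1)\<bar> \<le> a * b"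
proof -
  let ?W = "\<lambda>s::real. w0 + of_real s * (1 - w0)"
  have W: "0 < norm (?W s)" "\<bar>norm (?W s) - s\<bar> \<le> b" "norm (?W s) \<le> 1" if s: "s \<in> {0..1}" for s
  proof -
    have "0 < Re (?W s)"
    proof (cases "s = 1")
      case False
      then have "0 < (1 - s) * Re w0" using w0 s by auto
      then show ?thesis using s by (simp add: algebra_simps)
    qed simp
    then show "0 < norm (?W s)" by (metis less_irrefl zero_complex.simps(1) zero_less_norm_iff)
    have e: "?W s - of_real s = of_real (1 - s) * w0" by (simp add: algebra_simps)
    have "(1 - s) * norm w0 \<le> 1 * norm w0" using s by (intro mult_right_mono) auto
    then have n: "norm (?W s - of_real s) \<le> (1 - s) * norm w0" "(1 - s) * norm w0 \<le> b"
      unfolding e using s w0 by (auto simp: norm_mult simp del: of_real_diff)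
    have "\<bar>norm (?W s) - norm (of_real s :: complex)\<bar> \<le> norm (?W s - of_real s)"
      by (rule norm_triangle_ineq3)
    with n s show "\<bar>norm (?W s) - s\<bar> \<le> b" by simp
    have "(1 - s) * norm w0 \<le> (1 - s) * 1" using s w0 by (intro mult_left_mono) auto
    then show "norm (?W s) \<le> 1"
      using n norm_triangle_ineq2[of "?W s" "of_real s"] s by simp
  qed
  have i1: "(\<lambda>s. norm (?W s) powr a) integrable_on {0..1}"
    by (intro integrable_continuous_real continuous_on_powr' continuous_intros) (use W in auto)
  have "((\<lambda>s. s powr a) has_integral 1 powr (a + 1) / (a + 1) - 0 powr (a + 1) / (a + 1)) {0..1}"
    by (rule fundamental_theorem_of_calculus_interior)
      (use a in \<open>auto intro!: continuous_intros continuous_on_powr' derivative_eq_intros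
        simp: has_real_derivative_iff_has_vector_derivative[symmetric]\<close>)
  then have i2: "((\<lambda>s. s powr a) has_integral 1 / (a + 1)) {0..1}" by simp
  \<comment> \<open>The Lipschitz estimate of the power is stated for positive arguments, so
    \<open>s = 0\<close> is treated directly by
    \<open>\<bar>w0\<bar> powr a \<le> \<bar>w0\<bar>\<close>.\<close>
  have le: "\<bar>norm (?W s) powr a - s powr a\<bar> \<le> a * b" if s: "s \<in> {0..1}" for s
  proof (cases "s = 0")
    case True
    have "norm w0 powr a \<le> norm w0 powr 1"
      using W(1,3)[of 0] a by (intro powr_mono') auto
    also have "\<dots> \<le> b" using w0 by simp
    also have "\<dots> \<le> a * b" using a w0 norm_ge_zero[of w0] by (simp add: mult_le_cancel_right1 del: norm_ge_zero)
    finally show ?thesis using True by simp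
  next
    case False
    have "\<bar>norm (?W s) powr a - s powr a\<bar> \<le> a * \<bar>norm (?W s) - s\<bar>"
      by (rule powr_diff_le) (use a W[OF s] s False in auto)
    also have "\<dots> \<le> a * b" using W(2)[OF s] a by (intro mult_left_mono) auto
    finally show ?thesis .
  qed
  have "integral {0..1} (\<lambda>s. norm (?W s) powr a) - 1 / (a + 1)
      = integral {0..1} (\<lambda>s. norm (?W s) powr a - s powr a)"
    using i1 i2 by (subst Henstock_Kurzweil_Integration.integral_diff) (auto simp: integral_unique has_integral_integrable)
  moreover have "norm (integral {0..1} (\<lambda>s. norm (?W s) powr a - s powr a)) \<le> integral {0..1} (\<lambda>s::real. a * b)"
    by (rule integral_norm_bound_integral)
      (use i1 i2 le in \<open>auto intro!: Henstock_Kurzweil_Integration.integrable_diff intro: has_integral_integrable\<close>)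
  ultimately show ?thesis by simp
qed

text \<open>With \<open>X = k / ((a + 1) * A)\<close>, the quantities
  \<open>\<bar>1 - w0\<bar>\<^sup>2 / X\<close> and \<open>X\<close> are twice the kinetic and the
  potential share of the action of the arc, in units of the length of the radial ray. The segment is
  shorter by an amount linear in \<open>b\<close>, while the mismatch between \<open>k\<close> and
  \<open>(a + 1) * A\<close> enters only through its square.\<close>

lemma jacobi_length_gain:
  fixes a c :: real
  assumes a: "1 \<le> a" and c: "0 < c" "c \<le> 1"
  obtains b \<mu> where "0 < b" "b < 1" "0 < \<mu>" "\<mu> < 1"
    "\<And>w0 k A. \<lbrakk>norm (w0::complex) = b; c * b \<le> Re w0; \<bar>k - 1\<bar> \<le> b;
        A = integral {0..1} (\<lambda>s. norm (w0 + of_real s * (1 - w0)) powr a)\<rbrakk>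
      \<Longrightarrow> ((norm (1 - w0))\<^sup>2 / (k / ((a + 1) * A)) + k / ((a + 1) * A)) / 2 \<le> 1 - \<mu>"
proof -
  \<comment> \<open>Multiplying the time estimate by \<open>a + 1\<close> bounds the deviation of
    \<open>(a + 1) * A\<close> from 1 by \<open>K * b\<close>.\<close>
  define K where "K = a * (a + 1)"
  have K: "2 \<le> K" unfolding K_def using a mult_mono[of 1 a 2 "a + 1"] by auto
  \<comment> \<open>Chosen so that the squared mismatch \<open>((K + 1) * b)\<^sup>2\<close> equals
    \<open>c * b / 4\<close>, half of the available gain \<open>c * b / 2\<close>. The other half
    pays for \<mu> = \<open>c * b / 16\<close>, because \<open>2 * (P * k)\<close> is at most
    4.\<close>
  define b where "b = c / (4 * (K + 1)\<^sup>2)"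
  have K9: "9 \<le> (K + 1)\<^sup>2" using K power_mono[of 3 "K + 1" 2] by simp
  have b0: "0 < b" using K c by (simp add: b_def)
  have b1: "(K + 1)\<^sup>2 * b = c / 4" using K by (simp add: b_def)
  have b2: "36 * b \<le> c" using mult_right_mono[OF K9, of b] b0 b1 by simp
  have "K * b \<le> (K + 1)\<^sup>2 * b" using K b0 by (intro mult_right_mono) (auto simp: power2_eq_square algebra_simps)
  then have Kb: "K * b \<le> 1 / 4" using b1 c by simp
  show thesis
  proof
    show "0 < b" by fact
    show "b < 1" using b2 c b0 by simp
    show "0 < c * b / 16" using b0 c by simp
    show "c * b / 16 < 1" using mult_mono[of c 1 b 1] b2 c b0 by simp
    fix w0 :: complex and k A
    assume w: "norm w0 = b" "c * b \<le> Re w0" and k: "\<bar>k - 1\<bar> \<le> b"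
      and A: "A = integral {0..1} (\<lambda>s. norm (w0 + of_real s * (1 - w0)) powr a)"
    have "0 < c * b" using b0 c by simp
    then have "\<bar>A - 1 / (a + 1)\<bar> \<le> a * b"
      unfolding A by (intro jacobi_time_estimate a) (use w b2 c b0 in linarith)+
    then have "(a + 1) * \<bar>A - 1 / (a + 1)\<bar> \<le> (a + 1) * (a * b)" using a by (intro mult_left_mono) auto
    moreover have "(a + 1) * \<bar>A - 1 / (a + 1)\<bar> = \<bar>(a + 1) * (A - 1 / (a + 1))\<bar>" using a by (simp add: abs_mult)
    moreover have "(a + 1) * (A - 1 / (a + 1)) = (a + 1) * A - 1" using a by (simp add: field_simps)
    ultimately have P: "\<bar>(a + 1) * A - 1\<bar> \<le> K * b" by (simp add: K_def algebra_simps)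
    define P where "P = (a + 1) * A"
    have P': "\<bar>P - 1\<bar> \<le> K * b" using P by (simp add: P_def)
    have Pb: "3 / 4 \<le> P" "P \<le> 5 / 4" using P' Kb by (simp_all only: abs_le_iff) linarith+
    have kb: "3 / 4 \<le> k" "k \<le> 5 / 4" using k b2 c by (simp_all only: abs_le_iff) linarith+
    define L where "L = (norm (1 - w0))\<^sup>2"
    have L: "L = 1 - 2 * Re w0 + b\<^sup>2"
      unfolding L_def w(1)[symmetric] cmod_power2 by (simp add: power2_eq_square algebra_simps)
    \<comment> \<open>In \<open>1 - L = 2 * Re w0 - b\<^sup>2\<close> the linear part is at least
      \<open>2 * c * b\<close>, and one half of it absorbs the square as \<open>b\<close> is at most
      \<open>c\<close>.\<close>
    have "b * b \<le> c * b" using b2 b0 by (intro mult_right_mono) auto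
    then have "c * b \<le> 1 - L" using L w by (simp add: power2_eq_square)
    moreover have "1 / 2 \<le> P\<^sup>2" using power_mono[OF Pb(1), of 2] by (simp add: power2_eq_square)
    ultimately have "c * b * (1 / 2) \<le> (1 - L) * P\<^sup>2"
      using b0 c \<open>0 < c * b\<close> by (intro mult_mono) linarith+
    moreover have "(P - k)\<^sup>2 \<le> ((K + 1) * b)\<^sup>2"
      using P' k by (intro abs_le_square_iff[THEN iffD1]) (auto simp: algebra_simps abs_le_iff)
    moreover have "((K + 1) * b)\<^sup>2 = c / 4 * b"
      unfolding b1[symmetric] by (simp add: power2_eq_square)
    moreover have "P * k \<le> 5 / 4 * (5 / 4)" using Pb kb by (intro mult_mono) auto
    then have "c * b / 16 * (2 * (P * k)) \<le> c * b / 16 * 4"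
      using b0 c by (intro mult_left_mono) auto
    \<comment> \<open>What remains is completing the square: \<open>L * P\<^sup>2 + k\<^sup>2 = (P -
      k)\<^sup>2 + 2 * P * k - (1 - L) * P\<^sup>2\<close>.\<close>
    ultimately have "(P - k)\<^sup>2 \<le> (1 - L) * P\<^sup>2 - c * b / 16 * (2 * (P * k))" by linarith
    then have "L * P\<^sup>2 + k\<^sup>2 \<le> (1 - c * b / 16) * (2 * (P * k))"
      by (simp add: power2_eq_square algebra_simps)
    moreover have "(L / (k / P) + k / P) / 2 = (L * P\<^sup>2 + k\<^sup>2) / (2 * (P * k))"
      using Pb kb by (simp add: power2_eq_square field_simps)
    moreover have "0 < 2 * (P * k)" using Pb kb by simp
    ultimately show "((norm (1 - w0))\<^sup>2 / (k / ((a + 1) * A)) + k / ((a + 1) * A)) / 2 \<le> 1 - c * b / 16"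
      unfolding P_def[symmetric] L_def[symmetric] by (simp add: pos_divide_le_eq)
  qed
qed

text \<open>Dividing positions by \<open>R\<close> brings the end of the arc to 1, so
  \<open>b\<close> and \<mu> are uniform in the collision path and in \<tau>. The time hypothesis
  says that \<tau> is nearly the collision time from distance \<open>R\<close>; \<open>c\<close> is
  a uniform lower bound for the component of the starting direction along the ray.\<close>

lemma shorter_connection:
  fixes \<alpha> \<kappa> c :: real
  assumes \<alpha>: "1 \<le> \<alpha>" "\<alpha> < 2" and \<kappa>: "0 < \<kappa>" and c: "0 < c" "c \<le> 1"
  defines "\<gamma> \<equiv> 1 - \<alpha> / 2"
  obtains b \<mu> where "0 < b" "b < 1" "0 < \<mu>" "\<mu> < 1"
    "\<And>R \<tau> \<psi>. \<lbrakk>0 < R; 0 < \<tau>; \<bar>\<tau> * ((1 + \<alpha> / 2) * sqrt (2 * \<kappa>)) / R powr (1 + \<alpha> / 2) - 1\<bar> \<le> b;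
        \<bar>\<gamma> * \<psi>\<bar> < pi / 2; c \<le> cos (\<gamma> * \<psi>)\<rbrakk>
      \<Longrightarrow> \<exists>Z Z' B. continuous_on {0..\<tau>} Z \<and> Z 0 = of_real (b powr (1 / \<gamma>)) * cis \<psi> \<and> Z \<tau> = 1
        \<and> (\<forall>t\<in>{0..\<tau>}. Z t \<noteq> 0 \<and> norm (Z t) \<le> 1)
        \<and> (\<forall>t\<in>{0<..<\<tau>}. (Z has_vector_derivative Z' t) (at t) \<and> norm (Z' t) \<le> B)
        \<and> continuous_on {0<..<\<tau>} Z'
        \<and> (\<integral>\<^sup>+t\<in>{0<..<\<tau>}. ennreal ((R * norm (Z' t))\<^sup>2 / 2 + \<kappa> * (R * norm (Z t)) powr (- \<alpha>)) \<partial>lborel)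
          \<le> ennreal ((1 - \<mu>) * (sqrt (2 * \<kappa>) / \<gamma> * R powr \<gamma>))"
proof -
  have \<gamma>: "0 < \<gamma>" "\<gamma> \<le> 1" "\<alpha> = 2 - 2 * \<gamma>" "\<gamma> \<le> 1 / 2" using \<alpha> by (auto simp: \<gamma>_def)
  define a where "a = \<alpha> / \<gamma>"
  \<comment> \<open>The second identity converts
    \<open>\<bar>r\<bar> powr (1 + \<alpha> / 2)\<close> in the collision asymptotics into
    \<open>\<bar>w\<bar> powr (a + 1)\<close>, the scale of time in flattened coordinates.\<close>
  have a: "1 \<le> a" "(a + 1) * \<gamma> = 1 + \<alpha> / 2"
    using \<gamma>(1,3,4) \<alpha> by (simp_all add: a_def le_divide_eq distrib_right)
  obtain b \<mu> where b: "0 < b" "b < 1" "0 < \<mu>" "\<mu> < 1"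
    "\<And>w0 k A. \<lbrakk>norm (w0::complex) = b; c * b \<le> Re w0; \<bar>k - 1\<bar> \<le> b;
        A = integral {0..1} (\<lambda>s. norm (w0 + of_real s * (1 - w0)) powr a)\<rbrakk>
      \<Longrightarrow> ((norm (1 - w0))\<^sup>2 / (k / ((a + 1) * A)) + k / ((a + 1) * A)) / 2 \<le> 1 - \<mu>"
    using jacobi_length_gain[OF a(1) c] by blast
  show thesis
  proof (rule that[OF b(1-4)])
    fix R \<tau> \<psi> :: real
    assume R: "0 < R" and \<tau>: "0 < \<tau>"
      and k: "\<bar>\<tau> * ((1 + \<alpha> / 2) * sqrt (2 * \<kappa>)) / R powr (1 + \<alpha> / 2) - 1\<bar> \<le> b"
      and \<psi>: "\<bar>\<gamma> * \<psi>\<bar> < pi / 2" "c \<le> cos (\<gamma> * \<psi>)"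
    define w0 where "w0 = of_real b * cis (\<gamma> * \<psi>)"
    have nw0: "norm w0 = b" and Rew0: "c * b \<le> Re w0"
      using b \<psi> by (auto simp: w0_def norm_mult mult.commute)
    have Rpos: "0 < Re w0" using Rew0 mult_pos_pos[OF c(1) b(1)] by linarith
    have nw1: "norm w0 \<le> 1" using nw0 b by simp
    define l where "l = norm (1 - w0)"
    define A where "A = integral {0..1} (\<lambda>s. norm (w0 + of_real s * (1 - w0)) powr (\<alpha> / \<gamma>))"
    define q where "q = sqrt (2 * \<kappa>)"
    have q: "0 < q" "q\<^sup>2 = 2 * \<kappa>" using \<kappa> by (auto simp: q_def)
    \<comment> \<open>The ratio of \<tau> to the leading-order time of a zero-energy collision from
      distance \<open>R\<close>.\<close>
    define k where "k = \<tau> * ((1 + \<alpha> / 2) * q) / R powr (1 + \<alpha> / 2)"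
    obtain Z Z' B where Z: "continuous_on {0..\<tau>} Z" "Z 0 = w0 powr of_real (1 / \<gamma>)" "Z \<tau> = 1"
      "\<And>t. t \<in> {0..\<tau>} \<Longrightarrow> Z t \<noteq> 0" "\<And>t. t \<in> {0..\<tau>} \<Longrightarrow> norm (Z t) \<le> 1"
      "\<And>t. t \<in> {0<..<\<tau>} \<Longrightarrow> (Z has_vector_derivative Z' t) (at t)"
      "continuous_on {0<..<\<tau>} Z'" "\<And>t. t \<in> {0<..<\<tau>} \<Longrightarrow> norm (Z' t) \<le> B"
      "\<And>t. t \<in> {0<..<\<tau>} \<Longrightarrow> (norm (Z' t))\<^sup>2 = (l * A / (\<gamma> * \<tau>))\<^sup>2 * norm (Z t) powr (- \<alpha>)"
      "(\<integral>\<^sup>+t\<in>{0<..<\<tau>}. ennreal (norm (Z t) powr (- \<alpha>)) \<partial>lborel) = ennreal (\<tau> / A)" "0 < A"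
      using jacobi_geodesic[OF \<gamma>(1-3) Rpos nw1 \<tau>] unfolding l_def A_def by blast
    have gain: "(l\<^sup>2 / (k / ((a + 1) * A)) + k / ((a + 1) * A)) / 2 \<le> 1 - \<mu>"
      unfolding l_def by (rule b(5)[OF nw0 Rew0]) (use k in \<open>simp_all add: k_def q_def A_def a_def\<close>)
    \<comment> \<open>The argument of \<open>w0\<close> lies in the principal range because it is
      smaller than a right angle. Its power then has the angle \<psi> itself, even when \<psi> lies
      outside the principal range.\<close>
    have "w0 = exp (Complex (ln b) (\<gamma> * \<psi>))"
      using b by (simp add: w0_def exp_eq_polar exp_of_real)
    then have Ln: "Ln w0 = Complex (ln b) (\<gamma> * \<psi>)"
      using \<psi> pi_gt_zero by (auto intro!: Ln_exp simp: abs_less_iff)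
    have "w0 \<noteq> 0" using nw0 b by auto
    then have Z0: "Z 0 = of_real (b powr (1 / \<gamma>)) * cis \<psi>"
      using \<gamma> b by (simp add: Z(2) powr_def Ln exp_eq_polar exp_of_real)
    \<comment> \<open>Kinetic and potential energy of the scaled arc are both multiples of
      \<open>\<bar>Z\<bar> powr (- \<alpha>)\<close>; this is the sum of the two factors.\<close>
    define M where "M = R\<^sup>2 * (l * A / (\<gamma> * \<tau>))\<^sup>2 / 2 + \<kappa> * R powr (- \<alpha>)"
    have M0: "0 \<le> M" using \<kappa> by (simp add: M_def)
    have "(\<integral>\<^sup>+t\<in>{0<..<\<tau>}. ennreal ((R * norm (Z' t))\<^sup>2 / 2 + \<kappa> * (R * norm (Z t)) powr (- \<alpha>)) \<partial>lborel)
        = (\<integral>\<^sup>+t. ennreal M * (ennreal (norm (Z t) powr (- \<alpha>)) * indicator {0<..<\<tau>} t) \<partial>lborel)"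
    proof (rule nn_integral_cong)
      fix t
      have "(R * norm (Z' t))\<^sup>2 / 2 + \<kappa> * (R * norm (Z t)) powr (- \<alpha>) = M * norm (Z t) powr (- \<alpha>)"
        if "t \<in> {0<..<\<tau>}"
        unfolding power_mult_distrib Z(9)[OF that] M_def using R by (simp add: powr_mult algebra_simps)
      then show "ennreal ((R * norm (Z' t))\<^sup>2 / 2 + \<kappa> * (R * norm (Z t)) powr (- \<alpha>)) * indicator {0<..<\<tau>} t
          = ennreal M * (ennreal (norm (Z t) powr (- \<alpha>)) * indicator {0<..<\<tau>} t)"
        using M0 by (cases "t \<in> {0<..<\<tau>}") (simp_all add: ennreal_mult)
    qed
    also have "\<dots> = ennreal M * ennreal (\<tau> / A)"
    proof (subst nn_integral_cmult)
      have "continuous_on {0<..<\<tau>} (\<lambda>t. norm (Z t) powr (- \<alpha>))"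
        by (intro continuous_on_powr' continuous_intros continuous_on_subset[OF Z(1)]) (use Z(4) in auto)
      then show "(\<lambda>t. ennreal (norm (Z t) powr (- \<alpha>)) * indicator {0<..<\<tau>} t) \<in> borel_measurable lborel"
        by (rule borel_measurable_ennreal_indicator_Ioo)
    qed (simp add: Z(10))
    also have "\<dots> = ennreal (M * (\<tau> / A))"
      using M0 by (subst ennreal_mult) (use \<tau> Z(11) in auto)
    also have "M * (\<tau> / A) = q / \<gamma> * R powr \<gamma> * ((l\<^sup>2 / (k / ((a + 1) * A)) + k / ((a + 1) * A)) / 2)"
    proof -
      have R1: "R powr (1 + \<alpha> / 2) * R powr \<gamma> = R\<^sup>2"
        using R by (simp add: powr_add[symmetric] \<gamma>_def)
      have "1 + \<alpha> / 2 = \<gamma> + \<alpha>" by (simp add: \<gamma>_def)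
      then have R2: "R powr (1 + \<alpha> / 2) = R powr \<gamma> * R powr \<alpha>"
        by (simp only: powr_add)
      \<comment> \<open>In units of the length \<open>q / \<gamma> * R powr \<gamma>\<close> of the
        ray, the kinetic part of the action is \<open>l\<^sup>2 / (2 * X)\<close> and the potential
        part \<open>X / 2\<close>. Equality \<open>X = l\<close> would mean zero energy.\<close>
      define X where "X = k / ((a + 1) * A)"
      have X: "X = \<tau> * \<gamma> * q / (A * R powr (1 + \<alpha> / 2))"
      proof -
        have "X = \<tau> * ((a + 1) * \<gamma> * q) / R powr (1 + \<alpha> / 2) / ((a + 1) * A)"
          by (simp only: X_def k_def a(2))
        also have "\<dots> = (a + 1) * (\<tau> * \<gamma> * q) / ((a + 1) * (A * R powr (1 + \<alpha> / 2)))"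
          by (simp add: mult_ac)
        also have "\<dots> = \<tau> * \<gamma> * q / (A * R powr (1 + \<alpha> / 2))"
          using a by (intro mult_divide_mult_cancel_left) simp
        finally show ?thesis .
      qed
      have \<tau>A: "\<tau> / A = X * R powr (1 + \<alpha> / 2) / (\<gamma> * q)"
        using q \<gamma> Z(11) R by (simp add: X)
      have X0: "X > 0" unfolding X using \<tau> \<gamma> q Z(11) R by simp
      have "R\<^sup>2 * (l * A / (\<gamma> * \<tau>))\<^sup>2 / 2 * (\<tau> / A) = R\<^sup>2 * l\<^sup>2 / (2 * \<gamma>\<^sup>2 * (\<tau> / A))"
        using \<tau> Z(11) by (simp add: power2_eq_square field_simps)
      also have "\<dots> = q / \<gamma> * R powr \<gamma> * (l\<^sup>2 / X / 2)"
        unfolding \<tau>A R1[symmetric] using R X0 \<gamma> q by (simp add: power2_eq_square field_simps)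
      finally have 1: "R\<^sup>2 * (l * A / (\<gamma> * \<tau>))\<^sup>2 / 2 * (\<tau> / A) = q / \<gamma> * R powr \<gamma> * (l\<^sup>2 / X / 2)" .
      have "\<kappa> * R powr (- \<alpha>) * (\<tau> / A) = q\<^sup>2 / 2 * R powr (- \<alpha>) * (X * (R powr \<gamma> * R powr \<alpha>) / (\<gamma> * q))"
        unfolding \<tau>A R2 q(2) by simp
      also have "\<dots> = q / \<gamma> * R powr \<gamma> * (X / 2)"
        using R q(1) by (simp add: power2_eq_square powr_minus field_simps)
      finally have 2: "\<kappa> * R powr (- \<alpha>) * (\<tau> / A) = q / \<gamma> * R powr \<gamma> * (X / 2)" .
      show ?thesis unfolding M_def distrib_right[of _ _ "\<tau> / A"] 1 2 X_def[symmetric]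
        by (simp add: distrib_left add_divide_distrib)
    qed
    also have "ennreal \<dots> \<le> ennreal (q / \<gamma> * R powr \<gamma> * (1 - \<mu>))"
      using gain q \<gamma> by (intro ennreal_leI mult_left_mono) auto
    finally have le: "(\<integral>\<^sup>+t\<in>{0<..<\<tau>}. ennreal ((R * norm (Z' t))\<^sup>2 / 2 + \<kappa> * (R * norm (Z t)) powr (- \<alpha>)) \<partial>lborel)
          \<le> ennreal ((1 - \<mu>) * (sqrt (2 * \<kappa>) / \<gamma> * R powr \<gamma>))"
      by (simp add: q_def mult.commute)
    show "\<exists>Z Z' B. continuous_on {0..\<tau>} Z \<and> Z 0 = of_real (b powr (1 / \<gamma>)) * cis \<psi> \<and> Z \<tau> = 1
        \<and> (\<forall>t\<in>{0..\<tau>}. Z t \<noteq> 0 \<and> norm (Z t) \<le> 1)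
        \<and> (\<forall>t\<in>{0<..<\<tau>}. (Z has_vector_derivative Z' t) (at t) \<and> norm (Z' t) \<le> B)
        \<and> continuous_on {0<..<\<tau>} Z'
        \<and> (\<integral>\<^sup>+t\<in>{0<..<\<tau>}. ennreal ((R * norm (Z' t))\<^sup>2 / 2 + \<kappa> * (R * norm (Z t)) powr (- \<alpha>)) \<partial>lborel)
          \<le> ennreal ((1 - \<mu>) * (sqrt (2 * \<kappa>) / \<gamma> * R powr \<gamma>))"
      using Z(1,3-8) Z0 le by blast
  qed
qed

section \<open>Changing the relative position of a pair\<close>

text \<open>Jacobi coordinates of the pair: a configuration is its collapse plus the spread of its
  relative vector, which points from \<open>p\<close> to \<open>q\<close>. Both maps are linear, so
  the same decomposition applies to velocities.\<close>

definition pair_collapse :: "('n::finite \<Rightarrow> real) \<Rightarrow> 'n \<Rightarrow> 'n \<Rightarrow> 'n config \<Rightarrow> 'n config" where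
  "pair_collapse m p q x = (\<chi> j. if j \<in> {p, q} then cluster_center m {p, q} x else x $ j)"

definition pair_spread :: "('n::finite \<Rightarrow> real) \<Rightarrow> 'n \<Rightarrow> 'n \<Rightarrow> complex \<Rightarrow> 'n config" where
  "pair_spread m p q z = (\<chi> j. if j = p then - (m q / (m p + m q)) *\<^sub>R z
     else if j = q then (m p / (m p + m q)) *\<^sub>R z else 0)"

lemma sum_UNIV_pair:
  fixes f :: "'n::finite \<Rightarrow> 'a::comm_monoid_add"
  assumes "p \<noteq> q"
  shows "sum f UNIV = f p + f q + sum f (UNIV - {p, q})"
proof -
  have "sum f UNIV = sum f {p, q} + sum f (UNIV - {p, q})"
    by (subst sum.subset_diff[of "{p, q}"]) (auto simp: add.commute)
  then show ?thesis using assms by simp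
qed

lemma cluster_center_pair:
  "p \<noteq> q \<Longrightarrow> cluster_center m {p, q} x = (m p *\<^sub>R x $ p + m q *\<^sub>R x $ q) /\<^sub>R (m p + m q)"
  by (simp add: cluster_center_def)

lemma bounded_linear_pair_collapse: "bounded_linear (pair_collapse m p q)"
  unfolding linear_conv_bounded_linear[symmetric] pair_collapse_def cluster_center_def
  by (rule linearI)
    (auto simp: vec_eq_iff scaleR_add_right sum.distrib scaleR_sum_right mult_ac)

lemma bounded_linear_pair_spread: "bounded_linear (pair_spread m p q)"
  unfolding linear_conv_bounded_linear[symmetric] pair_spread_def
  by (rule linearI) (auto simp: vec_eq_iff algebra_simps)

lemma pair_collapse_add_spread:
  fixes m :: "'n::finite \<Rightarrow> real"
  assumes "p \<noteq> q" "0 < m p" "0 < m q"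
  shows "pair_collapse m p q x + pair_spread m p q (x $ q - x $ p) = x"
proof -
  define a where "a = m q / (m p + m q)"
  define b where "b = m p / (m p + m q)"
  have ab: "a + b = 1" using assms by (simp add: a_def b_def add_divide_distrib[symmetric])
  have c: "(m p *\<^sub>R x $ p + m q *\<^sub>R x $ q) /\<^sub>R (m p + m q) = b *\<^sub>R x $ p + a *\<^sub>R x $ q"
    by (simp add: a_def b_def scaleR_add_right divide_inverse mult.commute)
  have "(b *\<^sub>R x $ p + a *\<^sub>R x $ q) - a *\<^sub>R (x $ q - x $ p) = (a + b) *\<^sub>R x $ p"
    "(b *\<^sub>R x $ p + a *\<^sub>R x $ q) + b *\<^sub>R (x $ q - x $ p) = (a + b) *\<^sub>R x $ q"
    by (simp_all add: algebra_simps)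
  then have "(m p *\<^sub>R x $ p + m q *\<^sub>R x $ q) /\<^sub>R (m p + m q) - (m q / (m p + m q)) *\<^sub>R (x $ q - x $ p) = x $ p"
    and "(m p *\<^sub>R x $ p + m q *\<^sub>R x $ q) /\<^sub>R (m p + m q) + (m p / (m p + m q)) *\<^sub>R (x $ q - x $ p) = x $ q"
    unfolding c a_def[symmetric] b_def[symmetric] ab by simp_all
  then show ?thesis
    using assms(1) by (auto simp: vec_eq_iff pair_collapse_def pair_spread_def cluster_center_pair)
qed

lemma pair_nth:
  fixes m :: "'n::finite \<Rightarrow> real"
  assumes "p \<noteq> q"
  shows "(pair_collapse m p q x + pair_spread m p q z) $ p = cluster_center m {p, q} x - (m q / (m p + m q)) *\<^sub>R z"
    and "(pair_collapse m p q x + pair_spread m p q z) $ q = cluster_center m {p, q} x + (m p / (m p + m q)) *\<^sub>R z"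
    and "j \<notin> {p, q} \<Longrightarrow> (pair_collapse m p q x + pair_spread m p q z) $ j = x $ j"
  using assms by (auto simp: pair_collapse_def pair_spread_def)

lemma pair_diff:
  fixes m :: "'n::finite \<Rightarrow> real"
  assumes "p \<noteq> q" "0 < m p" "0 < m q"
  shows "(pair_collapse m p q x + pair_spread m p q z) $ q - (pair_collapse m p q x + pair_spread m p q z) $ p = z"
proof -
  have "m p / (m p + m q) + m q / (m p + m q) = 1" using assms by (simp add: add_divide_distrib[symmetric])
  then show ?thesis unfolding pair_nth(1,2)[OF assms(1)]
    by (simp add: scaleR_add_left[symmetric])
qed

lemma norm_pair_spread_le:
  fixes m :: "'n::finite \<Rightarrow> real"
  assumes "p \<noteq> q" "0 < m p" "0 < m q"
  shows "norm (pair_spread m p q z) \<le> norm z"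
proof -
  have "norm (pair_spread m p q z) \<le> (\<Sum>j\<in>UNIV. norm (pair_spread m p q z $ j))"
    unfolding norm_vec_def by (rule L2_set_le_sum) auto
  also have "\<dots> = m q / (m p + m q) * norm z + m p / (m p + m q) * norm z + (\<Sum>j\<in>UNIV - {p, q}. 0)"
    unfolding sum_UNIV_pair[OF assms(1), of "\<lambda>j. norm (pair_spread m p q z $ j)"]
    using assms by (intro arg_cong2[where f = "(+)"] sum.cong) (auto simp: pair_spread_def)
  also have "\<dots> = norm z" using assms
    by (simp add: distrib_right[symmetric] add_divide_distrib[symmetric] add.commute)
  finally show ?thesis .
qed

lemma centered_pair:
  fixes m :: "'n::finite \<Rightarrow> real"
  assumes "p \<noteq> q" "0 < m p" "0 < m q" "x \<in> centered_configs m"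
  shows "pair_collapse m p q x + pair_spread m p q z \<in> centered_configs m"
proof -
  let ?y = "pair_collapse m p q x + pair_spread m p q z"
  have "m p *\<^sub>R ?y $ p + m q *\<^sub>R ?y $ q = m p *\<^sub>R x $ p + m q *\<^sub>R x $ q"
  proof -
    have "m p *\<^sub>R ?y $ p + m q *\<^sub>R ?y $ q = (m p + m q) *\<^sub>R cluster_center m {p, q} x"
      unfolding pair_nth(1,2)[OF assms(1)] by (simp add: algebra_simps)
    then show ?thesis using assms by (simp add: cluster_center_pair)
  qed
  moreover have "(\<Sum>j\<in>UNIV - {p, q}. m j *\<^sub>R ?y $ j) = (\<Sum>j\<in>UNIV - {p, q}. m j *\<^sub>R x $ j)"
    using pair_nth(3)[OF assms(1)] by (intro sum.cong refl) auto
  ultimately show ?thesis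
    using assms(4) by (simp only: centered_configs_def mem_Collect_eq sum_UNIV_pair[OF assms(1)])
qed

text \<open>The motion of the centre of mass and the relative motion are orthogonal for the
  mass-weighted inner product; the last coefficient is the reduced mass.\<close>

lemma kinetic_pair:
  fixes m :: "'n::finite \<Rightarrow> real"
  assumes "p \<noteq> q" "0 < m p" "0 < m q"
  shows "kinetic m (pair_collapse m p q v + pair_spread m p q w) =
    kinetic m (pair_collapse m p q v) + m p * m q / (m p + m q) * ((norm w)\<^sup>2 / 2)"
proof -
  let ?y = "pair_collapse m p q v + pair_spread m p q w"
  define c where "c = cluster_center m {p, q} v"
  define b where "b = m p / (m p + m q)"
  define a where "a = m q / (m p + m q)"
  have ab: "a + b = 1" "m p * a = m q * b" "m p * a = m p * m q / (m p + m q)"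
    using assms by (auto simp: a_def b_def add_divide_distrib[symmetric])
  have "m p * (norm (?y $ p))\<^sup>2 + m q * (norm (?y $ q))\<^sup>2
      = m p * (norm c)\<^sup>2 + m q * (norm c)\<^sup>2 + (m p * a * a + m q * b * b) * (norm w)\<^sup>2
        + 2 * (m q * b - m p * a) * (c \<bullet> w)"
    unfolding pair_nth(1,2)[OF assms(1)] c_def[symmetric] a_def[symmetric] b_def[symmetric] power2_norm_eq_inner
    by (simp add: inner_diff_left inner_diff_right inner_add_left inner_add_right inner_commute algebra_simps)
  also have "m p * a * a + m q * b * b = m p * m q / (m p + m q)"
    using ab by (metis distrib_left mult.right_neutral)
  finally have pq: "m p * (norm (?y $ p))\<^sup>2 + m q * (norm (?y $ q))\<^sup>2
      = m p * (norm c)\<^sup>2 + m q * (norm c)\<^sup>2 + m p * m q / (m p + m q) * (norm w)\<^sup>2"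
    using ab(2) by simp
  have rest: "(\<Sum>j\<in>UNIV - {p, q}. m j * (norm (?y $ j))\<^sup>2)
      = (\<Sum>j\<in>UNIV - {p, q}. m j * (norm (pair_collapse m p q v $ j))\<^sup>2)"
    by (intro sum.cong refl) (auto simp: pair_spread_def)
  have "pair_collapse m p q v $ p = c" "pair_collapse m p q v $ q = c" by (simp_all add: pair_collapse_def c_def)
  then show ?thesis
    unfolding kinetic_def sum_UNIV_pair[OF assms(1), of "\<lambda>j. m j * (norm (_ $ j))\<^sup>2"] pq rest
    by (simp add: algebra_simps)
qed

text \<open>Apart from the pair's own term, only its terms with the other bodies change, and
  afterwards their distances are at least \<open>d\<close>. Both pair terms enter with a plus sign,
  so that the estimate can be integrated in the extended nonnegative reals without
  subtraction.\<close>

lemma potential_pair_le: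
  fixes m :: "'n::{finite,linorder} \<Rightarrow> real"
  assumes pq: "p \<noteq> q" and m: "\<And>j. 0 < m j" and \<alpha>: "0 < \<alpha>" and d: "0 < d"
    and eq: "\<And>j. j \<notin> {p, q} \<Longrightarrow> y $ j = x $ j"
    and near: "\<And>j. j \<in> {p, q} \<Longrightarrow> norm (y $ j - c) \<le> d"
    and far: "\<And>j. j \<notin> {p, q} \<Longrightarrow> 2 * d \<le> norm (x $ j - c)"
  shows "potential m \<alpha> y + m p * m q / \<alpha> * norm (x $ q - x $ p) powr (- \<alpha>)
    \<le> potential m \<alpha> x + m p * m q / \<alpha> * norm (y $ q - y $ p) powr (- \<alpha>)
      + (\<Sum>j\<in>UNIV. \<Sum>k\<in>UNIV. m j * m k / \<alpha> * d powr (- \<alpha>))"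
proof -
  let ?T = "\<lambda>x j k. m j * m k / \<alpha> * norm (x $ j - x $ k :: complex) powr (- \<alpha>)"
  let ?K = "\<lambda>j k. m j * m k / \<alpha> * d powr (- \<alpha>)"
  define D where "D = ?T y p q - ?T x p q"
  \<comment> \<open>The change of the pair's own term, placed at both orderings because the
    symmetric sum counts every pair twice.\<close>
  let ?D = "\<lambda>j k. if (j, k) = (p, q) \<or> (j, k) = (q, p) then D else 0"
  have T0: "0 \<le> ?T z j k" for z j k using m[of j] m[of k] \<alpha> by (intro mult_nonneg_nonneg) auto
  have K0: "0 \<le> ?K j k" for j k using m[of j] m[of k] \<alpha> by (intro mult_nonneg_nonneg) auto
  have sep: "d \<le> norm (y $ j - y $ k)" if "j \<in> {p, q}" "k \<notin> {p, q}" for j k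
    using near[OF that(1)] far[OF that(2)] eq[OF that(2)] norm_triangle_ineq2[of "y $ k - c" "y $ j - c"]
    by (simp add: norm_minus_commute)
  have le: "?T y j k \<le> ?T x j k + ?D j k + ?K j k" if jk: "j \<noteq> k" for j k
  proof (cases "j \<in> {p, q}"; cases "k \<in> {p, q}")
    assume "j \<in> {p, q}" "k \<in> {p, q}"
    then have "(j, k) = (p, q) \<or> (j, k) = (q, p)" using jk by auto
    then have "?D j k = ?T y j k - ?T x j k"
      using pq by (auto simp: D_def norm_minus_commute mult.commute)
    then show ?thesis using K0[of j k] by linarith
  next
    assume "j \<notin> {p, q}" "k \<notin> {p, q}"
    then have "?T y j k = ?T x j k" "?D j k = 0" using eq by auto
    then show ?thesis using K0[of j k] by linarith
  next
    assume jk: "j \<in> {p, q}" "k \<notin> {p, q}"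
    then have "?D j k = 0" by auto
    moreover have "?T y j k \<le> ?K j k"
      using sep[OF jk] d m[of j] m[of k] \<alpha> by (intro mult_left_mono powr_mono2') auto
    ultimately show ?thesis using T0[of j k x] by linarith
  next
    assume jk: "j \<notin> {p, q}" "k \<in> {p, q}"
    then have "?D j k = 0" by auto
    moreover have "?T y j k \<le> ?K j k"
      using sep[OF jk(2,1)] d m[of j] m[of k] \<alpha> by (intro mult_left_mono powr_mono2') (auto simp: norm_minus_commute)
    ultimately show ?thesis using T0[of j k x] by linarith
  qed
  have sumD: "(\<Sum>j\<in>UNIV. \<Sum>k\<in>UNIV - {j}. ?D j k) = 2 * D"
  proof -
    have "(\<Sum>k\<in>UNIV - {p}. ?D p k) = (\<Sum>k\<in>{q}. D)" "(\<Sum>k\<in>UNIV - {q}. ?D q k) = (\<Sum>k\<in>{p}. D)"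
      using pq by (intro sum.mono_neutral_cong_right; auto)+
    moreover have "(\<Sum>j\<in>UNIV - {p, q}. \<Sum>k\<in>UNIV - {j}. ?D j k) = 0"
      by (intro sum.neutral ballI) auto
    ultimately show ?thesis
      using sum_UNIV_pair[OF pq, of "\<lambda>j. \<Sum>k\<in>UNIV - {j}. ?D j k"] by simp
  qed
  have "(\<Sum>j\<in>UNIV. \<Sum>k\<in>UNIV - {j}. ?T y j k) \<le> (\<Sum>j\<in>UNIV. \<Sum>k\<in>UNIV - {j}. ?T x j k + ?D j k + ?K j k)"
    by (intro sum_mono le) auto
  also have "\<dots> = (\<Sum>j\<in>UNIV. \<Sum>k\<in>UNIV - {j}. ?T x j k) + 2 * D + (\<Sum>j\<in>UNIV. \<Sum>k\<in>UNIV - {j}. ?K j k)"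
    by (simp only: sum.distrib sumD)
  also have "(\<Sum>j\<in>UNIV. \<Sum>k\<in>UNIV - {j}. ?K j k) \<le> 2 * (\<Sum>j\<in>UNIV. \<Sum>k\<in>UNIV. ?K j k)"
  proof -
    have "(\<Sum>j\<in>UNIV. \<Sum>k\<in>UNIV - {j}. ?K j k) \<le> (\<Sum>j\<in>UNIV. \<Sum>k\<in>UNIV. ?K j k)"
      by (intro sum_mono sum_mono2 K0) auto
    moreover have "0 \<le> (\<Sum>j\<in>UNIV. \<Sum>k\<in>UNIV. ?K j k)" by (intro sum_nonneg K0)
    ultimately show ?thesis by linarith
  qed
  finally have "potential m \<alpha> y \<le> potential m \<alpha> x + D + (\<Sum>j\<in>UNIV. \<Sum>k\<in>UNIV. ?K j k)"
    unfolding potential_symmetric by simp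
  then show ?thesis by (simp add: D_def norm_minus_commute)
qed

text \<open>This bounds the perturbing force in the relative equation of motion: after the Kepler
  term with the total mass of the pair is removed, only bodies at distance at least \<open>d\<close>
  contribute.\<close>

lemma acceleration_pair_diff:
  fixes m :: "'n::finite \<Rightarrow> real"
  assumes pq: "p \<noteq> q" and m: "\<And>j. 0 < m j" and \<alpha>: "0 < \<alpha>" and d: "0 < d"
    and far: "\<And>j. j \<notin> {p, q} \<Longrightarrow> d \<le> norm (x $ p - x $ j) \<and> d \<le> norm (x $ q - x $ j)"
  shows "norm (acceleration m \<alpha> x q - acceleration m \<alpha> x p
      + ((m p + m q) * norm (x $ q - x $ p) powr (- \<alpha> - 2)) *\<^sub>R (x $ q - x $ p))
    \<le> 2 * (\<Sum>j\<in>UNIV. m j) * d powr (- \<alpha> - 1)"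
proof -
  let ?f = "\<lambda>j k. (m k * norm (x $ j - x $ k) powr (- \<alpha> - 2)) *\<^sub>R (x $ k - x $ j)"
  have S: "acceleration m \<alpha> x q = ?f q p + (\<Sum>k\<in>UNIV - {p, q}. ?f q k)"
    "acceleration m \<alpha> x p = ?f p q + (\<Sum>k\<in>UNIV - {p, q}. ?f p k)"
    unfolding acceleration_def using pq
    by (subst sum.remove[of _ p], auto simp: insert_commute intro!: sum.cong)
      (subst sum.remove[of _ q], auto simp: insert_commute intro!: sum.cong)
  \<comment> \<open>The mutual attractions point in opposite directions, so their difference carries
    the sum of the two masses and cancels the Kepler term exactly.\<close>
  have e: "?f q p - ?f p q + ((m p + m q) * norm (x $ q - x $ p) powr (- \<alpha> - 2)) *\<^sub>R (x $ q - x $ p) = 0"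
    by (simp add: norm_minus_commute algebra_simps)
  have b: "norm (?f j k) \<le> m k * d powr (- \<alpha> - 1)" if "j \<in> {p, q}" "k \<notin> {p, q}" for j k
  proof -
    have dj: "d \<le> norm (x $ j - x $ k)" using far[OF that(2)] that(1) by auto
    have "norm (?f j k) = m k * (norm (x $ j - x $ k) powr (- \<alpha> - 2) * norm (x $ j - x $ k))"
      using m[of k] by (simp add: norm_minus_commute)
    also have "norm (x $ j - x $ k) powr (- \<alpha> - 2) * norm (x $ j - x $ k) = norm (x $ j - x $ k) powr (- \<alpha> - 1)"
    proof -
      have "- \<alpha> - 1 = - \<alpha> - 2 + 1" by simp
      then have "norm (x $ j - x $ k) powr (- \<alpha> - 1) = norm (x $ j - x $ k) powr (- \<alpha> - 2) * norm (x $ j - x $ k) powr 1"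
        by (simp only: powr_add)
      then show ?thesis by simp
    qed
    also have "m k * \<dots> \<le> m k * d powr (- \<alpha> - 1)"
      using dj d \<alpha> m[of k] by (intro mult_left_mono powr_mono2') auto
    finally show ?thesis .
  qed
  have "acceleration m \<alpha> x q - acceleration m \<alpha> x p
      + ((m p + m q) * norm (x $ q - x $ p) powr (- \<alpha> - 2)) *\<^sub>R (x $ q - x $ p)
    = (\<Sum>k\<in>UNIV - {p, q}. ?f q k) - (\<Sum>k\<in>UNIV - {p, q}. ?f p k)"
    using e unfolding S by (simp add: algebra_simps)
  also have "norm \<dots> \<le> norm (\<Sum>k\<in>UNIV - {p, q}. ?f q k) + norm (\<Sum>k\<in>UNIV - {p, q}. ?f p k)"
    by (rule norm_triangle_ineq4)
  also have "\<dots> \<le> (\<Sum>k\<in>UNIV - {p, q}. m k * d powr (- \<alpha> - 1)) + (\<Sum>k\<in>UNIV - {p, q}. m k * d powr (- \<alpha> - 1))"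
    by (intro add_mono sum_norm_le b) auto
  also have "\<dots> \<le> 2 * (\<Sum>k\<in>UNIV. m k * d powr (- \<alpha> - 1))"
  proof -
    have "(\<Sum>k\<in>UNIV - {p, q}. m k * d powr (- \<alpha> - 1)) \<le> (\<Sum>k\<in>UNIV. m k * d powr (- \<alpha> - 1))"
      by (rule sum_mono2) (simp_all add: m less_imp_le)
    then show ?thesis by simp
  qed
  also have "\<dots> = 2 * (\<Sum>j\<in>UNIV. m j) * d powr (- \<alpha> - 1)" by (simp add: sum_distrib_right)
  finally show ?thesis .
qed

section \<open>Comparison of actions\<close>

lemma measurable_lagrangian_on_Ioo:
  fixes m :: "'n::{finite,linorder} \<Rightarrow> real"
  assumes \<alpha>: "\<alpha> \<noteq> 0" and y: "\<And>t. t \<in> {a<..<b} \<Longrightarrow> (y has_vector_derivative w t) (at t)"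
    and w: "continuous_on {a<..<b} w" and cf: "\<And>t. t \<in> {a<..<b} \<Longrightarrow> collision_free (y t)"
  shows "(\<lambda>t. ennreal (kinetic m (w t) + potential m \<alpha> (y t)) * indicator {a<..<b} t) \<in> borel_measurable lborel"
proof -
  have "isCont (\<lambda>t. potential m \<alpha> (y t)) t" if t: "t \<in> {a<..<b}" for t
    by (rule isCont_o2[OF has_vector_derivative_continuous[OF y[OF t]]
          has_derivative_continuous[OF has_derivative_potential[OF cf[OF t] \<alpha>]]])
  then have "continuous_on {a<..<b} (\<lambda>t. potential m \<alpha> (y t))"
    by (intro continuous_at_imp_continuous_on) blast
  moreover have "continuous_on {a<..<b} (\<lambda>t. kinetic m (w t))"
    unfolding kinetic_def
    by (intro continuous_intros bounded_linear.continuous_on[OF bounded_linear_vec_nth] w)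
  ultimately have "continuous_on {a<..<b} (\<lambda>t. kinetic m (w t) + potential m \<alpha> (y t))"
    by (intro continuous_on_add)
  then show ?thesis by (rule borel_measurable_ennreal_indicator_Ioo)
qed

text \<open>The velocity may jump at \<tau> and the path may collide at time 0. These times and
  \<open>T\<close> form a null set, so on the remainder the extended Lagrangian is finite and equals
  the real one.\<close>

lemma action_eq_nn_integral_split:
  fixes m :: "'n::{finite,linorder} \<Rightarrow> real"
  assumes m: "\<And>j. 0 < m j" and \<alpha>: "0 < \<alpha>" and \<tau>: "0 < \<tau>" "\<tau> < T"
    and y: "\<And>t. t \<in> {0<..<\<tau>} \<union> {\<tau><..<T} \<Longrightarrow> (y has_vector_derivative w t) (at t)"
    and w: "continuous_on {0<..<\<tau>} w" "continuous_on {\<tau><..<T} w"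
    and cf: "\<And>t. t \<in> {0<..<\<tau>} \<union> {\<tau><..<T} \<Longrightarrow> collision_free (y t)"
  shows "action m \<alpha> y T = (\<integral>\<^sup>+t\<in>{0<..<\<tau>}. ennreal (kinetic m (w t) + potential m \<alpha> (y t)) \<partial>lborel)
    + (\<integral>\<^sup>+t\<in>{\<tau><..<T}. ennreal (kinetic m (w t) + potential m \<alpha> (y t)) \<partial>lborel)"
proof -
  let ?f = "\<lambda>t. ennreal (kinetic m (w t) + potential m \<alpha> (y t))"
  have l: "lagrangian m \<alpha> (y t) (vector_derivative y (at t)) = ?f t" if t: "t \<in> {0<..<\<tau>} \<union> {\<tau><..<T}" for t
    unfolding lagrangian_def potential_ext_def
    using vector_derivative_at[OF y[OF t]] cf[OF t] kinetic_nonneg[of m "w t", OF m] potential_nonneg[of m \<alpha> "y t", OF m \<alpha>]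
    by (simp add: ennreal_plus)
  have "action m \<alpha> y T = (\<integral>\<^sup>+t. ?f t * indicator {0<..<\<tau>} t + ?f t * indicator {\<tau><..<T} t \<partial>lborel)"
    unfolding action_def
  proof (rule nn_integral_cong_AE)
    show "AE t in lborel. lagrangian m \<alpha> (y t) (vector_derivative y (at t)) * indicator {0..T} t
        = ?f t * indicator {0<..<\<tau>} t + ?f t * indicator {\<tau><..<T} t"
      using AE_lborel_singleton[of 0] AE_lborel_singleton[of \<tau>] AE_lborel_singleton[of T]
    proof eventually_elim
      case (elim t)
      consider "t \<in> {0<..<\<tau>}" | "t \<in> {\<tau><..<T}" | "t \<notin> {0..T}" using elim by force
      then show ?case using \<tau> l[of t] by cases auto
    qed
  qed
  also have "\<dots> = (\<integral>\<^sup>+t\<in>{0<..<\<tau>}. ?f t \<partial>lborel) + (\<integral>\<^sup>+t\<in>{\<tau><..<T}. ?f t \<partial>lborel)"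
    by (intro nn_integral_add measurable_lagrangian_on_Ioo) (use \<alpha> y w cf in auto)
  finally show ?thesis .
qed

text \<open>Here \<open>f\<close> and \<open>g\<close> stand for the new and the old Lagrangian,
  \<open>k\<close> and \<open>h\<close> for the new and the old Lagrangian of the pair alone, \<mu>
  for the reduced mass and \<open>K\<close> for the effect of the other bodies. The balance is
  integrated in additive form because subtraction of extended reals is truncated.\<close>

lemma nn_integral_less_of_balance:
  fixes f g h k :: "real \<Rightarrow> real"
  assumes \<tau>: "0 \<le> \<tau>" and K: "0 \<le> K" and \<mu>: "0 \<le> \<mu>"
    and nonneg: "\<And>t. t \<in> {0<..<\<tau>} \<Longrightarrow> 0 \<le> f t \<and> 0 \<le> g t \<and> 0 \<le> h t \<and> 0 \<le> k t"
    and le: "\<And>t. t \<in> {0<..<\<tau>} \<Longrightarrow> f t + \<mu> * h t \<le> g t + \<mu> * k t + K"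
    and [measurable]: "(\<lambda>t. ennreal (f t) * indicator {0<..<\<tau>} t) \<in> borel_measurable lborel"
      "(\<lambda>t. ennreal (g t) * indicator {0<..<\<tau>} t) \<in> borel_measurable lborel"
      "(\<lambda>t. ennreal (h t) * indicator {0<..<\<tau>} t) \<in> borel_measurable lborel"
      "(\<lambda>t. ennreal (k t) * indicator {0<..<\<tau>} t) \<in> borel_measurable lborel"
    and A: "ennreal A \<le> (\<integral>\<^sup>+t\<in>{0<..<\<tau>}. ennreal (h t) \<partial>lborel)"
    and B: "(\<integral>\<^sup>+t\<in>{0<..<\<tau>}. ennreal (k t) \<partial>lborel) \<le> ennreal B"
    and AB: "0 \<le> A" "0 \<le> B" "\<mu> * B + K * \<tau> < \<mu> * A"
    and fin: "(\<integral>\<^sup>+t\<in>{0<..<\<tau>}. ennreal (g t) \<partial>lborel) < \<infinity>"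
  shows "(\<integral>\<^sup>+t\<in>{0<..<\<tau>}. ennreal (f t) \<partial>lborel) < (\<integral>\<^sup>+t\<in>{0<..<\<tau>}. ennreal (g t) \<partial>lborel)"
proof -
  let ?i = "\<lambda>t. indicator {0<..<\<tau>} t :: ennreal"
  obtain G where G: "(\<integral>\<^sup>+t\<in>{0<..<\<tau>}. ennreal (g t) \<partial>lborel) = ennreal G" "0 \<le> G"
    using fin by (cases "\<integral>\<^sup>+t\<in>{0<..<\<tau>}. ennreal (g t) \<partial>lborel" rule: ennreal_cases) auto
  have "(\<integral>\<^sup>+t\<in>{0<..<\<tau>}. ennreal (f t) \<partial>lborel) + ennreal (\<mu> * A)
      \<le> (\<integral>\<^sup>+t. ennreal (f t) * ?i t \<partial>lborel) + ennreal \<mu> * (\<integral>\<^sup>+t. ennreal (h t) * ?i t \<partial>lborel)"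
    using A AB \<mu> by (intro add_left_mono) (simp add: ennreal_mult mult_left_mono)
  also have "\<dots> = (\<integral>\<^sup>+t. ennreal (f t) * ?i t + ennreal \<mu> * (ennreal (h t) * ?i t) \<partial>lborel)"
    by (simp add: nn_integral_add nn_integral_cmult)
  also have "\<dots> \<le> (\<integral>\<^sup>+t. ennreal (g t) * ?i t + ennreal \<mu> * (ennreal (k t) * ?i t) + ennreal K * ?i t \<partial>lborel)"
  proof (rule nn_integral_mono)
    fix t
    show "ennreal (f t) * ?i t + ennreal \<mu> * (ennreal (h t) * ?i t)
        \<le> ennreal (g t) * ?i t + ennreal \<mu> * (ennreal (k t) * ?i t) + ennreal K * ?i t"
    proof (cases "t \<in> {0<..<\<tau>}")
      case True
      then have "ennreal (f t + \<mu> * h t) \<le> ennreal (g t + \<mu> * k t + K)" by (intro ennreal_leI le)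
      then show ?thesis using True nonneg[OF True] \<mu> K by (simp add: ennreal_plus ennreal_mult)
    qed simp
  qed
  also have "\<dots> = (\<integral>\<^sup>+t. ennreal (g t) * ?i t \<partial>lborel) + ennreal \<mu> * (\<integral>\<^sup>+t. ennreal (k t) * ?i t \<partial>lborel)
      + ennreal K * ennreal \<tau>"
    using \<tau> by (simp add: nn_integral_add nn_integral_cmult nn_integral_cmult_indicator)
  also have "\<dots> \<le> ennreal G + ennreal \<mu> * ennreal B + ennreal K * ennreal \<tau>"
    unfolding G by (intro add_mono mult_left_mono B order_refl) auto
  also have "\<dots> = ennreal (G + \<mu> * B + K * \<tau>)"
    using G(2) \<mu> K \<tau> AB by (simp add: ennreal_plus ennreal_mult)
  finally have main: "(\<integral>\<^sup>+t\<in>{0<..<\<tau>}. ennreal (f t) \<partial>lborel) + ennreal (\<mu> * A) \<le> ennreal (G + \<mu> * B + K * \<tau>)" .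
  \<comment> \<open>The inequality just obtained already shows that the new integral is finite, so
    the comparison can be finished in the reals.\<close>
  then have "(\<integral>\<^sup>+t\<in>{0<..<\<tau>}. ennreal (f t) \<partial>lborel) \<noteq> \<infinity>" by (auto simp: top_unique)
  then obtain F where F: "(\<integral>\<^sup>+t\<in>{0<..<\<tau>}. ennreal (f t) \<partial>lborel) = ennreal F" "0 \<le> F"
    by (cases "\<integral>\<^sup>+t\<in>{0<..<\<tau>}. ennreal (f t) \<partial>lborel" rule: ennreal_cases) auto
  have nn: "0 \<le> \<mu> * A" "0 \<le> G + \<mu> * B + K * \<tau>" using \<mu> AB G K \<tau> by auto
  have "ennreal (F + \<mu> * A) \<le> ennreal (G + \<mu> * B + K * \<tau>)"
    using main F nn by (simp add: ennreal_plus)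
  then have "F + \<mu> * A \<le> G + \<mu> * B + K * \<tau>" using nn by (simp add: ennreal_le_iff)
  then show ?thesis using AB G F by (simp add: ennreal_less_iff)
qed

text \<open>Separates geometry from analysis: any nonvanishing \<open>Z\<close> with modulus at most
  1 that ends at 1 may replace the relative motion, provided its pair action leaves room for the
  error term. The ball of radius \<open>d\<close> about \<open>c\<close> contains the deformed pair,
  and the other bodies stay outside the ball of radius \<open>2 * d\<close>.\<close>

lemma pair_deformation:
  fixes m :: "'n::{finite,linorder} \<Rightarrow> real" and x :: "real \<Rightarrow> 'n config"
  assumes pq: "p \<noteq> q" and m: "\<And>j. 0 < m j" and \<alpha>: "0 < \<alpha>" and \<tau>: "0 < \<tau>" "\<tau> < \<delta>"
    and x: "x \<in> H1_centered_paths m \<delta>"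
    and v: "\<And>t. t \<in> {0<..<\<delta>} \<Longrightarrow> (x has_vector_derivative v t) (at t)" "continuous_on {0<..<\<delta>} v"
    and cf: "\<And>t. t \<in> {0<..\<delta>} \<Longrightarrow> collision_free (x t)"
    and fin: "(\<integral>\<^sup>+t\<in>{0<..<\<delta>}. ennreal (kinetic m (v t) + potential m \<alpha> (x t)) \<partial>lborel) < \<infinity>"
    and d: "0 < d" "\<And>t. t \<in> {0..\<tau>} \<Longrightarrow> norm (cluster_center m {p, q} (x t) - c) + norm (x \<tau> $ q - x \<tau> $ p) \<le> d"
    and far: "\<And>t j. t \<in> {0..\<tau>} \<Longrightarrow> j \<notin> {p, q} \<Longrightarrow> 2 * d \<le> norm (x t $ j - c)"
    and Z: "continuous_on {0..\<tau>} Z" "Z \<tau> = 1" "\<And>t. t \<in> {0..\<tau>} \<Longrightarrow> Z t \<noteq> 0 \<and> norm (Z t) \<le> 1"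
      "\<And>t. t \<in> {0<..<\<tau>} \<Longrightarrow> (Z has_vector_derivative Z' t) (at t) \<and> norm (Z' t) \<le> Zb"
      "continuous_on {0<..<\<tau>} Z'"
    and A: "ennreal A \<le> (\<integral>\<^sup>+t\<in>{0<..<\<tau>}. ennreal ((norm (v t $ q - v t $ p))\<^sup>2 / 2
        + (m p + m q) / \<alpha> * norm (x t $ q - x t $ p) powr (- \<alpha>)) \<partial>lborel)"
    and B: "(\<integral>\<^sup>+t\<in>{0<..<\<tau>}. ennreal ((norm (x \<tau> $ q - x \<tau> $ p) * norm (Z' t))\<^sup>2 / 2
        + (m p + m q) / \<alpha> * (norm (x \<tau> $ q - x \<tau> $ p) * norm (Z t)) powr (- \<alpha>)) \<partial>lborel) \<le> ennreal B"
    and AB: "0 \<le> A" "0 \<le> B" "m p * m q / (m p + m q) * B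
      + (\<Sum>j\<in>UNIV. \<Sum>k\<in>UNIV. m j * m k / \<alpha> * d powr (- \<alpha>)) * \<tau> < m p * m q / (m p + m q) * A"
  defines "y \<equiv> \<lambda>t. if t \<le> \<tau> then pair_collapse m p q (x t) + pair_spread m p q ((x \<tau> $ q - x \<tau> $ p) * Z t) else x t"
  shows "y \<in> H1_centered_paths m \<delta>" "action m \<alpha> y \<delta> < action m \<alpha> x \<delta>"
    "\<And>t. t \<in> {\<tau>..\<delta>} \<Longrightarrow> y t = x t"
    "\<And>t. t \<in> {0<..\<delta>} \<Longrightarrow> collision_free (y t)"
    "\<And>t. t \<in> {0..\<tau>} \<Longrightarrow> norm (y t - x t) \<le> norm (x \<tau> $ q - x \<tau> $ p) + norm (x t $ q - x t $ p)"
    "y 0 $ p \<noteq> y 0 $ q" "\<And>k j. k \<in> {p, q} \<Longrightarrow> j \<notin> {p, q} \<Longrightarrow> y 0 $ k \<noteq> y 0 $ j"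
proof -
  define r where "r = x \<tau> $ q - x \<tau> $ p"
  let ?C = "pair_collapse m p q" and ?S = "pair_spread m p q"
  define Y where "Y = (\<lambda>t. ?C (x t) + ?S (r * Z t))"
  note mpq = m[of p] m[of q]
  interpret C: bounded_linear ?C by (rule bounded_linear_pair_collapse)
  interpret S: bounded_linear ?S by (rule bounded_linear_pair_spread)
  have x1: "H1_path \<delta> x" and xc: "\<And>t. t \<in> {0..\<delta>} \<Longrightarrow> x t \<in> centered_configs m"
    using x by (auto simp: H1_centered_paths_def)
  have r0: "r \<noteq> 0" using cf[of \<tau>] \<tau> pq by (auto simp: r_def collision_free_def)
  have xsplit: "x t = ?C (x t) + ?S (x t $ q - x t $ p)" for t
    by (rule pair_collapse_add_spread[OF pq mpq, symmetric])
  have yY: "y t = Y t" if "t \<le> \<tau>" for t using that by (simp add: y_def Y_def r_def)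
  have Y\<tau>: "Y \<tau> = x \<tau>" using Z(2) xsplit[of \<tau>] by (simp add: Y_def r_def)
  show yx: "y t = x t" if "t \<in> {\<tau>..\<delta>}" for t
    using that Y\<tau> yY[of \<tau>] by (cases "t = \<tau>") (auto simp: y_def)
  have near: "norm (Y t $ j - c) \<le> d" if t: "t \<in> {0..\<tau>}" and j: "j \<in> {p, q}" for t j
  proof -
    have "norm (Y t - ?C (x t)) \<le> norm (r * Z t)"
      using norm_pair_spread_le[OF pq mpq, of "r * Z t"] by (simp add: Y_def)
    also have "\<dots> \<le> norm r"
      using Z(3)[OF t] mult_left_mono[of "norm (Z t)" 1 "norm r"] by (simp add: norm_mult)
    finally have "norm ((Y t - ?C (x t)) $ j) \<le> norm r"
      using order_trans[OF Finite_Cartesian_Product.norm_nth_le] by blast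
    moreover have "?C (x t) $ j = cluster_center m {p, q} (x t)" using j by (simp add: pair_collapse_def)
    ultimately show ?thesis
      using d(2)[OF t] norm_triangle_ineq[of "Y t $ j - cluster_center m {p, q} (x t)" "cluster_center m {p, q} (x t) - c"]
      by (simp add: r_def)
  qed
  have Yj: "Y t $ j = x t $ j" if "j \<notin> {p, q}" for t j
    unfolding Y_def by (rule pair_nth(3)[OF pq that])
  have Ydiff: "Y t $ q - Y t $ p = r * Z t" for t
    unfolding Y_def by (rule pair_diff[OF pq mpq])
  have sep: "Y t $ k \<noteq> Y t $ j" if "t \<in> {0..\<tau>}" "k \<in> {p, q}" "j \<notin> {p, q}" for t k j
    using near[OF that(1,2)] far[OF that(1,3)] Yj[OF that(3)] d(1) by auto
  have Ypq: "Y t $ p \<noteq> Y t $ q" if "t \<in> {0..\<tau>}" for t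
    using Ydiff[of t] Z(3)[OF that] r0 by auto
  have Ycf: "collision_free (Y t)" if t: "t \<in> {0<..\<tau>}" for t
    unfolding collision_free_def
  proof (intro allI impI)
    fix j k :: 'n assume jk: "j \<noteq> k"
    have t': "t \<in> {0..\<tau>}" and t'': "t \<in> {0<..\<delta>}" using t \<tau> by auto
    consider "j \<in> {p, q}" "k \<in> {p, q}" | "j \<in> {p, q}" "k \<notin> {p, q}" | "j \<notin> {p, q}" "k \<in> {p, q}" | "j \<notin> {p, q}" "k \<notin> {p, q}"
      by blast
    then show "Y t $ j \<noteq> Y t $ k"
    proof cases
      case 1 then show ?thesis using Ypq[OF t'] jk by auto
    next
      case 2 then show ?thesis by (rule sep[OF t'])
    next
      case 3 then show ?thesis using sep[OF t' 3(2,1)] by auto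
    next
      case 4 then show ?thesis using Yj[OF 4(1)] Yj[OF 4(2)] cf[OF t''] jk by (auto simp: collision_free_def)
    qed
  qed
  show "collision_free (y t)" if "t \<in> {0<..\<delta>}" for t
    using that yY[of t] Ycf[of t] yx[of t] cf[of t] by (cases "t \<le> \<tau>") auto
  show "norm (y t - x t) \<le> norm (x \<tau> $ q - x \<tau> $ p) + norm (x t $ q - x t $ p)" if t: "t \<in> {0..\<tau>}" for t
  proof -
    have C: "?C (x t) = x t - ?S (x t $ q - x t $ p)"
      using xsplit[of t] by (metis add_diff_cancel_right')
    have "y t - x t = ?S (r * Z t - (x t $ q - x t $ p))"
      using yY[of t] t unfolding Y_def C S.diff[of "r * Z t"] by simp
    then have "norm (y t - x t) \<le> norm (r * Z t) + norm (x t $ q - x t $ p)"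
      using order_trans[OF norm_pair_spread_le[OF pq mpq] norm_triangle_ineq4] by metis
    moreover have "norm (r * Z t) \<le> norm r"
      using Z(3)[OF t] mult_left_mono[of "norm (Z t)" 1 "norm r"] by (simp add: norm_mult)
    ultimately show ?thesis by (simp add: r_def)
  qed
  show "y 0 $ p \<noteq> y 0 $ q" using Ypq[of 0] yY[of 0] \<tau> by auto
  show "y 0 $ k \<noteq> y 0 $ j" if "k \<in> {p, q}" "j \<notin> {p, q}" for k j
    using sep[OF _ that, of 0] yY[of 0] \<tau> by auto
  have Z_H1: "H1_path \<tau> Z"
    by (rule H1_path_if_bounded_derivative[of _ _ Z' Zb]) (use \<tau> Z in auto)
  have YH1: "H1_path \<tau> Y"
    unfolding Y_def
    by (intro H1_path_add H1_path_bounded_linear[OF H1_path_mono[OF x1] bounded_linear_pair_collapse]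
        H1_path_bounded_linear[OF Z_H1]
        bounded_linear_compose[OF bounded_linear_pair_spread bounded_linear_mult_right])
      (use \<tau> in auto)
  have "H1_path \<delta> (\<lambda>t. if t \<le> \<tau> then Y t else x t)"
    by (rule H1_path_concat[OF x1 YH1]) (use \<tau> Y\<tau> in auto)
  also have "(\<lambda>t. if t \<le> \<tau> then Y t else x t) = y" by (auto simp: y_def Y_def r_def)
  finally have "H1_path \<delta> y" .
  moreover have "y t \<in> centered_configs m" if t: "t \<in> {0..\<delta>}" for t
    using centered_pair[OF pq mpq xc[OF t]] xc[OF t] by (simp add: y_def)
  ultimately show "y \<in> H1_centered_paths m \<delta>" by (simp add: H1_centered_paths_def)
  \<comment> \<open>The velocity of the new path away from \<tau>; its value at \<tau> lies on a
    null set.\<close>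
  define w where "w = (\<lambda>t. if t < \<tau> then ?C (v t) + ?S (r * Z' t) else v t)"
  have dY: "(Y has_vector_derivative ?C (v t) + ?S (r * Z' t)) (at t)" if t: "t \<in> {0<..<\<tau>}" for t
    unfolding Y_def
    by (intro has_vector_derivative_add C.has_vector_derivative S.has_vector_derivative
        bounded_linear.has_vector_derivative[OF bounded_linear_mult_right] v(1))
      (use t \<tau> Z(4)[OF t] in auto)
  have dy: "(y has_vector_derivative w t) (at t)" if t: "t \<in> {0<..<\<tau>} \<union> {\<tau><..<\<delta>}" for t
  proof (cases "t < \<tau>")
    case True
    then have t': "t \<in> {0<..<\<tau>}" using t by auto
    have "(y has_vector_derivative ?C (v t) + ?S (r * Z' t)) (at t)"
      by (rule has_vector_derivative_transform_within_open[OF dY[OF t'], of "{0<..<\<tau>}"])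
        (use t' yY in auto)
    then show ?thesis using True by (simp add: w_def)
  next
    case False
    then have t': "t \<in> {\<tau><..<\<delta>}" using t by auto
    have "(y has_vector_derivative v t) (at t)"
      by (rule has_vector_derivative_transform_within_open[OF v(1), of t "{\<tau><..<\<delta>}"])
        (use t' \<tau> yx in auto)
    then show ?thesis using False by (simp add: w_def)
  qed
  have cv: "continuous_on {0<..<\<tau>} v" "continuous_on {\<tau><..<\<delta>} v"
    using \<tau> by (auto intro!: continuous_on_subset[OF v(2)])
  have "continuous_on {0<..<\<tau>} (\<lambda>t. ?C (v t) + ?S (r * Z' t))"
    by (intro continuous_on_add C.continuous_on S.continuous_on cv continuous_on_mult continuous_on_const Z(5))
  then have cw1: "continuous_on {0<..<\<tau>} w"
    by (rule continuous_on_eq) (simp add: w_def)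
  have cw2: "continuous_on {\<tau><..<\<delta>} w"
    by (rule continuous_on_eq[OF cv(2)]) (auto simp: w_def)
  have ycf: "collision_free (y t)" if "t \<in> {0<..<\<tau>} \<union> {\<tau><..<\<delta>}" for t
    using that yY[of t] Ycf[of t] yx[of t] cf[of t] \<tau> by (cases "t \<le> \<tau>") auto
  have xcf: "collision_free (x t)" if "t \<in> {0<..<\<tau>} \<union> {\<tau><..<\<delta>}" for t
    using that cf[of t] \<tau> by auto
  have vx: "(x has_vector_derivative v t) (at t)" if "t \<in> {0<..<\<tau>} \<union> {\<tau><..<\<delta>}" for t
    using that v(1)[of t] \<tau> by auto
  let ?f = "\<lambda>t. kinetic m (w t) + potential m \<alpha> (y t)"
  let ?g = "\<lambda>t. kinetic m (v t) + potential m \<alpha> (x t)"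
  let ?h = "\<lambda>t. (norm (v t $ q - v t $ p))\<^sup>2 / 2 + (m p + m q) / \<alpha> * norm (x t $ q - x t $ p) powr (- \<alpha>)"
  let ?k = "\<lambda>t. (norm r * norm (Z' t))\<^sup>2 / 2 + (m p + m q) / \<alpha> * (norm r * norm (Z t)) powr (- \<alpha>)"
  have less: "(\<integral>\<^sup>+t\<in>{0<..<\<tau>}. ennreal (?f t) \<partial>lborel) < (\<integral>\<^sup>+t\<in>{0<..<\<tau>}. ennreal (?g t) \<partial>lborel)"
  proof (rule nn_integral_less_of_balance[where h = ?h and k = ?k and A = A and B = B])
    show "0 \<le> \<tau>" using \<tau> by simp
    show "0 \<le> (\<Sum>j\<in>UNIV. \<Sum>k\<in>UNIV. m j * m k / \<alpha> * d powr (- \<alpha>))"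
      using m \<alpha> by (intro sum_nonneg mult_nonneg_nonneg divide_nonneg_nonneg) (auto intro: less_imp_le)
    show "0 \<le> m p * m q / (m p + m q)" using mpq by simp
    show "0 \<le> ?f t \<and> 0 \<le> ?g t \<and> 0 \<le> ?h t \<and> 0 \<le> ?k t" for t
      using kinetic_nonneg[of m "w t", OF m] kinetic_nonneg[of m "v t", OF m]
        potential_nonneg[of m \<alpha> "y t", OF m \<alpha>] potential_nonneg[of m \<alpha> "x t", OF m \<alpha>] mpq \<alpha> by simp
    show "?f t + m p * m q / (m p + m q) * ?h t \<le> ?g t + m p * m q / (m p + m q) * ?k t
        + (\<Sum>j\<in>UNIV. \<Sum>k\<in>UNIV. m j * m k / \<alpha> * d powr (- \<alpha>))" if t: "t \<in> {0<..<\<tau>}" for t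
    proof -
      have t': "t \<in> {0..\<tau>}" using t by auto
      \<comment> \<open>The reduced mass turns the coefficient \<open>(m p + m q) / \<alpha>\<close>
        of the pair Lagrangian into the coefficient \<open>m p * m q / \<alpha>\<close> in the
        potential.\<close>
      define \<mu> where "\<mu> = m p * m q / (m p + m q)"
      have \<mu>: "\<mu> * ((m p + m q) / \<alpha> * z) = m p * m q / \<alpha> * z" for z
        using mpq by (simp add: \<mu>_def)
      have P: "potential m \<alpha> (Y t) + m p * m q / \<alpha> * norm (x t $ q - x t $ p) powr (- \<alpha>)
        \<le> potential m \<alpha> (x t) + m p * m q / \<alpha> * norm (Y t $ q - Y t $ p) powr (- \<alpha>)
          + (\<Sum>j\<in>UNIV. \<Sum>k\<in>UNIV. m j * m k / \<alpha> * d powr (- \<alpha>))"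
        by (rule potential_pair_le[OF pq m \<alpha> d(1), of "Y t" "x t" c])
          (use Yj near[OF t'] far[OF t'] in auto)
      have Kw: "kinetic m (w t) = kinetic m (?C (v t)) + \<mu> * ((norm r * norm (Z' t))\<^sup>2 / 2)"
        using t kinetic_pair[OF pq mpq, of "v t" "r * Z' t"] by (simp add: w_def norm_mult \<mu>_def)
      have Kv: "kinetic m (v t) = kinetic m (?C (v t)) + \<mu> * ((norm (v t $ q - v t $ p))\<^sup>2 / 2)"
        using kinetic_pair[OF pq mpq, of "v t" "v t $ q - v t $ p"] pair_collapse_add_spread[OF pq mpq, of "v t"]
        by (simp add: \<mu>_def)
      have Ynorm: "norm (Y t $ q - Y t $ p) = norm r * norm (Z t)" unfolding Ydiff by (simp add: norm_mult)
      show ?thesis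
        unfolding \<mu>_def[symmetric] distrib_left[of \<mu>] \<mu> Kw Kv yY[of t, OF less_imp_le[of t \<tau>]]
        using P t yY[of t] unfolding Ynorm by simp
    qed
    show "(\<lambda>t. ennreal (?f t) * indicator {0<..<\<tau>} t) \<in> borel_measurable lborel"
      by (rule measurable_lagrangian_on_Ioo) (use \<alpha> dy cw1 ycf in auto)
    show "(\<lambda>t. ennreal (?g t) * indicator {0<..<\<tau>} t) \<in> borel_measurable lborel"
      by (rule measurable_lagrangian_on_Ioo) (use \<alpha> vx cv xcf in auto)
    have "continuous_on {0..\<delta>} x" by (rule H1_path_imp_continuous_on[OF x1])
    then have cx: "continuous_on {0<..<\<tau>} x" by (rule continuous_on_subset) (use \<tau> in auto)
    have "continuous_on {0<..<\<tau>} (\<lambda>t. norm (x t $ q - x t $ p) powr (- \<alpha>))"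
      by (intro continuous_on_powr' continuous_on_norm continuous_on_diff continuous_on_const
          bounded_linear.continuous_on[OF bounded_linear_vec_nth] cx)
        (use xcf pq in \<open>auto simp: collision_free_def\<close>)
    then show "(\<lambda>t. ennreal (?h t) * indicator {0<..<\<tau>} t) \<in> borel_measurable lborel"
      by (intro borel_measurable_ennreal_indicator_Ioo continuous_on_add continuous_on_mult continuous_on_const continuous_on_divide continuous_on_power
          continuous_on_norm continuous_on_diff bounded_linear.continuous_on[OF bounded_linear_vec_nth] cv) auto
    have "continuous_on {0<..<\<tau>} Z" by (rule continuous_on_subset[OF Z(1)]) auto
    then have "continuous_on {0<..<\<tau>} (\<lambda>t. (norm r * norm (Z t)) powr (- \<alpha>))"
      by (intro continuous_on_powr' continuous_on_norm continuous_on_mult continuous_on_const)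
        (use Z(3) r0 in auto)
    then show "(\<lambda>t. ennreal (?k t) * indicator {0<..<\<tau>} t) \<in> borel_measurable lborel"
      by (intro borel_measurable_ennreal_indicator_Ioo continuous_on_add continuous_on_mult continuous_on_const continuous_on_divide continuous_on_power
          continuous_on_norm Z(5)) auto
    show "ennreal A \<le> (\<integral>\<^sup>+t\<in>{0<..<\<tau>}. ennreal (?h t) \<partial>lborel)" by (rule A)
    show "(\<integral>\<^sup>+t\<in>{0<..<\<tau>}. ennreal (?k t) \<partial>lborel) \<le> ennreal B" using B by (simp add: r_def)
    show "0 \<le> A" "0 \<le> B" "m p * m q / (m p + m q) * B
      + (\<Sum>j\<in>UNIV. \<Sum>k\<in>UNIV. m j * m k / \<alpha> * d powr (- \<alpha>)) * \<tau> < m p * m q / (m p + m q) * A" by (rule AB)+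
    have "(\<integral>\<^sup>+t\<in>{0<..<\<tau>}. ennreal (?g t) \<partial>lborel) \<le> (\<integral>\<^sup>+t\<in>{0<..<\<delta>}. ennreal (?g t) \<partial>lborel)"
      by (rule nn_integral_mono) (use \<tau> in \<open>auto simp: indicator_def\<close>)
    then show "(\<integral>\<^sup>+t\<in>{0<..<\<tau>}. ennreal (?g t) \<partial>lborel) < \<infinity>" using fin by (rule le_less_trans)
  qed
  \<comment> \<open>After \<tau> the paths coincide. Finiteness of this common part allows it to be
    added to the strict inequality.\<close>
  have tail: "(\<integral>\<^sup>+t\<in>{\<tau><..<\<delta>}. ennreal (?f t) \<partial>lborel) = (\<integral>\<^sup>+t\<in>{\<tau><..<\<delta>}. ennreal (?g t) \<partial>lborel)"
    by (rule nn_integral_cong) (use yx in \<open>auto simp: indicator_def w_def\<close>)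
  have "(\<integral>\<^sup>+t\<in>{\<tau><..<\<delta>}. ennreal (?g t) \<partial>lborel) \<le> (\<integral>\<^sup>+t\<in>{0<..<\<delta>}. ennreal (?g t) \<partial>lborel)"
    by (rule nn_integral_mono) (use \<tau> in \<open>auto simp: indicator_def\<close>)
  then have tail_fin: "(\<integral>\<^sup>+t\<in>{\<tau><..<\<delta>}. ennreal (?g t) \<partial>lborel) < \<infinity>" using fin by (rule le_less_trans)
  have "action m \<alpha> y \<delta> = (\<integral>\<^sup>+t\<in>{0<..<\<tau>}. ennreal (?f t) \<partial>lborel) + (\<integral>\<^sup>+t\<in>{\<tau><..<\<delta>}. ennreal (?g t) \<partial>lborel)"
    unfolding tail[symmetric]
    by (rule action_eq_nn_integral_split[OF m \<alpha> \<tau> dy cw1 cw2 ycf])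
  also have "\<dots> < (\<integral>\<^sup>+t\<in>{0<..<\<tau>}. ennreal (?g t) \<partial>lborel) + (\<integral>\<^sup>+t\<in>{\<tau><..<\<delta>}. ennreal (?g t) \<partial>lborel)"
    using less tail_fin by (simp add: add.commute ennreal_add_left_cancel_less)
  also have "\<dots> = action m \<alpha> x \<delta>"
    by (rule action_eq_nn_integral_split[OF m \<alpha> \<tau> vx cv xcf, symmetric])
  finally show "action m \<alpha> y \<delta> < action m \<alpha> x \<delta>" .
qed

section \<open>The deformation\<close>

text \<open>The square root is the length of the relative vector of a normalized configuration,
  since the reduced mass times its square is 1; the first factor is the weight with which a body
  shares in that vector.\<close>

lemma rho_bar_eq:
  assumes "0 < m p" "0 < m q"
  shows "rho_bar m p q = m q / (m p + m q) * sqrt ((m p + m q) / (m p * m q))"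
proof -
  have e: "m q / (m p * (m p + m q)) = (m q / (m p + m q))\<^sup>2 * ((m p + m q) / (m p * m q))"
    using assms by (simp add: power2_eq_square divide_simps)
  show ?thesis
    unfolding rho_bar_def e real_sqrt_mult real_sqrt_abs using assms by simp
qed

lemma cis_add_pi: "cis (a + pi) = - cis a"
  by (simp add: cis_mult[symmetric])

text \<open>At the collision the collapse leaves the configuration unchanged, so adding the scaled
  normalized configuration is a pure spread in the direction \<phi>.\<close>

lemma add_cluster_pair:
  fixes m :: "'n::finite \<Rightarrow> real"
  assumes pq: "p \<noteq> q" and m: "0 < m p" "0 < m q"
    and z0: "x $ p = cluster_center m {p, q} x" "x $ q = cluster_center m {p, q} x"
    and \<sigma>: "\<sigma> p = of_real (rho_bar m p q) * cis (\<phi> + pi)" "\<sigma> q = of_real (rho_bar m q p) * cis \<phi>"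
  shows "add_cluster {p, q} x \<epsilon> \<sigma> = pair_collapse m p q x
    + pair_spread m p q (of_real (\<epsilon> * sqrt ((m p + m q) / (m p * m q))) * cis \<phi>)" (is "_ = ?y")
proof -
  define s where "s = sqrt ((m p + m q) / (m p * m q))"
  have "rho_bar m p q = m q / (m p + m q) * s" "rho_bar m q p = m p / (m p + m q) * s"
    using rho_bar_eq[of m p q] rho_bar_eq[of m q p] m by (simp_all add: s_def add.commute mult.commute)
  then have "?y $ p = x $ p + \<epsilon> *\<^sub>R \<sigma> p" "?y $ q = x $ q + \<epsilon> *\<^sub>R \<sigma> q"
    unfolding pair_nth(1,2)[OF pq] s_def[symmetric]
    by (simp_all add: z0 \<sigma> cis_add_pi scaleR_conv_of_real)
  moreover have "?y $ j = x $ j" if "j \<notin> {p, q}" for j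
    by (rule pair_nth(3)[OF pq that])
  ultimately show ?thesis unfolding add_cluster_def vec_eq_iff by auto
qed

lemma cluster_separation:
  fixes x :: "real \<Rightarrow> 'n::finite config"
  assumes \<delta>: "0 < \<delta>" and cont: "continuous_on {0..\<delta>} x"
    and other: "\<And>j. j \<notin> k \<Longrightarrow> x 0 $ j \<noteq> c"
  obtains d \<delta>1 where "0 < d" "0 < \<delta>1" "\<delta>1 < \<delta>"
    "\<And>t j. t \<in> {0..\<delta>1} \<Longrightarrow> norm (x t $ j - x 0 $ j) \<le> d / 4"
    "\<And>t j. t \<in> {0..\<delta>1} \<Longrightarrow> j \<notin> k \<Longrightarrow> 2 * d \<le> norm (x t $ j - c)"
proof -
  \<comment> \<open>The entry 1 keeps the set nonempty when the cluster consists of all bodies. With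
    \<open>d\<close> a quarter of this minimum, displacements up to \<open>d / 4\<close> leave more
    than \<open>2 * d\<close>.\<close>
  define D where "D = Min (insert 1 ((\<lambda>j. norm (x 0 $ j - c)) ` (UNIV - k)))"
  have "0 < D" unfolding D_def by (subst Min_gr_iff) (use other in auto)
  define d where "d = D / 4"
  have d: "0 < d" using \<open>0 < D\<close> by (simp add: d_def)
  have D: "4 * d \<le> norm (x 0 $ j - c)" if "j \<notin> k" for j
    unfolding d_def D_def using that by simp
  obtain e where e: "0 < e" "\<And>t. t \<in> {0..\<delta>} \<Longrightarrow> dist t 0 < e \<Longrightarrow> dist (x t) (x 0) < d / 4"
    using cont[unfolded continuous_on_iff, rule_format, of 0 "d / 4"] \<delta> d by auto
  define \<delta>1 where "\<delta>1 = min e \<delta> / 2"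
  have \<delta>1: "0 < \<delta>1" "\<delta>1 < \<delta>" "\<delta>1 < e" using e(1) \<delta> by (auto simp: \<delta>1_def)
  have near: "norm (x t $ j - x 0 $ j) \<le> d / 4" if t: "t \<in> {0..\<delta>1}" for t j
  proof -
    have "norm ((x t - x 0) $ j) \<le> norm (x t - x 0)" by (rule Finite_Cartesian_Product.norm_nth_le)
    also have "\<dots> < d / 4" using e(2)[of t] t \<delta>1 by (simp add: dist_norm)
    finally show ?thesis by simp
  qed
  show thesis
  proof (rule that[OF d \<delta>1(1,2) near])
    fix t j assume "t \<in> {0..\<delta>1}" "j \<notin> k"
    then show "2 * d \<le> norm (x t $ j - c)"
      using near[of t j] D[of j] d norm_triangle_ineq2[of "x 0 $ j - c" "x 0 $ j - x t $ j"]
      by (simp add: norm_minus_commute)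
  qed auto
qed

text \<open>Smallness of \<delta>0 comes first; then for every tolerance \<eta> all sufficiently
  small \<epsilon>0 work. The tolerance makes "small deformation" precise as uniform
  closeness.\<close>

theorem proposition4p3:
  fixes m :: "'n::{finite,linorder} \<Rightarrow> real"
    and \<alpha> \<delta> :: real
    and x :: "real \<Rightarrow> 'n config"
    and i2 i3 :: 'n
    and \<rho>2 \<rho>3 \<theta>2 \<theta>3 :: "real \<Rightarrow> real"
    and \<theta>3p \<phi>2 \<phi>3 :: real
    and \<sigma> :: "'n \<Rightarrow> complex"
  assumes "1 \<le> \<alpha>" and "\<alpha> < 2"
    and "CARD('n) \<ge> 2"
    and "\<forall>j. m j > 0"
    and "i2 \<noteq> i3"
    and "isolated_cluster_collision_solution m \<alpha> {i2, i3} \<delta> x"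
    and "\<forall>t\<in>{0<..\<delta>}. \<rho>2 t > 0 \<and> \<rho>3 t > 0 \<and> \<theta>2 t = \<theta>3 t + pi
           \<and> x t $ i2 - cluster_center m {i2, i3} (x t) = of_real (\<rho>2 t) * cis (\<theta>2 t)
           \<and> x t $ i3 - cluster_center m {i2, i3} (x t) = of_real (\<rho>3 t) * cis (\<theta>3 t)"
    and "continuous_on {0<..\<delta>} \<theta>2" and "continuous_on {0<..\<delta>} \<theta>3"
    and "(\<theta>3 \<longlongrightarrow> \<theta>3p) (at_right 0)"
    and "normalized_centered_cluster_config m {i2, i3} \<sigma>"
    and "\<sigma> i2 = of_real (rho_bar m i2 i3) * cis \<phi>2"
    and "\<sigma> i3 = of_real (rho_bar m i3 i2) * cis \<phi>3"
    and "\<phi>2 = \<phi>3 + pi"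
    and "1 < \<alpha> \<longrightarrow> \<bar>\<phi>3 - \<theta>3p\<bar> \<le> pi"
    and "\<alpha> = 1 \<longrightarrow> \<bar>\<phi>3 - \<theta>3p\<bar> < pi"
  shows "\<forall>\<^sub>F \<delta>0 in at_right 0. \<forall>\<eta>>0. \<forall>\<^sub>F \<epsilon>0 in at_right 0.
           \<exists>y \<in> H1_centered_paths m \<delta>.
             action m \<alpha> y \<delta> < action m \<alpha> x \<delta>
             \<and> (\<forall>t\<in>{\<delta>0..\<delta>}. y t = x t)
             \<and> (\<forall>t\<in>{0<..\<delta>}. collision_free (y t))
             \<and> (\<forall>t\<in>{0..\<delta>0}. norm (y t - x t) < \<eta>)
             \<and> y 0 = add_cluster {i2, i3} (x 0) \<epsilon>0 \<sigma>
             \<and> y 0 $ i2 \<noteq> y 0 $ i3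
             \<and> (\<forall>k\<in>{i2, i3}. \<forall>j. j \<notin> {i2, i3} \<longrightarrow> y 0 $ k \<noteq> y 0 $ j)"
proof -
  have m: "0 < m j" for j using assms(4) by blast
  have pq: "i2 \<noteq> i3" by fact
  have \<alpha>: "1 \<le> \<alpha>" "\<alpha> < 2" "0 < \<alpha>" "\<alpha> \<noteq> 0" using assms(1,2) by auto
  have sol: "0 < \<delta>" "x \<in> H1_centered_paths m \<delta>" "\<And>t. t \<in> {0<..\<delta>} \<Longrightarrow> collision_free (x t)"
    "newton_solution_on m \<alpha> {0<..\<delta>} x"
    "\<And>j. j \<in> {i2, i3} \<Longrightarrow> x 0 $ j = cluster_center m {i2, i3} (x 0)"
    "\<And>j. j \<notin> {i2, i3} \<Longrightarrow> x 0 $ j \<noteq> cluster_center m {i2, i3} (x 0)"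
    using assms(6) unfolding isolated_cluster_collision_solution_def by blast+
  define c0 where "c0 = cluster_center m {i2, i3} (x 0)"
  have x1: "H1_path \<delta> x" using sol(2) by (simp add: H1_centered_paths_def)
  have cx: "continuous_on {0..\<delta>} x" by (rule H1_path_imp_continuous_on[OF x1])
  have cf: "collision_free (x t)" if "t \<in> {0<..<\<delta>}" for t using sol(3) that by auto
  obtain v where v: "\<And>t. t \<in> {0<..<\<delta>} \<Longrightarrow> (x has_vector_derivative v t) (at t)"
    "\<And>t. t \<in> {0<..<\<delta>} \<Longrightarrow> (v has_vector_derivative (\<chi> j. acceleration m \<alpha> (x t) j)) (at t)"
    using newton_solution_onE[OF sol(4) cf m \<alpha>(4)] by blast
  have cv: "continuous_on {0<..<\<delta>} v"
    by (rule continuous_at_imp_continuous_on) (use v has_vector_derivative_continuous in blast)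
  have fin: "(\<integral>\<^sup>+t\<in>{0<..<\<delta>}. ennreal (kinetic m (v t) + potential m \<alpha> (x t)) \<partial>lborel) < \<infinity>"
    by (rule newton_solution_finite_action[OF x1 m \<alpha>(3) v cf])
  obtain d \<delta>1 where d: "0 < d" and \<delta>1: "0 < \<delta>1" "\<delta>1 < \<delta>"
    and near: "\<And>t j. t \<in> {0..\<delta>1} \<Longrightarrow> norm (x t $ j - x 0 $ j) \<le> d / 4"
    and far: "\<And>t j. t \<in> {0..\<delta>1} \<Longrightarrow> j \<notin> {i2, i3} \<Longrightarrow> 2 * d \<le> norm (x t $ j - c0)"
    using cluster_separation[OF sol(1) cx, of "{i2, i3}" c0] sol(6) unfolding c0_def by blast
  define r where "r = (\<lambda>t. x t $ i3 - x t $ i2)"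
  define w where "w = (\<lambda>t. v t $ i3 - v t $ i2)"
  define \<kappa> where "\<kappa> = (m i2 + m i3) / \<alpha>"
  have \<kappa>: "0 < \<kappa>" "\<alpha> * \<kappa> = m i2 + m i3" using m[of i2] m[of i3] \<alpha> by (auto simp: \<kappa>_def)
  have bl: "bounded_linear (\<lambda>z::'n config. z $ i3 - z $ i2)"
    by (intro bounded_linear_sub bounded_linear_vec_nth)
  have dr: "(r has_vector_derivative w t) (at t)" if "t \<in> {0<..<\<delta>}" for t
    unfolding r_def w_def by (rule bounded_linear.has_vector_derivative[OF bl v(1)[OF that]])
  have r1: "H1_path \<delta> r" unfolding r_def by (rule H1_path_bounded_linear[OF x1 bl])
  have cr: "continuous_on {0..\<delta>} r" by (rule H1_path_imp_continuous_on[OF r1])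
  have r0: "r 0 = 0" using sol(5)[of i2] sol(5)[of i3] by (simp add: r_def)
  have rnz: "r t \<noteq> 0" if "t \<in> {0<..\<delta>}" for t
    using sol(3)[OF that] pq by (auto simp: r_def collision_free_def)
  have rlim: "(r \<longlongrightarrow> 0) (at_right 0)"
    using continuous_on_Icc_at_rightD[OF cr sol(1)] r0 by simp
  have polar: "r t = of_real (norm (r t)) * cis (\<theta>3 t)" if t: "t \<in> {0<..\<delta>}" for t
  proof -
    have h: "\<theta>2 t = \<theta>3 t + pi"
      "x t $ i2 - cluster_center m {i2, i3} (x t) = of_real (\<rho>2 t) * cis (\<theta>2 t)"
      "x t $ i3 - cluster_center m {i2, i3} (x t) = of_real (\<rho>3 t) * cis (\<theta>3 t)"
      using assms(7) t by blast+
    have "r t = (x t $ i3 - cluster_center m {i2, i3} (x t)) - (x t $ i2 - cluster_center m {i2, i3} (x t))"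
      by (simp add: r_def)
    also have "\<dots> = of_real (\<rho>2 t + \<rho>3 t) * cis (\<theta>3 t)"
      unfolding h cis_add_pi by (simp add: algebra_simps)
    finally have e: "r t = of_real (\<rho>2 t + \<rho>3 t) * cis (\<theta>3 t)" .
    moreover have "norm (r t) = \<rho>2 t + \<rho>3 t"
      unfolding e norm_mult norm_cis norm_of_real using assms(7) t by fastforce
    ultimately show ?thesis by simp
  qed
  \<comment> \<open>The tidal force on the relative motion: what the other bodies add to the Kepler
    attraction of the pair.\<close>
  define F where "F = (\<lambda>t. acceleration m \<alpha> (x t) i3 - acceleration m \<alpha> (x t) i2
      + (\<alpha> * \<kappa> * norm (r t) powr (- \<alpha> - 2)) *\<^sub>R r t)"
  have dw: "(w has_vector_derivative F t - (\<alpha> * \<kappa> * norm (r t) powr (- \<alpha> - 2)) *\<^sub>R r t) (at t)"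
    if "t \<in> {0<..<\<delta>}" for t
    using bounded_linear.has_vector_derivative[OF bl v(2)[OF that]] by (simp add: w_def F_def)
  have F: "norm (F t) \<le> 2 * (\<Sum>j\<in>UNIV. m j) * d powr (- \<alpha> - 1)" if t: "t \<in> {0<..<\<delta>1}" for t
    unfolding F_def r_def \<kappa>(2)
  proof (rule acceleration_pair_diff[OF pq m \<alpha>(3) d])
    fix j assume j: "j \<notin> {i2, i3}"
    have "2 * d \<le> norm (x t $ j - c0)" using far[of t j] t j by auto
    moreover have "norm (x t $ i2 - c0) \<le> d / 4" "norm (x t $ i3 - c0) \<le> d / 4"
      using near[of t i2] near[of t i3] t sol(5)[of i2] sol(5)[of i3] by (auto simp: c0_def)
    ultimately show "d \<le> norm (x t $ i2 - x t $ j) \<and> d \<le> norm (x t $ i3 - x t $ j)"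
      using norm_triangle_ineq2[of "x t $ j - c0" "x t $ i2 - c0"] norm_triangle_ineq2[of "x t $ j - c0" "x t $ i3 - c0"] d
      by (simp add: norm_minus_commute)
  qed
  have fin_w: "(\<integral>\<^sup>+t\<in>{0<..<\<delta>1}. ennreal ((norm (w t))\<^sup>2) \<partial>lborel) < \<infinity>"
  proof (rule H1_path_nn_integral_derivative_finite[OF H1_path_mono[OF r1 less_imp_le[OF \<delta>1(2)]]])
    have "continuous_on {0<..<\<delta>} w" unfolding w_def
      by (rule bounded_linear.continuous_on[OF bl cv])
    then show "continuous_on {0<..<\<delta>1} w" by (rule continuous_on_subset) (use \<delta>1 in auto)
  qed (use dr \<delta>1 in auto)
  have out: "\<forall>\<^sub>F t in at_right 0. 0 < r t \<bullet> w t"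
    and asym: "((\<lambda>t. norm (r t) powr (1 + \<alpha> / 2) / t) \<longlongrightarrow> (1 + \<alpha> / 2) * sqrt (2 * \<kappa>)) (at_right 0)"
    using perturbed_kepler_collision[OF \<alpha>(1,2) \<kappa>(1) \<delta>1(1) dr dw F rnz rlim fin_w] \<delta>1 by auto
  define \<gamma> where "\<gamma> = 1 - \<alpha> / 2"
  have \<gamma>: "0 < \<gamma>" using \<alpha> by (simp add: \<gamma>_def)
  define L where "L = (1 + \<alpha> / 2) * sqrt (2 * \<kappa>)"
  have L: "0 < L" using \<alpha> \<kappa> by (simp add: L_def)
  \<comment> \<open>At \<alpha> = 1 the factor \<gamma> is 1/2 and strictness must come from the
    hypothesis; for larger \<alpha> it comes from \<gamma> < 1/2.\<close>
  have angle: "\<bar>\<gamma> * (\<phi>3 - \<theta>3p)\<bar> < pi / 2"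
  proof (cases "\<alpha> = 1")
    case True
    then show ?thesis using assms(16) by (simp add: \<gamma>_def)
  next
    case False
    then have "\<gamma> * \<bar>\<phi>3 - \<theta>3p\<bar> \<le> \<gamma> * pi" using assms(15) \<alpha> \<gamma> by (intro mult_left_mono) auto
    also have "\<dots> < 1 / 2 * pi" using False \<alpha> by (intro mult_strict_right_mono) (auto simp: \<gamma>_def)
    finally show ?thesis using \<gamma> by (simp add: abs_mult)
  qed
  \<comment> \<open>Half of the limiting cosine, so that the strict inequality persists with
    \<theta>3 at small times in place of its limit.\<close>
  define c where "c = cos (\<gamma> * (\<phi>3 - \<theta>3p)) / 2"
  have "0 < cos (\<gamma> * (\<phi>3 - \<theta>3p))" using angle by (intro cos_gt_zero_pi) auto
  then have c: "0 < c" "c \<le> 1" "c < cos (\<gamma> * (\<phi>3 - \<theta>3p))"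
    using cos_le_one[of "\<gamma> * (\<phi>3 - \<theta>3p)"] unfolding c_def by linarith+
  obtain b \<mu> where b: "0 < b" "b < 1" "0 < \<mu>" "\<mu> < 1"
    "\<And>R \<tau> \<psi>. \<lbrakk>0 < R; 0 < \<tau>; \<bar>\<tau> * L / R powr (1 + \<alpha> / 2) - 1\<bar> \<le> b;
        \<bar>\<gamma> * \<psi>\<bar> < pi / 2; c \<le> cos (\<gamma> * \<psi>)\<rbrakk>
      \<Longrightarrow> \<exists>Z Z' B. continuous_on {0..\<tau>} Z \<and> Z 0 = of_real (b powr (1 / \<gamma>)) * cis \<psi> \<and> Z \<tau> = 1
        \<and> (\<forall>t\<in>{0..\<tau>}. Z t \<noteq> 0 \<and> norm (Z t) \<le> 1)
        \<and> (\<forall>t\<in>{0<..<\<tau>}. (Z has_vector_derivative Z' t) (at t) \<and> norm (Z' t) \<le> B)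
        \<and> continuous_on {0<..<\<tau>} Z'
        \<and> (\<integral>\<^sup>+t\<in>{0<..<\<tau>}. ennreal ((R * norm (Z' t))\<^sup>2 / 2 + \<kappa> * (R * norm (Z t)) powr (- \<alpha>)) \<partial>lborel)
          \<le> ennreal ((1 - \<mu>) * (sqrt (2 * \<kappa>) / \<gamma> * R powr \<gamma>))"
    using shorter_connection[OF \<alpha>(1,2) \<kappa>(1) c(1,2)] unfolding \<gamma>_def[symmetric] L_def[symmetric] by blast
  define K where "K = (\<Sum>j\<in>UNIV. \<Sum>k\<in>UNIV. m j * m k / \<alpha> * d powr (- \<alpha>))"
  define M where "M = m i2 * m i3 / (m i2 + m i3)"
  have M: "0 < M" using m[of i2] m[of i3] by (simp add: M_def)
  define A where "A = (\<lambda>\<tau>. sqrt (2 * \<kappa>) / \<gamma> * norm (r \<tau>) powr \<gamma>)"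
  have ratio: "((\<lambda>\<tau>. \<tau> / norm (r \<tau>) powr (1 + \<alpha> / 2)) \<longlongrightarrow> 1 / L) (at_right 0)"
    using tendsto_inverse[OF asym[folded L_def]] L by (simp add: inverse_eq_divide)
  have "((\<lambda>\<tau>. \<bar>\<tau> / norm (r \<tau>) powr (1 + \<alpha> / 2) * L - 1\<bar>) \<longlongrightarrow> \<bar>1 / L * L - 1\<bar>) (at_right 0)"
    by (intro tendsto_intros ratio)
  then have ev1: "\<forall>\<^sub>F \<tau> in at_right 0. \<bar>\<tau> / norm (r \<tau>) powr (1 + \<alpha> / 2) * L - 1\<bar> < b"
    using order_tendstoD(2)[of _ "\<bar>1 / L * L - 1\<bar>" _ b] L b by simp
  have "((\<lambda>\<tau>. \<bar>\<gamma> * (\<phi>3 - \<theta>3 \<tau>)\<bar>) \<longlongrightarrow> \<bar>\<gamma> * (\<phi>3 - \<theta>3p)\<bar>) (at_right 0)"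
    by (intro tendsto_intros assms(10))
  then have ev2: "\<forall>\<^sub>F \<tau> in at_right 0. \<bar>\<gamma> * (\<phi>3 - \<theta>3 \<tau>)\<bar> < pi / 2"
    by (rule order_tendstoD(2)[OF _ angle])
  have "((\<lambda>\<tau>. cos (\<gamma> * (\<phi>3 - \<theta>3 \<tau>))) \<longlongrightarrow> cos (\<gamma> * (\<phi>3 - \<theta>3p))) (at_right 0)"
    by (intro tendsto_intros assms(10))
  then have ev3: "\<forall>\<^sub>F \<tau> in at_right 0. c < cos (\<gamma> * (\<phi>3 - \<theta>3 \<tau>))"
    by (rule order_tendstoD(1)[OF _ c(3)])
  \<comment> \<open>Equivalent to \<open>K * \<tau> / \<bar>r \<tau>\<bar> powr \<gamma>\<close>
    tending to 0: splitting the exponent \<gamma> as \<open>(1 + \<alpha> / 2) - \<alpha>\<close>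
    leaves a convergent ratio times a positive power of the distance.\<close>
  have "((\<lambda>\<tau>. K * (\<tau> / norm (r \<tau>) powr (1 + \<alpha> / 2)) * norm (r \<tau>) powr \<alpha>) \<longlongrightarrow> K * (1 / L) * 0) (at_right 0)"
    by (intro tendsto_intros ratio tendsto_zero_powrI[OF tendsto_norm_zero[OF rlim] tendsto_const _ \<alpha>(3)]) simp
  then have ev4: "\<forall>\<^sub>F \<tau> in at_right 0. K * (\<tau> / norm (r \<tau>) powr (1 + \<alpha> / 2)) * norm (r \<tau>) powr \<alpha>
      < M * \<mu> * (sqrt (2 * \<kappa>) / \<gamma>)"
    by (rule order_tendstoD(2)) (use M b \<kappa> \<gamma> in simp)
  have ev5: "\<forall>\<^sub>F \<tau> in at_right 0. \<tau> < \<delta>1" using \<delta>1(1) unfolding eventually_at_right_field by auto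
  obtain \<tau>0 where \<tau>0: "0 < \<tau>0" and good: "\<And>\<tau>. 0 < \<tau> \<Longrightarrow> \<tau> < \<tau>0 \<Longrightarrow>
      0 < r \<tau> \<bullet> w \<tau> \<and> \<bar>\<tau> / norm (r \<tau>) powr (1 + \<alpha> / 2) * L - 1\<bar> < b \<and> \<bar>\<gamma> * (\<phi>3 - \<theta>3 \<tau>)\<bar> < pi / 2
      \<and> c < cos (\<gamma> * (\<phi>3 - \<theta>3 \<tau>)) \<and> K * (\<tau> / norm (r \<tau>) powr (1 + \<alpha> / 2)) * norm (r \<tau>) powr \<alpha>
          < M * \<mu> * (sqrt (2 * \<kappa>) / \<gamma>) \<and> \<tau> < \<delta>1"
    using eventually_conj[OF out eventually_conj[OF ev1 eventually_conj[OF ev2 eventually_conj[OF ev3 eventually_conj[OF ev4 ev5]]]]]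
    unfolding eventually_at_right_field by blast
  define s where "s = sqrt ((m i2 + m i3) / (m i2 * m i3))"
  have s: "0 < s" using m[of i2] m[of i3] by (simp add: s_def)
  define \<beta> where "\<beta> = b powr (1 / \<gamma>)"
  have \<beta>: "0 < \<beta>" using b by (simp add: \<beta>_def)
  \<comment> \<open>Every small \<tau> yields a deformation, and \<tau> dictates its size: the
    geodesic starts at relative distance \<open>\<beta> * \<bar>r \<tau>\<bar>\<close>, while the
    normalized configuration has relative length \<open>s\<close>.\<close>
  have deform: "\<exists>y \<in> H1_centered_paths m \<delta>. action m \<alpha> y \<delta> < action m \<alpha> x \<delta>
      \<and> (\<forall>t\<in>{\<tau>..\<delta>}. y t = x t) \<and> (\<forall>t\<in>{0<..\<delta>}. collision_free (y t))
      \<and> (\<forall>t\<in>{0..\<tau>}. norm (y t - x t) \<le> norm (r \<tau>) + norm (r t))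
      \<and> y 0 = add_cluster {i2, i3} (x 0) (\<beta> * norm (r \<tau>) / s) \<sigma>
      \<and> y 0 $ i2 \<noteq> y 0 $ i3 \<and> (\<forall>k\<in>{i2, i3}. \<forall>j. j \<notin> {i2, i3} \<longrightarrow> y 0 $ k \<noteq> y 0 $ j)"
    if \<tau>: "0 < \<tau>" "\<tau> < \<tau>0" for \<tau>
  proof -
    note g = good[OF \<tau>]
    have \<tau>\<delta>: "\<tau> < \<delta>" "\<tau> < \<delta>1" using g \<delta>1 by auto
    have R: "0 < norm (r \<tau>)" using rnz[of \<tau>] \<tau> \<tau>\<delta> by auto
    have g': "\<bar>\<tau> * L / norm (r \<tau>) powr (1 + \<alpha> / 2) - 1\<bar> \<le> b"
      "\<bar>\<gamma> * (\<phi>3 - \<theta>3 \<tau>)\<bar> < pi / 2" "c \<le> cos (\<gamma> * (\<phi>3 - \<theta>3 \<tau>))" using g by auto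
    obtain Z Z' B where Z: "continuous_on {0..\<tau>} Z" "Z 0 = of_real \<beta> * cis (\<phi>3 - \<theta>3 \<tau>)" "Z \<tau> = 1"
        "\<And>t. t \<in> {0..\<tau>} \<Longrightarrow> Z t \<noteq> 0 \<and> norm (Z t) \<le> 1"
        "\<And>t. t \<in> {0<..<\<tau>} \<Longrightarrow> (Z has_vector_derivative Z' t) (at t) \<and> norm (Z' t) \<le> B"
        "continuous_on {0<..<\<tau>} Z'"
        "(\<integral>\<^sup>+t\<in>{0<..<\<tau>}. ennreal ((norm (r \<tau>) * norm (Z' t))\<^sup>2 / 2 + \<kappa> * (norm (r \<tau>) * norm (Z t)) powr (- \<alpha>)) \<partial>lborel)
          \<le> ennreal ((1 - \<mu>) * A \<tau>)"
      using b(5)[OF R \<tau>(1) g'] unfolding \<beta>_def[symmetric] A_def by blast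
    have lower: "ennreal (A \<tau>) \<le> (\<integral>\<^sup>+t\<in>{0<..<\<tau>}. ennreal ((norm (w t))\<^sup>2 / 2 + \<kappa> * norm (r t) powr (- \<alpha>)) \<partial>lborel)"
      unfolding A_def \<gamma>_def
    proof (rule kepler_action_lower_bound[OF \<alpha>(2) \<kappa>(1) \<tau>(1)])
      fix t assume t: "t \<in> {0<..\<tau>}"
      then have "t \<in> {0<..<\<delta>}" "0 < t" "t < \<tau>0" using \<tau> \<tau>\<delta> by auto
      then show "(r has_vector_derivative w t) (at t)" "r t \<noteq> 0" "0 \<le> r t \<bullet> w t"
        using dr[of t] rnz[of t] good[of t] by auto
    qed (rule rlim)
    have A0: "0 < A \<tau>" using \<kappa> \<gamma> R by (simp add: A_def)
    have "K * \<tau> < M * \<mu> * A \<tau>"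
    proof -
      have "1 + \<alpha> / 2 = \<gamma> + \<alpha>" by (simp add: \<gamma>_def)
      then have "norm (r \<tau>) powr (1 + \<alpha> / 2) = norm (r \<tau>) powr \<gamma> * norm (r \<tau>) powr \<alpha>"
        by (simp only: powr_add)
      then have "K * (\<tau> / norm (r \<tau>) powr (1 + \<alpha> / 2)) * norm (r \<tau>) powr \<alpha> = K * \<tau> / norm (r \<tau>) powr \<gamma>"
        using R by simp
      then have "K * \<tau> / norm (r \<tau>) powr \<gamma> < M * \<mu> * (sqrt (2 * \<kappa>) / \<gamma>)" using g by simp
      then show ?thesis using R by (simp add: A_def pos_divide_less_eq mult_ac)
    qed
    then have gain: "M * ((1 - \<mu>) * A \<tau>) + K * \<tau> < M * A \<tau>"
      by (simp add: algebra_simps)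
    \<comment> \<open>The centre, as a weighted mean, moves by at most \<open>d / 4\<close>, and the
      relative vector is at most \<open>d / 2\<close>; together they stay below
      \<open>d\<close>.\<close>
    have cc: "norm (cluster_center m {i2, i3} (x t) - c0) + norm (x \<tau> $ i3 - x \<tau> $ i2) \<le> d" if t: "t \<in> {0..\<tau>}" for t
    proof -
      have n: "norm (x t $ j - c0) \<le> d / 4" if "j \<in> {i2, i3}" "t \<in> {0..\<tau>}" for t j
        using near[of t j] sol(5)[OF that(1)] that \<tau>\<delta> by (auto simp: c0_def)
      have "cluster_center m {i2, i3} (x t) - c0 = (m i2 *\<^sub>R (x t $ i2 - c0) + m i3 *\<^sub>R (x t $ i3 - c0)) /\<^sub>R (m i2 + m i3)"
      proof -
        have e: "m i2 *\<^sub>R (x t $ i2 - c0) + m i3 *\<^sub>R (x t $ i3 - c0)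
            = (m i2 *\<^sub>R x t $ i2 + m i3 *\<^sub>R x t $ i3) - (m i2 + m i3) *\<^sub>R c0"
          by (simp add: algebra_simps)
        have "m i2 + m i3 \<noteq> 0" using m[of i2] m[of i3] by simp
        then show ?thesis unfolding cluster_center_pair[OF pq] e by (simp add: scaleR_diff_right)
      qed
      also have "norm \<dots> \<le> (m i2 * (d / 4) + m i3 * (d / 4)) / (m i2 + m i3)"
      proof -
        have "norm (m i2 *\<^sub>R (x t $ i2 - c0) + m i3 *\<^sub>R (x t $ i3 - c0)) \<le> m i2 * (d / 4) + m i3 * (d / 4)"
        proof (rule order_trans[OF norm_triangle_ineq add_mono])
          show "norm (m i2 *\<^sub>R (x t $ i2 - c0)) \<le> m i2 * (d / 4)"
            using mult_left_mono[OF n[of i2 t] less_imp_le[OF m]] t m[of i2] by simp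
          show "norm (m i3 *\<^sub>R (x t $ i3 - c0)) \<le> m i3 * (d / 4)"
            using mult_left_mono[OF n[of i3 t] less_imp_le[OF m]] t m[of i3] by simp
        qed
        moreover have "0 < m i2 + m i3" using m[of i2] m[of i3] by simp
        ultimately show ?thesis
          by (simp only: norm_scaleR abs_inverse abs_of_pos divide_inverse_commute)
            (rule mult_left_mono, simp_all)
      qed
      also have "\<dots> = d / 4" using m[of i2] m[of i3] by (simp add: distrib_right[symmetric])
      finally have "norm (cluster_center m {i2, i3} (x t) - c0) \<le> d / 4" .
      moreover have "norm (x \<tau> $ i3 - x \<tau> $ i2) \<le> d / 4 + d / 4"
        using n[of i2 \<tau>] n[of i3 \<tau>] \<tau> norm_triangle_ineq4[of "x \<tau> $ i3 - c0" "x \<tau> $ i2 - c0"] by simp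
      ultimately show ?thesis using d by simp
    qed
    have far': "2 * d \<le> norm (x t $ j - c0)" if "t \<in> {0..\<tau>}" "j \<notin> {i2, i3}" for t j
      using far[of t j] that \<tau>\<delta> by auto
    let ?y = "\<lambda>t. if t \<le> \<tau> then pair_collapse m i2 i3 (x t) + pair_spread m i2 i3 ((x \<tau> $ i3 - x \<tau> $ i2) * Z t) else x t"
    have pos: "0 \<le> (1 - \<mu>) * A \<tau>" using A0 b(4) by simp
    note D = pair_deformation[OF pq m \<alpha>(3) \<tau>(1) \<tau>\<delta>(1) sol(2) v(1) cv sol(3) fin d cc far' Z(1,3,4,5,6)
        lower[unfolded r_def w_def \<kappa>_def] Z(7)[unfolded r_def \<kappa>_def] less_imp_le[OF A0] pos gain[unfolded M_def K_def]]
    \<comment> \<open>The starting angle of \<open>Z\<close> is measured from the direction of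
      \<open>r \<tau>\<close>, so multiplication restores the absolute angle \<phi>3.\<close>
    have y0: "?y 0 = add_cluster {i2, i3} (x 0) (\<beta> * norm (r \<tau>) / s) \<sigma>"
    proof -
      have "r \<tau> * Z 0 = of_real (norm (r \<tau>)) * cis (\<theta>3 \<tau>) * (of_real \<beta> * cis (\<phi>3 - \<theta>3 \<tau>))"
        using polar[of \<tau>] \<tau> \<tau>\<delta> Z(2) by simp
      also have "\<dots> = of_real (\<beta> * norm (r \<tau>)) * (cis (\<theta>3 \<tau>) * cis (\<phi>3 - \<theta>3 \<tau>))"
        by simp
      also have "\<dots> = of_real (\<beta> * norm (r \<tau>) / s * s) * cis \<phi>3"
        using s by (simp add: cis_mult)
      finally have "r \<tau> * Z 0 = of_real (\<beta> * norm (r \<tau>) / s * s) * cis \<phi>3" .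
      moreover have "add_cluster {i2, i3} (x 0) (\<beta> * norm (r \<tau>) / s) \<sigma> = pair_collapse m i2 i3 (x 0)
        + pair_spread m i2 i3 (of_real (\<beta> * norm (r \<tau>) / s * s) * cis \<phi>3)"
        unfolding s_def
        by (rule add_cluster_pair[OF pq m m sol(5) sol(5)]) (use assms(12-14) in auto)
      ultimately show ?thesis using \<tau> by (simp add: r_def)
    qed
    have "action m \<alpha> ?y \<delta> < action m \<alpha> x \<delta>" "?y \<in> H1_centered_paths m \<delta>" by (rule D; assumption)+
    moreover have "\<forall>t\<in>{\<tau>..\<delta>}. ?y t = x t" by (intro ballI) (rule D(3); assumption)
    moreover have "\<forall>t\<in>{0<..\<delta>}. collision_free (?y t)" by (intro ballI) (rule D(4); assumption)
    moreover have "\<forall>t\<in>{0..\<tau>}. norm (?y t - x t) \<le> norm (r \<tau>) + norm (r t)"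
      unfolding r_def by (intro ballI) (rule D(5); assumption)
    moreover have "?y 0 $ i2 \<noteq> ?y 0 $ i3" by (rule D(6); assumption)
    moreover have "\<forall>k\<in>{i2, i3}. \<forall>j. j \<notin> {i2, i3} \<longrightarrow> ?y 0 $ k \<noteq> ?y 0 $ j"
      by (intro ballI allI impI) (rule D(7); assumption)
    ultimately show ?thesis using y0 by (intro bexI[of _ ?y] conjI)
  qed
  have cn: "continuous_on {0..\<delta>} (\<lambda>t. norm (r t))" by (intro continuous_on_norm cr)
  show ?thesis
    unfolding eventually_at_right_field[of "\<lambda>\<delta>0. \<forall>\<eta>>0. _ \<delta>0 \<eta>"]
  proof (intro exI[of _ \<delta>] conjI sol(1) allI impI)
    fix \<delta>0 \<eta> :: real assume \<delta>0: "0 < \<delta>0" "\<delta>0 < \<delta>" and \<eta>: "0 < \<eta>"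
    have "\<forall>\<^sub>F t in at_right 0. norm (r t) < \<eta> / 2"
      using tendsto_norm_zero[OF rlim] \<eta> by (intro order_tendstoD) auto
    then obtain e where e: "0 < e" "\<And>t. 0 < t \<Longrightarrow> t < e \<Longrightarrow> norm (r t) < \<eta> / 2"
      unfolding eventually_at_right_field by blast
    define \<tau>1 where "\<tau>1 = min (min e \<tau>0) \<delta>0 / 2"
    have \<tau>1: "0 < \<tau>1" "\<tau>1 < e" "\<tau>1 < \<tau>0" "\<tau>1 < \<delta>0" using e \<tau>0 \<delta>0 by (auto simp: \<tau>1_def)
    have small: "norm (r t) < \<eta> / 2" if "0 \<le> t" "t \<le> \<tau>1" for t
      using e(2)[of t] that \<tau>1 r0 \<eta> by (cases "t = 0") auto
    have R1: "0 < norm (r \<tau>1)" using rnz[of \<tau>1] \<tau>1 \<delta>0 by auto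
    show "\<forall>\<^sub>F \<epsilon>0 in at_right 0. \<exists>y \<in> H1_centered_paths m \<delta>.
             action m \<alpha> y \<delta> < action m \<alpha> x \<delta>
             \<and> (\<forall>t\<in>{\<delta>0..\<delta>}. y t = x t)
             \<and> (\<forall>t\<in>{0<..\<delta>}. collision_free (y t))
             \<and> (\<forall>t\<in>{0..\<delta>0}. norm (y t - x t) < \<eta>)
             \<and> y 0 = add_cluster {i2, i3} (x 0) \<epsilon>0 \<sigma>
             \<and> y 0 $ i2 \<noteq> y 0 $ i3
             \<and> (\<forall>k\<in>{i2, i3}. \<forall>j. j \<notin> {i2, i3} \<longrightarrow> y 0 $ k \<noteq> y 0 $ j)"
      unfolding eventually_at_right_field
    proof (intro exI[of _ "\<beta> * norm (r \<tau>1) / s"] conjI allI impI)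
      show "0 < \<beta> * norm (r \<tau>1) / s" using \<beta> R1 s by simp
      fix \<epsilon>0 assume \<epsilon>0: "0 < \<epsilon>0" "\<epsilon>0 < \<beta> * norm (r \<tau>1) / s"
      have "norm (r 0) \<le> \<epsilon>0 * s / \<beta>" "\<epsilon>0 * s / \<beta> \<le> norm (r \<tau>1)"
        using \<epsilon>0 s \<beta> r0 by (auto simp: field_simps)
      \<comment> \<open>The distance of the pair is continuous and starts at 0, so every smaller
        value is attained. Its preimage \<tau> may be anywhere in \<open>{0..\<tau>1}\<close>, which
        is why the estimates are uniform there.\<close>
      then obtain \<tau> where \<tau>: "0 \<le> \<tau>" "\<tau> \<le> \<tau>1" "norm (r \<tau>) = \<epsilon>0 * s / \<beta>"
        using IVT'[of "\<lambda>t. norm (r t)" 0 _ \<tau>1] continuous_on_subset[OF cn, of "{0..\<tau>1}"] \<tau>1 \<delta>0 by auto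
      have "\<tau> \<noteq> 0" using \<tau>(3) \<epsilon>0 s \<beta> r0 by auto
      then have \<tau>pos: "0 < \<tau>" "\<tau> < \<tau>0" using \<tau> \<tau>1 by auto
      have \<epsilon>eq: "\<beta> * norm (r \<tau>) / s = \<epsilon>0" using \<tau>(3) s \<beta> by simp
      obtain y where y: "y \<in> H1_centered_paths m \<delta>" "action m \<alpha> y \<delta> < action m \<alpha> x \<delta>"
        "\<And>t. t \<in> {\<tau>..\<delta>} \<Longrightarrow> y t = x t" "\<forall>t\<in>{0<..\<delta>}. collision_free (y t)"
        "\<And>t. t \<in> {0..\<tau>} \<Longrightarrow> norm (y t - x t) \<le> norm (r \<tau>) + norm (r t)"
        "y 0 = add_cluster {i2, i3} (x 0) \<epsilon>0 \<sigma>"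
        "y 0 $ i2 \<noteq> y 0 $ i3" "\<forall>k\<in>{i2, i3}. \<forall>j. j \<notin> {i2, i3} \<longrightarrow> y 0 $ k \<noteq> y 0 $ j"
        using deform[OF \<tau>pos] unfolding \<epsilon>eq by blast
      have "y t = x t" if "t \<in> {\<delta>0..\<delta>}" for t using y(3)[of t] that \<tau> \<tau>1 by auto
      moreover have "norm (y t - x t) < \<eta>" if t: "t \<in> {0..\<delta>0}" for t
      proof (cases "t \<le> \<tau>")
        case True
        have "norm (y t - x t) \<le> norm (r \<tau>) + norm (r t)" "norm (r t) < \<eta> / 2" "norm (r \<tau>) < \<eta> / 2"
          by (rule y(5) small; use True t \<tau> in simp)+
        then show ?thesis by linarith
      next
        case False
        then show ?thesis using y(3)[of t] t \<delta>0 \<eta> by auto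
      qed
      ultimately show "\<exists>y \<in> H1_centered_paths m \<delta>.
             action m \<alpha> y \<delta> < action m \<alpha> x \<delta>
             \<and> (\<forall>t\<in>{\<delta>0..\<delta>}. y t = x t)
             \<and> (\<forall>t\<in>{0<..\<delta>}. collision_free (y t))
             \<and> (\<forall>t\<in>{0..\<delta>0}. norm (y t - x t) < \<eta>)
             \<and> y 0 = add_cluster {i2, i3} (x 0) \<epsilon>0 \<sigma>
             \<and> y 0 $ i2 \<noteq> y 0 $ i3
             \<and> (\<forall>k\<in>{i2, i3}. \<forall>j. j \<notin> {i2, i3} \<longrightarrow> y 0 $ k \<noteq> y 0 $ j)"
        using y(1,2,4,6-8) by blast
    qed
  qed
qed

end
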